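(* For any $x_2\in\mathbb{C}$ with $x_2\ne0$ there exists a unique, up to unitary equivalence, irreducible well-behaved $*$-representation of $A_{0,x_2}$; it acts on $l_2(\mathbb{Z}_+)^{\otimes3}$ and is defined by $$a_2=a\otimes\mathbf1\otimes\mathbf1,$$ $$a_1=-\Bigl(\mathbf1\otimes\mathbf1\otimes a+\frac{\overline{x}_2}{2}\mathbf1\otimes a^2\otimes\mathbf1+|x_2|\,a^*\otimes a\otimes\mathbf1+\frac{x_2}{2}(a^* )^2\otimes\mathbf1\otimes\mathbf1\Bigr),$$ $$A=|x_2|\,\mathbf1\otimes a\otimes\mathbf1+x_2\,a^*\otimes\mathbf1\otimes\mathbf1.$$
   Context: $A_{0,x_2}$ is the unital $*$-algebra generated by $a_1,a_2,A$ with relations $a_i^*a_i-a_ia_i^*=1$ ($i=1,2$), $a_1^*a_2=a_2a_1^*$, $A=a_2a_1-a_1a_2$, $Aa_1-a_1A=0$, $Aa_2-a_2A=x_21$, $a_i^*A=Aa_i^*$ ($i=1,2$). $A_3$ is the unital $*$-algebra of the CCR with three degrees of freedom, generated by $c_1,c_2,c_3$ with $c_i^*c_i-c_ic_i^*=1$ for all $i$ and $c_i^*c_j=c_jc_i^*$, $c_ic_j=c_jc_i$ for $i\ne j$. For $x_2\ne0$ there is a $*$-isomorphism $A_{0,x_2}\to A_3$ given by $a_2\mapsto c_1$, $A\mapsto|x_2|c_2+x_2c_1^*$, $a_1\mapsto-\bigl(c_3+\frac{\overline{x}_2}{2}c_2^2+|x_2|c_1^*c_2+\frac{x_2}{2}(c_1^*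 )^2\bigr)$. A (generally unbounded) $*$-representation of $A_3$ is well-behaved if it is integrable, i.e. it is the differential, on the space of smooth vectors, of a strongly continuous unitary representation of the (7-dimensional) Heisenberg Lie group. A $*$-representation of $A_{0,x_2}$ is well-behaved if the representation of $A_3$ corresponding to it under the $*$-isomorphism $A_{0,x_2}\to A_3$ with $a_2\mapsto c_1$, $A\mapsto|x_2|c_2+x_2c_1^*$, $a_1\mapsto-\bigl(c_3+\frac{\overline{x}_2}{2}c_2^2+|x_2|c_1^*c_2+\frac{x_2}{2}(c_1^* )^2\bigr)$ is well-behaved. $l_2(\mathbb{Z}_+)$ has standard orthonormal basis $\{e_n\}_{n\ge0}$, and $a e_n=\sqrt{n+1}\,e_{n+1}$, so $a^*e_n=\sqrt{n}\,e_{n-1}$ and $a^*e_0=0$; the formulas are understood on the corresponding domain of smooth vectors (rapidly decreasing sequences). *)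

theory Defs
  imports "HOL-Analysis.Analysis"
begin

section \<open>Complex Hilbert spaces\<close>

text \<open>
  The complex structure is compatible with the real inner product space structure, so that norm,
  topology and vector-valued derivatives are those of the library.  The complex inner product is
  linear in its first argument.
\<close>

class complex_inner = real_inner +
  fixes scaleC :: "complex \<Rightarrow> 'a \<Rightarrow> 'a"  (infixr "*\<^sub>C" 75)
    and cinner :: "'a \<Rightarrow> 'a \<Rightarrow> complex"
  assumes scaleC_add_right: "c *\<^sub>C (x + y) = c *\<^sub>C x + c *\<^sub>C y"
    and scaleC_add_left: "(c + d) *\<^sub>C x = c *\<^sub>C x + d *\<^sub>C x"
    and scaleC_scaleC: "c *\<^sub>C d *\<^sub>C x = (c * d) *\<^sub>C x"
    and scaleR_scaleC: "r *\<^sub>R x = complex_of_real r *\<^sub>C x"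
    and cinner_commute: "cinner x y = cnj (cinner y x)"
    and cinner_add_left: "cinner (x + y) z = cinner x z + cinner y z"
    and cinner_scaleC_left: "cinner (c *\<^sub>C x) y = c * cinner x y"
    and inner_eq_Re_cinner: "inner x y = Re (cinner x y)"

class chilbert_space = complex_inner + complete_space

definition csubspace :: "'h::complex_inner set \<Rightarrow> bool" where
  "csubspace K \<longleftrightarrow> 0 \<in> K \<and> (\<forall>x\<in>K. \<forall>y\<in>K. x + y \<in> K) \<and> (\<forall>c. \<forall>x\<in>K. c *\<^sub>C x \<in> K)"

definition ortho_compl :: "'h::complex_inner set \<Rightarrow> 'h set" where
  "ortho_compl K = {y. \<forall>x\<in>K. cinner x y = 0}"

definition clinear_on :: "'h::complex_inner set \<Rightarrow> ('h \<Rightarrow> 'k::complex_inner) \<Rightarrow> bool" where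
  "clinear_on D T \<longleftrightarrow>
     (\<forall>x\<in>D. \<forall>y\<in>D. T (x + y) = T x + T y) \<and> (\<forall>c. \<forall>x\<in>D. T (c *\<^sub>C x) = c *\<^sub>C T x)"

definition unitary :: "('h::complex_inner \<Rightarrow> 'k::complex_inner) \<Rightarrow> bool" where
  "unitary T \<longleftrightarrow> clinear_on UNIV T \<and> surj T \<and> (\<forall>x y. cinner (T x) (T y) = cinner x y)"


section \<open>Unital \<open>*\<close>-algebras given by generators and relations\<close>

text \<open>
  The unital complex \<open>*\<close>-algebra with generators \<open>'g\<close> and relations \<open>R\<close> is the quotient of the
  set of formal expressions by the least congruence \<open>star_cong R\<close> that contains \<open>R\<close> and makes
  the quotient a unital \<open>*\<close>-algebra.  \<open>Const c\<close> stands for \<open>c\<close> times the unit.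
\<close>

datatype 'g star_expr =
    Gen 'g
  | Const complex
  | Add "'g star_expr" "'g star_expr"  (infixl "\<oplus>" 65)
  | Mul "'g star_expr" "'g star_expr"  (infixl "\<odot>" 70)
  | Star "'g star_expr"  ("_\<^sup>\<star>" [1000] 1000)

abbreviation Sub :: "'g star_expr \<Rightarrow> 'g star_expr \<Rightarrow> 'g star_expr"  (infixl "\<ominus>" 65) where
  "s \<ominus> t \<equiv> s \<oplus> Const (- 1) \<odot> t"

inductive star_cong ::
  "('g star_expr \<times> 'g star_expr) set \<Rightarrow> 'g star_expr \<Rightarrow> 'g star_expr \<Rightarrow> bool"
  for R where
  sc_rel: "(s, t) \<in> R \<Longrightarrow> star_cong R s t"
| sc_refl: "star_cong R s s"
| sc_sym: "star_cong R s t \<Longrightarrow> star_cong R t s"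
| sc_trans: "star_cong R s t \<Longrightarrow> star_cong R t u \<Longrightarrow> star_cong R s u"
| sc_cong_add: "star_cong R s s' \<Longrightarrow> star_cong R t t' \<Longrightarrow> star_cong R (s \<oplus> t) (s' \<oplus> t')"
| sc_cong_mul: "star_cong R s s' \<Longrightarrow> star_cong R t t' \<Longrightarrow> star_cong R (s \<odot> t) (s' \<odot> t')"
| sc_cong_star: "star_cong R s s' \<Longrightarrow> star_cong R (s\<^sup>\<star>) (s'\<^sup>\<star>)"
| sc_add_assoc: "star_cong R (s \<oplus> t \<oplus> u) (s \<oplus> (t \<oplus> u))"
| sc_add_commute: "star_cong R (s \<oplus> t) (t \<oplus> s)"
| sc_add_zero: "star_cong R (Const 0 \<oplus> s) s"
| sc_mul_zero: "star_cong R (Const 0 \<odot> s) (Const 0)"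
| sc_mul_assoc: "star_cong R (s \<odot> t \<odot> u) (s \<odot> (t \<odot> u))"
| sc_mul_one: "star_cong R (Const 1 \<odot> s) s"
| sc_distrib_left: "star_cong R (s \<odot> (t \<oplus> u)) (s \<odot> t \<oplus> s \<odot> u)"
| sc_distrib_right: "star_cong R ((s \<oplus> t) \<odot> u) (s \<odot> u \<oplus> t \<odot> u)"
| sc_const_add: "star_cong R (Const (c + d)) (Const c \<oplus> Const d)"
| sc_const_mul: "star_cong R (Const (c * d)) (Const c \<odot> Const d)"
| sc_const_central: "star_cong R (Const c \<odot> s) (s \<odot> Const c)"
| sc_star_const: "star_cong R ((Const c)\<^sup>\<star>) (Const (cnj c))"
| sc_star_add: "star_cong R ((s \<oplus> t)\<^sup>\<star>) (s\<^sup>\<star> \<oplus> t\<^sup>\<star>)"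
| sc_star_mul: "star_cong R ((s \<odot> t)\<^sup>\<star>) (t\<^sup>\<star> \<odot> s\<^sup>\<star>)"
| sc_star_star: "star_cong R (s\<^sup>\<star>\<^sup>\<star>) s"

text \<open>The extension of an assignment of the generators to a \<open>*\<close>-homomorphism.\<close>

primrec star_subst :: "('g \<Rightarrow> 'k star_expr) \<Rightarrow> 'g star_expr \<Rightarrow> 'k star_expr" where
  "star_subst \<phi> (Gen g) = \<phi> g"
| "star_subst \<phi> (Const c) = Const c"
| "star_subst \<phi> (s \<oplus> t) = star_subst \<phi> s \<oplus> star_subst \<phi> t"
| "star_subst \<phi> (s \<odot> t) = star_subst \<phi> s \<odot> star_subst \<phi> t"
| "star_subst \<phi> (s\<^sup>\<star>) = (star_subst \<phi> s)\<^sup>\<star>"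

text \<open>The algebra of the CCR; \<open>Gen i\<close> is the creation operator of the \<open>i\<close>-th degree of freedom.\<close>

definition ccr_rels :: "('n::finite star_expr \<times> 'n star_expr) set" where
  "ccr_rels =
     {((Gen i)\<^sup>\<star> \<odot> Gen i \<ominus> Gen i \<odot> (Gen i)\<^sup>\<star>, Const 1) | i. True} \<union>
     {((Gen i)\<^sup>\<star> \<odot> Gen j, Gen j \<odot> (Gen i)\<^sup>\<star>) | i j. i \<noteq> j} \<union>
     {(Gen i \<odot> Gen j, Gen j \<odot> Gen i) | i j. i \<noteq> j}"

datatype gen = G_a1 | G_a2 | G_A

definition A0_rels :: "complex \<Rightarrow> (gen star_expr \<times> gen star_expr) set" where
  "A0_rels x2 =
    (let a1 = Gen G_a1; a2 = Gen G_a2; A = Gen G_A in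
     {(a1\<^sup>\<star> \<odot> a1 \<ominus> a1 \<odot> a1\<^sup>\<star>, Const 1),
      (a2\<^sup>\<star> \<odot> a2 \<ominus> a2 \<odot> a2\<^sup>\<star>, Const 1),
      (a1\<^sup>\<star> \<odot> a2, a2 \<odot> a1\<^sup>\<star>),
      (A, a2 \<odot> a1 \<ominus> a1 \<odot> a2),
      (A \<odot> a1 \<ominus> a1 \<odot> A, Const 0),
      (A \<odot> a2 \<ominus> a2 \<odot> A, Const x2),
      (a1\<^sup>\<star> \<odot> A, A \<odot> a1\<^sup>\<star>),
      (a2\<^sup>\<star> \<odot> A, A \<odot> a2\<^sup>\<star>)})"

text \<open>
  For \<open>x2 \<noteq> 0\<close>, the map on generators that induces the \<open>*\<close>-isomorphism of the algebra
  presented by \<open>A0_rels x2\<close> onto the CCR algebra with three degrees of freedom.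
\<close>

primrec A0_iso_gen :: "complex \<Rightarrow> gen \<Rightarrow> 3 star_expr" where
  "A0_iso_gen x2 G_a2 = Gen 1"
| "A0_iso_gen x2 G_A = Const (cmod x2) \<odot> Gen 2 \<oplus> Const x2 \<odot> (Gen 1)\<^sup>\<star>"
| "A0_iso_gen x2 G_a1 =
     Const (- 1) \<odot> (Gen 3 \<oplus> Const (cnj x2 / 2) \<odot> (Gen 2 \<odot> Gen 2)
       \<oplus> Const (cmod x2) \<odot> ((Gen 1)\<^sup>\<star> \<odot> Gen 2)
       \<oplus> Const (x2 / 2) \<odot> ((Gen 1)\<^sup>\<star> \<odot> (Gen 1)\<^sup>\<star>))"

definition A0_iso :: "complex \<Rightarrow> gen star_expr \<Rightarrow> 3 star_expr" where
  "A0_iso x2 = star_subst (A0_iso_gen x2)"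


section \<open>Unbounded \<open>*\<close>-representations\<close>

text \<open>
  A \<open>*\<close>-representation of the \<open>*\<close>-algebra with relations \<open>R\<close>, by operators on a common invariant
  dense domain \<open>D\<close>.  The values of \<open>\<pi> t\<close> outside \<open>D\<close> are irrelevant.
\<close>

definition star_rep ::
  "('g star_expr \<times> 'g star_expr) set \<Rightarrow> 'h::chilbert_space set \<Rightarrow> ('g star_expr \<Rightarrow> 'h \<Rightarrow> 'h) \<Rightarrow> bool"
where
  "star_rep R D \<pi> \<longleftrightarrow>
     csubspace D \<and> closure D = UNIV \<and>
     (\<forall>t. clinear_on D (\<pi> t) \<and> \<pi> t ` D \<subseteq> D) \<and>
     (\<forall>v\<in>D.
        (\<forall>s t. star_cong R s t \<longrightarrow> \<pi> s v = \<pi> t v) \<and>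
        (\<forall>c. \<pi> (Const c) v = c *\<^sub>C v) \<and>
        (\<forall>s t. \<pi> (s \<oplus> t) v = \<pi> s v + \<pi> t v) \<and>
        (\<forall>s t. \<pi> (s \<odot> t) v = \<pi> s (\<pi> t v))) \<and>
     (\<forall>t. \<forall>u\<in>D. \<forall>v\<in>D. cinner (\<pi> t u) v = cinner u (\<pi> (t\<^sup>\<star>) v))"

text \<open>
  Irreducibility: the space is nonzero and the representation is not the direct sum of two
  nonzero subrepresentations, acting on \<open>D \<inter> K\<close> and \<open>D \<inter> ortho_compl K\<close> for a closed subspace \<open>K\<close>.
\<close>

definition irreducible_rep :: "'h::chilbert_space set \<Rightarrow> ('g star_expr \<Rightarrow> 'h \<Rightarrow> 'h) \<Rightarrow> bool" where
  "irreducible_rep D \<pi> \<longleftrightarrow>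
     (\<exists>v::'h. v \<noteq> 0) \<and>
     (\<forall>K. csubspace K \<and> closed K \<and>
        (\<forall>v\<in>D. \<exists>u \<in> D \<inter> K. \<exists>w \<in> D \<inter> ortho_compl K. v = u + w) \<and>
        (\<forall>t. \<pi> t ` (D \<inter> K) \<subseteq> K) \<and> (\<forall>t. \<pi> t ` (D \<inter> ortho_compl K) \<subseteq> ortho_compl K)
        \<longrightarrow> K = {0} \<or> K = UNIV)"

definition unitarily_equivalent ::
  "'h::chilbert_space set \<Rightarrow> ('g star_expr \<Rightarrow> 'h \<Rightarrow> 'h) \<Rightarrow>
   'k::chilbert_space set \<Rightarrow> ('g star_expr \<Rightarrow> 'k \<Rightarrow> 'k) \<Rightarrow> bool" where
  "unitarily_equivalent D \<pi> D' \<pi>' \<longleftrightarrow>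
     (\<exists>T. unitary T \<and> T ` D = D' \<and> (\<forall>t. \<forall>v\<in>D. T (\<pi> t v) = \<pi>' t (T v)))"


section \<open>The Heisenberg group and integrable representations\<close>

primrec C_k :: "nat \<Rightarrow> ('a::real_normed_vector \<Rightarrow> 'b::real_normed_vector) \<Rightarrow> bool" where
  "C_k 0 f \<longleftrightarrow> continuous_on UNIV f"
| "C_k (Suc k) f \<longleftrightarrow>
     (\<forall>x. f differentiable (at x)) \<and> (\<forall>v. C_k k (\<lambda>x. frechet_derivative f (at x) v))"

definition smooth :: "('a::euclidean_space \<Rightarrow> 'b::real_normed_vector) \<Rightarrow> bool" where
  "smooth f \<longleftrightarrow> (\<forall>k. C_k k f)"

text \<open>
  The Heisenberg group of dimension \<open>2 * CARD('n) + 1\<close> in exponential coordinates: elements are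
  triples \<open>(p, q, t)\<close>, the Lie algebra is the same vector space with bracket
  \<open>[(p, q, t), (p', q', t')] = (0, 0, p \<bullet> q' - q \<bullet> p')\<close>, the exponential map is the identity, and
  the group law is the Baker-Campbell-Hausdorff formula \<open>X + Y + [X, Y] / 2\<close>.
\<close>

type_synonym 'n heis = "(real ^ 'n) \<times> (real ^ 'n) \<times> real"

definition heis_mult :: "'n::finite heis \<Rightarrow> 'n heis \<Rightarrow> 'n heis" where
  "heis_mult g h = (case (g, h) of ((p, q, t), (p', q', t')) \<Rightarrow>
     (p + p', q + q', t + t' + (p \<bullet> q' - q \<bullet> p') / 2))"

definition heis_rep :: "('n::finite heis \<Rightarrow> 'h::chilbert_space \<Rightarrow> 'h) \<Rightarrow> bool" where
  "heis_rep U \<longleftrightarrow>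
     (\<forall>g. unitary (U g)) \<and> (\<forall>g h v. U (heis_mult g h) v = U g (U h v)) \<and>
     (\<forall>v. continuous_on UNIV (\<lambda>g. U g v))"

definition smooth_vectors :: "('n::finite heis \<Rightarrow> 'h::chilbert_space \<Rightarrow> 'h) \<Rightarrow> 'h set" where
  "smooth_vectors U = {v. smooth (\<lambda>g. U g v)}"

text \<open>
  The action of the Lie algebra in a representation of the CCR algebra.  With position and momentum
  \<open>Q = (c\<^sup>\<star> + c) / sqrt 2\<close>, \<open>P = (c\<^sup>\<star> - c) / (\<i> sqrt 2)\<close>, the element \<open>(p, q, t)\<close> acts as
  \<open>\<i> (p \<bullet> P + q \<bullet> Q + t)\<close>; in particular \<open>(0, 0, 1)\<close> acts as the scalar \<open>\<i>\<close>.
\<close>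

definition heis_lie_act ::
  "('n::finite star_expr \<Rightarrow> 'h::chilbert_space \<Rightarrow> 'h) \<Rightarrow> 'n heis \<Rightarrow> 'h \<Rightarrow> 'h" where
  "heis_lie_act \<rho> X v = (case X of (p, q, t) \<Rightarrow>
     (\<Sum>j\<in>UNIV.
        complex_of_real (p $ j / sqrt 2) *\<^sub>C (\<rho> ((Gen j)\<^sup>\<star>) v - \<rho> (Gen j) v) +
        (\<i> * complex_of_real (q $ j / sqrt 2)) *\<^sub>C (\<rho> ((Gen j)\<^sup>\<star>) v + \<rho> (Gen j) v)) +
     (\<i> * complex_of_real t) *\<^sub>C v)"

definition integrable_rep ::
  "'h::chilbert_space set \<Rightarrow> ('n::finite star_expr \<Rightarrow> 'h \<Rightarrow> 'h) \<Rightarrow> bool" where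
  "integrable_rep D \<rho> \<longleftrightarrow>
     (\<exists>U::'n heis \<Rightarrow> 'h \<Rightarrow> 'h. heis_rep U \<and> D = smooth_vectors U \<and>
        (\<forall>X. \<forall>v\<in>D. ((\<lambda>s. U (s *\<^sub>R X) v) has_vector_derivative heis_lie_act \<rho> X v) (at 0)))"

definition A0_star_rep ::
  "complex \<Rightarrow> 'h::chilbert_space set \<Rightarrow> (gen star_expr \<Rightarrow> 'h \<Rightarrow> 'h) \<Rightarrow> bool" where
  "A0_star_rep x2 = star_rep (A0_rels x2)"

definition A0_well_behaved ::
  "complex \<Rightarrow> 'h::chilbert_space set \<Rightarrow> (gen star_expr \<Rightarrow> 'h \<Rightarrow> 'h) \<Rightarrow> bool" where
  "A0_well_behaved x2 D \<pi> \<longleftrightarrow>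
     (\<exists>\<rho>. star_rep ccr_rels D \<rho> \<and> integrable_rep D \<rho> \<and>
        (\<forall>t. \<forall>v\<in>D. \<pi> t v = \<rho> (A0_iso x2 t) v))"


section \<open>The Hilbert space of square summable families\<close>

definition sq_summable :: "('i \<Rightarrow> complex) \<Rightarrow> bool" where
  "sq_summable f \<longleftrightarrow> (\<lambda>i. (cmod (f i))\<^sup>2) summable_on UNIV"

lemma sq_summableI:
  assumes "\<And>F. finite F \<Longrightarrow> (\<Sum>i\<in>F. (cmod (f i))\<^sup>2) \<le> B"
  shows "sq_summable f"
  unfolding sq_summable_def
  by (rule nonneg_bdd_above_summable_on) (auto intro!: bdd_aboveI2 assms)

lemma sq_summable_zero: "sq_summable (\<lambda>_. 0)"
  by (simp add: sq_summable_def)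

lemma sq_summable_scale:
  assumes "sq_summable f"
  shows "sq_summable (\<lambda>i. c * f i)"
  using summable_on_cmult_right[OF assms[unfolded sq_summable_def], of "(cmod c)\<^sup>2"]
  by (simp add: sq_summable_def norm_mult power_mult_distrib)

lemma cmod_add_sq_le: "(cmod (x + y))\<^sup>2 \<le> 2 * (cmod x)\<^sup>2 + 2 * (cmod y)\<^sup>2"
proof -
  have "(cmod (x + y))\<^sup>2 \<le> (cmod x + cmod y)\<^sup>2"
    by (simp add: norm_triangle_ineq power_mono)
  also have "\<dots> \<le> 2 * (cmod x)\<^sup>2 + 2 * (cmod y)\<^sup>2"
    using sum_squares_bound[of "cmod x" "cmod y"] by (simp add: power2_sum)
  finally show ?thesis .
qed

lemma sq_summable_add:
  assumes "sq_summable f" "sq_summable g"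
  shows "sq_summable (\<lambda>i. f i + g i)"
  unfolding sq_summable_def
proof (rule summable_on_comparison_test)
  show "(\<lambda>i. 2 * (cmod (f i))\<^sup>2 + 2 * (cmod (g i))\<^sup>2) summable_on UNIV"
    using assms unfolding sq_summable_def
    by (intro summable_on_add summable_on_cmult_right)
qed (auto simp: cmod_add_sq_le)

lemma sq_summable_prod:
  assumes "sq_summable f" "sq_summable g"
  shows "(\<lambda>i. f i * cnj (g i)) summable_on UNIV"
proof (rule abs_summable_summable, rule Infinite_Sum.abs_summable_on_comparison_test')
  show "(\<lambda>i. (cmod (f i))\<^sup>2 + (cmod (g i))\<^sup>2) summable_on UNIV"
    using assms unfolding sq_summable_def by (rule summable_on_add)
  show "norm (f i * cnj (g i)) \<le> (cmod (f i))\<^sup>2 + (cmod (g i))\<^sup>2" for i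
  proof -
    have "2 * (cmod (f i) * cmod (g i)) \<le> (cmod (f i))\<^sup>2 + (cmod (g i))\<^sup>2"
      using sum_squares_bound[of "cmod (f i)" "cmod (g i)"] by simp
    moreover have "0 \<le> cmod (f i) * cmod (g i)" by simp
    ultimately show ?thesis unfolding norm_mult complex_mod_cnj by linarith
  qed
qed

typedef 'i ell2 = "{f :: 'i \<Rightarrow> complex. sq_summable f}"
  morphisms ell2_coord Abs_ell2
  by (rule exI[of _ "\<lambda>_. 0"]) (simp add: sq_summable_zero)

setup_lifting type_definition_ell2

lemma sq_summable_coord: "sq_summable (ell2_coord f)"
  using ell2_coord by auto

lemma ell2_eqI: "(\<And>i. ell2_coord f i = ell2_coord g i) \<Longrightarrow> f = g"
  by (metis ell2_coord_inject ext)

instantiation ell2 :: (type) complex_inner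
begin

lift_definition zero_ell2 :: "'a ell2" is "\<lambda>_. 0" by (rule sq_summable_zero)
lift_definition plus_ell2 :: "'a ell2 \<Rightarrow> 'a ell2 \<Rightarrow> 'a ell2" is "\<lambda>f g i. f i + g i"
  by (rule sq_summable_add)
lift_definition scaleC_ell2 :: "complex \<Rightarrow> 'a ell2 \<Rightarrow> 'a ell2" is "\<lambda>c f i. c * f i"
  by (rule sq_summable_scale)
lift_definition uminus_ell2 :: "'a ell2 \<Rightarrow> 'a ell2" is "\<lambda>f i. - f i"
  using sq_summable_scale[of _ "- 1"] by simp
lift_definition minus_ell2 :: "'a ell2 \<Rightarrow> 'a ell2 \<Rightarrow> 'a ell2" is "\<lambda>f g i. f i - g i"
  using sq_summable_add[OF _ sq_summable_scale[of _ "- 1"]] by simp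
lift_definition scaleR_ell2 :: "real \<Rightarrow> 'a ell2 \<Rightarrow> 'a ell2" is "\<lambda>r f i. complex_of_real r * f i"
  by (rule sq_summable_scale)
lift_definition cinner_ell2 :: "'a ell2 \<Rightarrow> 'a ell2 \<Rightarrow> complex" is
  "\<lambda>f g. \<Sum>\<^sub>\<infinity>i. f i * cnj (g i)" .

definition inner_ell2 :: "'a ell2 \<Rightarrow> 'a ell2 \<Rightarrow> real" where "inner_ell2 f g = Re (cinner f g)"
definition norm_ell2 :: "'a ell2 \<Rightarrow> real" where "norm_ell2 f = sqrt (inner f f)"
definition dist_ell2 :: "'a ell2 \<Rightarrow> 'a ell2 \<Rightarrow> real" where "dist_ell2 f g = norm (f - g)"
definition sgn_ell2 :: "'a ell2 \<Rightarrow> 'a ell2" where "sgn_ell2 f = inverse (norm f) *\<^sub>R f"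
definition uniformity_ell2 :: "('a ell2 \<times> 'a ell2) filter" where
  "uniformity_ell2 = (INF e\<in>{0 <..}. principal {(f, g). dist f g < e})"
definition open_ell2 :: "'a ell2 set \<Rightarrow> bool" where
  "open_ell2 S \<longleftrightarrow> (\<forall>f\<in>S. \<forall>\<^sub>F (f', g) in uniformity. f' = f \<longrightarrow> g \<in> S)"

lemma ell2_inner_self: "inner (f::'a ell2) f = (\<Sum>\<^sub>\<infinity>i. (cmod (ell2_coord f i))\<^sup>2)"
proof -
  have "cinner f f = (\<Sum>\<^sub>\<infinity>i. complex_of_real ((cmod (ell2_coord f i))\<^sup>2))"
    by (simp only: cinner_ell2.rep_eq complex_norm_square)
  also have "\<dots> = complex_of_real (\<Sum>\<^sub>\<infinity>i. (cmod (ell2_coord f i))\<^sup>2)"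
    using sq_summable_coord[of f]
    by (intro infsumI has_sum_of_real) (simp add: sq_summable_def)
  finally show ?thesis by (simp add: inner_ell2_def)
qed

instance
proof
  fix f g h :: "'a ell2" and c d :: complex and r s :: real
  have com: "cinner f g = cnj (cinner g f)" for f g :: "'a ell2"
    by (simp add: cinner_ell2.rep_eq mult.commute flip: infsum_cnj)
  have add: "cinner (f + g) h = cinner f h + cinner g h" for f g h :: "'a ell2"
    unfolding cinner_ell2.rep_eq plus_ell2.rep_eq distrib_right
    using infsum_add[OF sq_summable_prod[OF sq_summable_coord[of f] sq_summable_coord[of h]]
        sq_summable_prod[OF sq_summable_coord[of g] sq_summable_coord[of h]]] .
  have scal: "cinner (c *\<^sub>C f) g = c * cinner f g" for c and f g :: "'a ell2"
    by (simp add: cinner_ell2.rep_eq scaleC_ell2.rep_eq mult.assoc infsum_cmult_right')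
  have rc: "r *\<^sub>R f = complex_of_real r *\<^sub>C f" for r and f :: "'a ell2"
    by transfer simp
  show "f + g + h = f + (g + h)" by transfer (simp add: add.assoc)
  show "f + g = g + f" by transfer (simp add: add.commute)
  show "0 + f = f" by transfer simp
  show "- f + f = 0" by transfer simp
  show "f - g = f + - g" by transfer simp
  show "r *\<^sub>R (f + g) = r *\<^sub>R f + r *\<^sub>R g" by transfer (simp add: distrib_left)
  show "(r + s) *\<^sub>R f = r *\<^sub>R f + s *\<^sub>R f" by transfer (simp add: distrib_right)
  show "r *\<^sub>R s *\<^sub>R f = (r * s) *\<^sub>R f" by transfer (simp add: mult.assoc)
  show "1 *\<^sub>R f = f" by transfer simp
  show "dist f g = norm (f - g)" by (rule dist_ell2_def)
  show "sgn f = inverse (norm f) *\<^sub>R f" by (rule sgn_ell2_def)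
  show "uniformity = (INF e\<in>{0 <..}. principal {(f::'a ell2, g). dist f g < e})"
    by (rule uniformity_ell2_def)
  show "open S = (\<forall>f\<in>S. \<forall>\<^sub>F (f', g) in uniformity. f' = f \<longrightarrow> g \<in> S)" for S :: "'a ell2 set"
    by (rule open_ell2_def)
  show "inner f g = inner g f"
    unfolding inner_ell2_def by (subst com) simp
  show "inner (f + g) h = inner f h + inner g h" by (simp add: inner_ell2_def add)
  show "inner (r *\<^sub>R f) g = r * inner f g" by (simp add: inner_ell2_def rc scal)
  show "0 \<le> inner f f" by (simp add: ell2_inner_self infsum_nonneg)
  show "inner f f = 0 \<longleftrightarrow> f = 0"
  proof
    assume "inner f f = 0"
    then have "(cmod (ell2_coord f i))\<^sup>2 = 0" for i
      using nonneg_infsum_le_0D[of "\<lambda>i. (cmod (ell2_coord f i))\<^sup>2" UNIV i]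
        sq_summable_coord[of f] by (simp add: ell2_inner_self sq_summable_def)
    then show "f = 0" by (intro ell2_eqI) (simp add: zero_ell2.rep_eq)
  qed (simp add: ell2_inner_self zero_ell2.rep_eq)
  show "norm f = sqrt (inner f f)" by (rule norm_ell2_def)
  show "c *\<^sub>C (f + g) = c *\<^sub>C f + c *\<^sub>C g" by transfer (simp add: distrib_left)
  show "(c + d) *\<^sub>C f = c *\<^sub>C f + d *\<^sub>C f" by transfer (simp add: distrib_right)
  show "c *\<^sub>C d *\<^sub>C f = (c * d) *\<^sub>C f" by transfer (simp add: mult.assoc)
  show "r *\<^sub>R f = complex_of_real r *\<^sub>C f" by (rule rc)
  show "cinner f g = cnj (cinner g f)" by (rule com)
  show "cinner (f + g) h = cinner f h + cinner g h" by (rule add)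
  show "cinner (c *\<^sub>C f) g = c * cinner f g" by (rule scal)
  show "inner f g = Re (cinner f g)" by (rule inner_ell2_def)
qed

end

lemma ell2_norm_sq: "(norm f)\<^sup>2 = (\<Sum>\<^sub>\<infinity>i. (cmod (ell2_coord f i))\<^sup>2)"
  by (simp add: power2_norm_eq_inner ell2_inner_self)

lemma ell2_finite_sum_le: "finite F \<Longrightarrow> (\<Sum>i\<in>F. (cmod (ell2_coord f i))\<^sup>2) \<le> (norm f)\<^sup>2"
  unfolding ell2_norm_sq using sq_summable_coord[of f]
  by (intro finite_sum_le_infsum) (auto simp: sq_summable_def)

lemma ell2_coord_le: "cmod (ell2_coord f i) \<le> norm f"
  by (rule power2_le_imp_le) (use ell2_finite_sum_le[of "{i}" f] in auto)

instance ell2 :: (type) chilbert_space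
proof
  fix X :: "nat \<Rightarrow> 'a ell2"
  assume X: "Cauchy X"
  have "Cauchy (\<lambda>n. ell2_coord (X n) i)" for i
  proof (rule metric_CauchyI)
    fix e :: real assume "e > 0"
    then obtain M where M: "\<And>m n. m \<ge> M \<Longrightarrow> n \<ge> M \<Longrightarrow> dist (X m) (X n) < e"
      using metric_CauchyD[OF X] by blast
    have "dist (ell2_coord (X m) i) (ell2_coord (X n) i) \<le> dist (X m) (X n)" for m n
      using ell2_coord_le[of "X m - X n" i] by (simp add: dist_norm minus_ell2.rep_eq)
    then show "\<exists>M. \<forall>m\<ge>M. \<forall>n\<ge>M. dist (ell2_coord (X m) i) (ell2_coord (X n) i) < e"
      using M by (meson le_less_trans)
  qed
  then have "\<forall>i. \<exists>l. (\<lambda>n. ell2_coord (X n) i) \<longlonglongrightarrow> l"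
    using Cauchy_convergent convergent_def by blast
  then obtain L where L: "\<And>i. (\<lambda>n. ell2_coord (X n) i) \<longlonglongrightarrow> L i" by metis
  have bound: "(\<Sum>i\<in>F. (cmod (ell2_coord (X n) i - L i))\<^sup>2) \<le> e\<^sup>2"
    if M: "\<And>m. m \<ge> M \<Longrightarrow> dist (X n) (X m) < e" and "finite F" for F n M e
  proof (rule tendsto_upperbound)
    show "(\<lambda>m. \<Sum>i\<in>F. (cmod (ell2_coord (X n) i - ell2_coord (X m) i))\<^sup>2)
            \<longlonglongrightarrow> (\<Sum>i\<in>F. (cmod (ell2_coord (X n) i - L i))\<^sup>2)"
      by (intro tendsto_intros L)
    show "\<forall>\<^sub>F m in sequentially. (\<Sum>i\<in>F. (cmod (ell2_coord (X n) i - ell2_coord (X m) i))\<^sup>2) \<le> e\<^sup>2"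
      using eventually_ge_at_top[of M]
    proof eventually_elim
      case (elim m)
      have "(\<Sum>i\<in>F. (cmod (ell2_coord (X n) i - ell2_coord (X m) i))\<^sup>2) \<le> (norm (X n - X m))\<^sup>2"
        using ell2_finite_sum_le[OF \<open>finite F\<close>, of "X n - X m"] by (simp add: minus_ell2.rep_eq)
      also have "\<dots> \<le> e\<^sup>2" using M[OF elim] by (simp add: dist_norm power_mono)
      finally show ?case .
    qed
  qed simp
  have "\<exists>M. \<forall>n\<ge>M. sq_summable (\<lambda>i. ell2_coord (X n) i - L i) \<and>
      (\<Sum>\<^sub>\<infinity>i. (cmod (ell2_coord (X n) i - L i))\<^sup>2) \<le> e\<^sup>2" if "e > 0" for e
  proof -
    obtain M where M: "\<And>m n. m \<ge> M \<Longrightarrow> n \<ge> M \<Longrightarrow> dist (X n) (X m) < e"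
      using metric_CauchyD[OF X \<open>e > 0\<close>] by blast
    have *: "(\<Sum>i\<in>F. (cmod (ell2_coord (X n) i - L i))\<^sup>2) \<le> e\<^sup>2" if "n \<ge> M" "finite F" for n F
      using bound[OF M[OF _ that(1)] that(2)] by blast
    have "sq_summable (\<lambda>i. ell2_coord (X n) i - L i)" if "n \<ge> M" for n
      by (rule sq_summableI) (rule *[OF that])
    moreover from this have "(\<Sum>\<^sub>\<infinity>i. (cmod (ell2_coord (X n) i - L i))\<^sup>2) \<le> e\<^sup>2" if "n \<ge> M" for n
      using that * by (intro infsum_le_finite_sums) (auto simp: sq_summable_def)
    ultimately show ?thesis by blast
  qed
  note tail = this
  obtain M where "sq_summable (\<lambda>i. ell2_coord (X M) i - L i)"
    using tail[of 1] by auto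
  from sq_summable_add[OF sq_summable_coord[of "X M"] sq_summable_scale[OF this, of "- 1"]]
  have "sq_summable L" by simp
  then have coord: "ell2_coord (Abs_ell2 L) = L" by (simp add: Abs_ell2_inverse)
  have "X \<longlonglongrightarrow> Abs_ell2 L"
  proof (rule metric_LIMSEQ_I)
    fix e :: real assume "e > 0"
    then obtain M where M: "\<And>n. n \<ge> M \<Longrightarrow>
        (\<Sum>\<^sub>\<infinity>i. (cmod (ell2_coord (X n) i - L i))\<^sup>2) \<le> (e / 2)\<^sup>2"
      using tail[of "e / 2"] by auto
    have "dist (X n) (Abs_ell2 L) < e" if "n \<ge> M" for n
    proof -
      have "(norm (X n - Abs_ell2 L))\<^sup>2 \<le> (e / 2)\<^sup>2"
        using M[OF that] by (simp add: ell2_norm_sq minus_ell2.rep_eq coord)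
      then have "norm (X n - Abs_ell2 L) \<le> e / 2"
        by (rule power2_le_imp_le) (use \<open>e > 0\<close> in simp)
      then show ?thesis using \<open>e > 0\<close> by (simp add: dist_norm)
    qed
    then show "\<exists>M. \<forall>n\<ge>M. dist (X n) (Abs_ell2 L) < e" by blast
  qed
  then show "convergent X" by (rule convergentI)
qed


section \<open>The Fock space with three degrees of freedom\<close>

definition creation :: "(nat \<Rightarrow> complex) \<Rightarrow> nat \<Rightarrow> complex" where
  "creation f n = (case n of 0 \<Rightarrow> 0 | Suc m \<Rightarrow> complex_of_real (sqrt (m + 1)) * f m)"

definition annihilation :: "(nat \<Rightarrow> complex) \<Rightarrow> nat \<Rightarrow> complex" where
  "annihilation f n = complex_of_real (sqrt (n + 1)) * f (n + 1)"

definition basis_seq :: "nat \<Rightarrow> nat \<Rightarrow> complex" where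
  "basis_seq n = (\<lambda>m. if m = n then 1 else 0)"

lemma creation_basis:
  "creation (basis_seq n) = (\<lambda>m. complex_of_real (sqrt (n + 1)) * basis_seq (n + 1) m)"
  by (auto simp: creation_def basis_seq_def fun_eq_iff split: nat.split)

lemma annihilation_basis:
  "annihilation (basis_seq n) = (\<lambda>m. complex_of_real (sqrt n) * basis_seq (n - 1) m)"
  by (cases n) (auto simp: annihilation_def basis_seq_def fun_eq_iff)

text \<open>
  The Hilbert space tensor product of three copies of \<open>nat ell2\<close> is modelled as
  \<open>(nat \<times> nat \<times> nat) ell2\<close>, with elementary tensors the functions \<open>elem_tensor u v w\<close>.
  Operators \<open>R\<close>, \<open>S\<close>, \<open>T\<close> on sequences act on the first, second and third variable.
\<close>

definition elem_tensor ::
  "(nat \<Rightarrow> complex) \<Rightarrow> (nat \<Rightarrow> complex) \<Rightarrow> (nat \<Rightarrow> complex) \<Rightarrow> nat \<times> nat \<times> nat \<Rightarrow> complex" where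
  "elem_tensor u v w = (\<lambda>(k, l, m). u k * v l * w m)"

definition tensor_op ::
  "((nat \<Rightarrow> complex) \<Rightarrow> nat \<Rightarrow> complex) \<Rightarrow> ((nat \<Rightarrow> complex) \<Rightarrow> nat \<Rightarrow> complex) \<Rightarrow>
   ((nat \<Rightarrow> complex) \<Rightarrow> nat \<Rightarrow> complex) \<Rightarrow>
   (nat \<times> nat \<times> nat \<Rightarrow> complex) \<Rightarrow> nat \<times> nat \<times> nat \<Rightarrow> complex" where
  "tensor_op R S T f =
     (\<lambda>(k, l, m). R (\<lambda>k'. S (\<lambda>l'. T (\<lambda>m'. f (k', l', m')) m) l) k)"

lemma tensor_op_elem_tensor:
  assumes "\<And>c u. R (\<lambda>n. c * u n) = (\<lambda>n. c * R u n)"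
    and "\<And>c u. S (\<lambda>n. c * u n) = (\<lambda>n. c * S u n)"
    and "\<And>c u. T (\<lambda>n. c * u n) = (\<lambda>n. c * T u n)"
  shows "tensor_op R S T (elem_tensor u v w) = elem_tensor (R u) (S v) (T w)"
proof -
  have "R (\<lambda>k'. S (\<lambda>l'. T (\<lambda>m'. u k' * v l' * w m') m) l) k = R u k * S v l * T w m" for k l m
  proof -
    have "R (\<lambda>k'. S (\<lambda>l'. T (\<lambda>m'. u k' * v l' * w m') m) l) k =
        R (\<lambda>k'. S (\<lambda>l'. (u k' * T w m) * v l') l) k"
      using assms(3)[of "u _ * v _" w] by (simp add: mult_ac)
    also have "\<dots> = R (\<lambda>k'. (T w m * S v l) * u k') k"
      using assms(2)[of "u _ * T w m" v] by (simp add: mult_ac)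
    also have "\<dots> = R u k * S v l * T w m"
      using assms(1)[of "T w m * S v l" u] by (simp add: mult_ac)
    finally show ?thesis .
  qed
  then show ?thesis by (simp add: tensor_op_def elem_tensor_def)
qed

definition rapidly_decreasing :: "(nat \<times> nat \<times> nat) ell2 set" where
  "rapidly_decreasing =
     {f. \<forall>N. \<exists>C. \<forall>k l m. (1 + real k + real l + real m) ^ N * cmod (ell2_coord f (k, l, m)) \<le> C}"

end

theory Submission
  imports Defs "HOL-Probability.Characteristic_Functions"
begin

text \<open>
  Through the isomorphism, the statement is the Stone-von Neumann theorem for three degrees of
  freedom, in a form that keeps track of the smooth vectors.

  Uniqueness: in an integrable representation the Gaussian average
  \<open>\<integral> exp (-|z|\<^sup>2/4) W(z) dz\<close> of the Weyl operators is, up to a factor, the projection onto vectors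
  \<open>\<Omega>\<close> with \<open>\<langle>W(z) \<Omega>, \<Omega>\<rangle> = exp (-|z|\<^sup>2/4)\<close>.  By irreducibility the orbit of such an \<open>\<Omega>\<close> is total,
  and its Gram matrix is universal, so two irreducible representations are intertwined by a unitary,
  which respects smooth vectors and derivatives.

  Existence: the Weyl operators on the Fock space are defined by their action on the exponential
  vectors, which again only requires comparing Gram matrices.  On rapidly decreasing vectors the
  estimate \<open>|W(X) f - f - X f| \<le> |X X f|\<close> gives smoothness; conversely, the ladder operators preserve
  the smooth vectors, hence so do the powers of the number operator, which forces rapid decrease.
\<close>

section \<open>Hilbert spaces\<close>

\<comment> \<open>The operators are unbounded, so the argument works with scalar data: matrix
  coefficients determine operators through the Riesz representation, and Gram matrices of total
  families determine unitaries. The domain is part of the data. Well-behavedness prescribes all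
  smooth vectors, and irreducibility concerns only closed subspaces that split the domain. Hence a
  projection has to be shown to preserve smoothness before irreducibility can be applied; it does so
  because it commutes with the group. For the same reason the smooth vectors of the Fock
  representation have to be identified exactly. The two sides of the isomorphism are not on the same
  footing. The operators of a representation pulled back along it are among those of the CCR
  representation, so its irreducibility passes to the latter at once. On the Fock space the converse
  is required, and the CCR generators must be recovered from the images of \<open>a1\<close>,
  \<open>a2\<close>, \<open>A\<close>. Creation and annihilation are defined on arbitrary
  coefficient families, so that algebraic relations are pointwise identities; convergence matters
  only for adjoints and norms.\<close>
subclass (in chilbert_space) banach ..

lemma scaleC_zero_right [simp]: "c *\<^sub>C (0::'a::complex_inner) = 0"
  using scaleC_add_right[of c "0::'a" 0] by simp

lemma scaleC_zero_left [simp]: "0 *\<^sub>C (x::'a::complex_inner) = 0"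
  using scaleC_add_left[of 0 0 x] by simp

lemma scaleC_one [simp]: "1 *\<^sub>C (x::'a::complex_inner) = x"
  using scaleR_scaleC[of 1 x] by simp

lemma scaleC_minus_one: "(- 1) *\<^sub>C (x::'a::complex_inner) = - x"
  using scaleR_scaleC[of "- 1" x] by simp

lemma scaleC_minus_left: "(- c) *\<^sub>C (x::'a::complex_inner) = - (c *\<^sub>C x)"
  using scaleC_scaleC[of "- 1" c x] by (simp add: scaleC_minus_one)

lemma scaleC_minus_right: "c *\<^sub>C (- x::'a::complex_inner) = - (c *\<^sub>C x)"
  using scaleC_scaleC[of c "- 1" x] scaleC_scaleC[of "- 1" c x] by (simp add: scaleC_minus_one)

lemma scaleC_diff_right: "c *\<^sub>C (x - y::'a::complex_inner) = c *\<^sub>C x - c *\<^sub>C y"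
  using scaleC_add_right[of c x "- y"] by (simp add: scaleC_minus_right)

lemma scaleC_diff_left: "(c - d) *\<^sub>C (x::'a::complex_inner) = c *\<^sub>C x - d *\<^sub>C x"
  using scaleC_add_left[of c "- d" x] by (simp add: scaleC_minus_left)

lemma cinner_add_right: "cinner x (y + z) = cinner x y + cinner x (z::'a::complex_inner)"
  by (metis cinner_add_left cinner_commute complex_cnj_add)

lemma cinner_scaleC_right: "cinner x (c *\<^sub>C y) = cnj c * cinner x (y::'a::complex_inner)"
  by (metis cinner_scaleC_left cinner_commute complex_cnj_mult)

lemma cinner_zero_left [simp]: "cinner 0 (x::'a::complex_inner) = 0"
  using cinner_scaleC_left[of 0 x x] by simp

lemma cinner_zero_right [simp]: "cinner (x::'a::complex_inner) 0 = 0"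
  using cinner_scaleC_right[of x 0 x] by simp

lemma cinner_minus_left: "cinner (- x) (y::'a::complex_inner) = - cinner x y"
  using cinner_scaleC_left[of "- 1" x y] by (simp add: scaleC_minus_one)

lemma cinner_minus_right: "cinner x (- y::'a::complex_inner) = - cinner x y"
  using cinner_scaleC_right[of x "- 1" y] by (simp add: scaleC_minus_one)

lemma cinner_diff_left: "cinner (x - y) (z::'a::complex_inner) = cinner x z - cinner y z"
  using cinner_add_left[of x "- y" z] by (simp add: cinner_minus_left)

lemma cinner_diff_right: "cinner x (y - z::'a::complex_inner) = cinner x y - cinner x z"
  using cinner_add_right[of x y "- z"] by (simp add: cinner_minus_right)

lemmas cinner_simps = cinner_add_left cinner_add_right cinner_diff_left cinner_diff_right
  cinner_minus_left cinner_minus_right cinner_scaleC_left cinner_scaleC_right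

lemma cinner_self: "cinner x x = complex_of_real ((norm (x::'a::complex_inner))\<^sup>2)"
proof (rule complex_eqI)
  show "Re (cinner x x) = Re (complex_of_real ((norm x)\<^sup>2))"
    by (simp add: power2_norm_eq_inner inner_eq_Re_cinner)
  show "Im (cinner x x) = Im (complex_of_real ((norm x)\<^sup>2))"
    using arg_cong[OF cinner_commute[of x x], of Im] by simp
qed

lemma cinner_self_eq_zero [simp]: "cinner x x = 0 \<longleftrightarrow> (x::'a::complex_inner) = 0"
  by (simp add: cinner_self)

lemma norm_scaleC: "norm (c *\<^sub>C (x::'a::complex_inner)) = cmod c * norm x"
proof -
  have "cinner (c *\<^sub>C x) (c *\<^sub>C x) = (c * cnj c) * cinner x x"
    by (simp add: cinner_simps)
  also have "\<dots> = complex_of_real ((cmod c)\<^sup>2) * complex_of_real ((norm x)\<^sup>2)"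
    by (simp only: complex_norm_square[of c] cinner_self)
  also have "\<dots> = complex_of_real ((cmod c * norm x)\<^sup>2)"
    by (simp only: of_real_mult power_mult_distrib)
  finally have "complex_of_real ((norm (c *\<^sub>C x))\<^sup>2) = complex_of_real ((cmod c * norm x)\<^sup>2)"
    by (simp only: cinner_self)
  then have "(norm (c *\<^sub>C x))\<^sup>2 = (cmod c * norm x)\<^sup>2"
    using of_real_eq_iff by blast
  then show ?thesis by (simp add: power2_eq_iff_nonneg)
qed

lemma cmod_cinner_le: "cmod (cinner x y) \<le> norm x * norm (y::'a::complex_inner)"
proof (cases "cinner x y = 0")
  case False
  \<comment> \<open>This phase rotates \<open>cinner x y\<close> to its modulus, which reduces the
    claim to the real Cauchy-Schwarz inequality.\<close>
  define c where "c = cnj (cinner x y) / cmod (cinner x y)"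
  have c: "cmod c = 1" using False by (simp add: c_def norm_divide)
  have "cnj (cinner x y) * cinner x y = complex_of_real (cmod (cinner x y)) * cmod (cinner x y)"
    by (metis complex_norm_square mult.commute of_real_mult power2_eq_square)
  then have "c * cinner x y = cmod (cinner x y)"
    using False by (simp add: c_def)
  then have "cmod (cinner x y) = inner (c *\<^sub>C x) y"
    by (simp add: inner_eq_Re_cinner cinner_simps)
  also have "\<dots> \<le> norm (c *\<^sub>C x) * norm y" by (rule norm_cauchy_schwarz)
  finally show ?thesis by (simp add: norm_scaleC c)
qed simp

lemma bounded_bilinear_cinner: "bounded_bilinear (cinner :: 'a::complex_inner \<Rightarrow> _)"
proof
  fix r :: real and a b :: 'a
  show "cinner (r *\<^sub>R a) b = r *\<^sub>R cinner a b"
    by (simp add: scaleR_scaleC cinner_simps scaleR_conv_of_real)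
  show "cinner a (r *\<^sub>R b) = r *\<^sub>R cinner a b"
    by (simp add: scaleR_scaleC cinner_simps scaleR_conv_of_real)
  show "\<exists>K. \<forall>a b. norm (cinner (a::'a) b) \<le> norm a * norm b * K"
    using cmod_cinner_le by (auto intro!: exI[of _ 1])
qed (auto simp: cinner_simps)

lemmas tendsto_cinner [tendsto_intros] = bounded_bilinear.tendsto[OF bounded_bilinear_cinner]
lemmas continuous_on_cinner [continuous_intros] =
  bounded_bilinear.continuous_on[OF bounded_bilinear_cinner]

lemma bounded_bilinear_scaleC: "bounded_bilinear (scaleC :: complex \<Rightarrow> 'a::complex_inner \<Rightarrow> 'a)"
proof
  fix r :: real and c :: complex and x :: 'a
  show "(r *\<^sub>R c) *\<^sub>C x = r *\<^sub>R (c *\<^sub>C x)"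
    by (simp add: scaleR_scaleC scaleC_scaleC scaleR_conv_of_real)
  show "c *\<^sub>C (r *\<^sub>R x) = r *\<^sub>R (c *\<^sub>C x)"
    by (simp add: scaleR_scaleC scaleC_scaleC mult.commute)
  show "\<exists>K. \<forall>c (x::'a). norm (c *\<^sub>C x) \<le> norm c * norm x * K"
    by (auto simp: norm_scaleC intro!: exI[of _ 1])
qed (auto simp: scaleC_add_left scaleC_add_right)

lemmas tendsto_scaleC [tendsto_intros] = bounded_bilinear.tendsto[OF bounded_bilinear_scaleC]
lemmas continuous_on_scaleC [continuous_intros] =
  bounded_bilinear.continuous_on[OF bounded_bilinear_scaleC]

section \<open>Closed subspaces, orthogonal complements and the Riesz representation\<close>

lemma csubspace_diff: "csubspace K \<Longrightarrow> x \<in> K \<Longrightarrow> y \<in> K \<Longrightarrow> x - y \<in> K"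
  unfolding csubspace_def by (metis diff_conv_add_uminus scaleC_minus_one)

lemma csubspace_add: "csubspace K \<Longrightarrow> x \<in> K \<Longrightarrow> y \<in> K \<Longrightarrow> x + y \<in> K"
  by (auto simp: csubspace_def)

lemma csubspace_scaleC: "csubspace K \<Longrightarrow> x \<in> K \<Longrightarrow> c *\<^sub>C x \<in> K"
  by (auto simp: csubspace_def)

lemma csubspace_scaleR: "csubspace K \<Longrightarrow> x \<in> K \<Longrightarrow> r *\<^sub>R x \<in> K"
  by (simp add: scaleR_scaleC csubspace_scaleC)

lemma csubspace_zero: "csubspace K \<Longrightarrow> 0 \<in> K"
  by (auto simp: csubspace_def)

lemma csubspace_ortho_compl: "csubspace (ortho_compl K)"
  by (auto simp: csubspace_def ortho_compl_def cinner_simps)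

lemma closed_ortho_compl: "closed (ortho_compl K)"
proof -
  have "ortho_compl K = (\<Inter>x\<in>K. {y. cinner x y = 0})"
    by (auto simp: ortho_compl_def)
  then show ?thesis
    by (auto intro!: closed_INT closed_Collect_eq continuous_intros)
qed

lemma csubspace_closure:
  assumes "csubspace K"
  shows "csubspace (closure K)"
  unfolding csubspace_def
proof (intro conjI ballI allI)
  show "0 \<in> closure K" using csubspace_zero[OF assms] closure_subset by blast
  fix x assume x: "x \<in> closure K"
  then obtain X where X: "\<And>n. X n \<in> K" "X \<longlonglongrightarrow> x" by (auto simp: closure_sequential)
  show "c *\<^sub>C x \<in> closure K" for c
    unfolding closure_sequential
    by (rule exI[of _ "\<lambda>n. c *\<^sub>C X n"]) (auto intro!: tendsto_intros X csubspace_scaleC assms)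
  fix y assume "y \<in> closure K"
  then obtain Y where Y: "\<And>n. Y n \<in> K" "Y \<longlonglongrightarrow> y" by (auto simp: closure_sequential)
  show "x + y \<in> closure K"
    unfolding closure_sequential
    by (rule exI[of _ "\<lambda>n. X n + Y n"]) (auto intro!: tendsto_intros X Y csubspace_add assms)
qed

text \<open>Real multiples of \<open>k\<close> only detect the real part; the imaginary part is
  reached through \<i> times \<open>k\<close>, which also lies in \<open>K\<close>.\<close>

lemma norm_sub_minimal_imp_orthogonal:
  fixes y :: "'a::complex_inner"
  assumes K: "csubspace K" and min: "\<And>k. k \<in> K \<Longrightarrow> norm y \<le> norm (y - k)" and k: "k \<in> K"
  shows "cinner k y = 0"
proof -
  have re: "inner y k = 0" if k: "k \<in> K" for k
  proof (cases "k = 0")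
    case False
    \<comment> \<open>The minimiser of the quadratic polynomial |y - t k|^2 in
      \<open>t\<close>.\<close>
    define t where "t = inner y k / (norm k)\<^sup>2"
    have "(norm y)\<^sup>2 \<le> (norm (y - t *\<^sub>R k))\<^sup>2"
      using min[OF csubspace_scaleR[OF K k]] by (intro power_mono) auto
    also have "\<dots> = (norm y)\<^sup>2 - 2 * t * inner y k + t\<^sup>2 * (norm k)\<^sup>2"
      unfolding power2_norm_eq_inner
      by (simp add: inner_diff_left inner_diff_right inner_commute power2_eq_square)
    finally have "2 * t * inner y k \<le> t\<^sup>2 * (norm k)\<^sup>2" by simp
    moreover have "t * (norm k)\<^sup>2 = inner y k" using False by (simp add: t_def)
    ultimately have "2 * (t * inner y k) \<le> t * inner y k"
      by (metis mult.assoc power2_eq_square)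
    moreover have "t * inner y k = (inner y k)\<^sup>2 / (norm k)\<^sup>2"
      by (simp add: t_def power2_eq_square)
    ultimately have "(inner y k)\<^sup>2 / (norm k)\<^sup>2 \<le> 0" by simp
    then show ?thesis using False by (auto simp: divide_le_0_iff)
  qed simp
  have "Re (cinner k y) = 0"
    using re[OF k] by (simp add: inner_commute flip: inner_eq_Re_cinner)
  moreover have "Im (cinner k y) = 0"
    using re[OF csubspace_scaleC[OF K k, of \<i>]]
    by (simp add: inner_commute[of y]) (simp add: inner_eq_Re_cinner cinner_simps)
  ultimately show ?thesis by (simp add: complex_eq_iff)
qed

text \<open>Midpoints stay in \<open>K\<close>, so by the parallelogram law a sequence minimising
  the distance is Cauchy; its limit is the foot of the perpendicular.\<close>

lemma orthogonal_decomposition: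
  fixes K :: "'h::chilbert_space set"
  assumes K: "csubspace K" "closed K"
  obtains u where "u \<in> K" "x - u \<in> ortho_compl K"
proof -
  define d where "d = infdist x K"
  have ne: "K \<noteq> {}" using csubspace_zero[OF K(1)] by blast
  have "\<exists>u\<in>K. dist x u < d + 1 / Suc n" for n
  proof (rule ccontr)
    assume "\<not> ?thesis"
    then have "d + 1 / Suc n \<le> infdist x K"
      unfolding infdist_notempty[OF ne] by (intro cINF_greatest[OF ne]) (auto simp: not_less)
    then show False by (simp add: d_def)
  qed
  then obtain u where u: "\<And>n. u n \<in> K" "\<And>n. dist x (u n) < d + 1 / Suc n" by metis
  have d0: "0 \<le> d" by (simp add: d_def infdist_nonneg)
  have low: "d \<le> norm (x - k)" if "k \<in> K" for k
    using infdist_le[OF that, of x] by (simp add: d_def dist_norm)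
  \<comment> \<open>With \<open>e = 1 / Suc N\<close> the parallelogram law leaves 4 (d + e)^2 - 4
    d^2 = 8 d e + 4 e^2, and \<open>e \<le> 1\<close> makes the bound linear in
    \<open>e\<close>.\<close>
  have key: "(norm (u m - u n))\<^sup>2 \<le> (8 * d + 4) * (1 / Suc N)" if mn: "m \<ge> N" "n \<ge> N" for m n N
  proof -
    define e where "e = 1 / real (Suc N)"
    have e: "0 < e" "e \<le> 1" by (auto simp: e_def)
    have le: "norm (x - u k) \<le> d + e" if "k \<ge> N" for k
    proof -
      have "1 / real (Suc k) \<le> e" using that by (simp add: e_def frac_le)
      then show ?thesis using u(2)[of k] by (simp add: dist_norm)
    qed
    have mid: "(1/2) *\<^sub>R (u m + u n) \<in> K"
      by (intro csubspace_scaleR csubspace_add K u)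
    have "(norm (u m - u n))\<^sup>2 = 2 * (norm (x - u m))\<^sup>2 + 2 * (norm (x - u n))\<^sup>2
        - 4 * (norm (x - (1/2) *\<^sub>R (u m + u n)))\<^sup>2"
      unfolding power2_norm_eq_inner
      by (simp add: inner_diff_left inner_diff_right inner_add_left inner_add_right inner_commute algebra_simps)
    also have "\<dots> \<le> 2 * (d + e)\<^sup>2 + 2 * (d + e)\<^sup>2 - 4 * d\<^sup>2"
      using power_mono[OF le[OF mn(1)], of 2] power_mono[OF le[OF mn(2)], of 2]
        power_mono[OF low[OF mid] d0, of 2] by simp
    also have "\<dots> = 8 * d * e + 4 * (e * e)" by (simp add: power2_eq_square algebra_simps)
    also have "\<dots> \<le> 8 * d * e + 4 * e" using e by (simp add: mult_left_le)
    finally show ?thesis by (simp add: e_def algebra_simps)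
  qed
  have "Cauchy u"
  proof (rule metric_CauchyI)
    fix e :: real assume e: "e > 0"
    obtain N where N: "(8 * d + 4) / e\<^sup>2 < real N" using reals_Archimedean2 by blast
    have "dist (u m) (u n) < e" if "m \<ge> N" "n \<ge> N" for m n
    proof -
      have "(8 * d + 4) < e\<^sup>2 * Suc N"
      proof -
        have "8 * d + 4 < real N * e\<^sup>2" using N e by (simp add: divide_less_eq)
        also have "\<dots> \<le> e\<^sup>2 * Suc N" using e by (simp add: mult.commute mult_right_mono)
        finally show ?thesis .
      qed
      then have "(8 * d + 4) * (1 / Suc N) < e\<^sup>2" by (simp add: divide_simps)
      then have "(norm (u m - u n))\<^sup>2 < e\<^sup>2" using key[OF that] by simp
      then show ?thesis using e by (simp add: dist_norm power_less_imp_less_base)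
    qed
    then show "\<exists>M. \<forall>m\<ge>M. \<forall>n\<ge>M. dist (u m) (u n) < e" by blast
  qed
  then obtain l where l: "u \<longlonglongrightarrow> l" using Cauchy_convergent convergent_def by blast
  have lK: "l \<in> K" using closed_sequentially[OF K(2) u(1) l] .
  have "dist x l \<le> d"
  proof (rule tendsto_le[OF sequentially_bot])
    show "(\<lambda>n. dist x (u n)) \<longlonglongrightarrow> dist x l" by (intro tendsto_intros l)
    show "(\<lambda>n. d + 1 / Suc n) \<longlonglongrightarrow> d"
      using tendsto_add[OF tendsto_const[of d] LIMSEQ_inverse_real_of_nat] by (simp add: inverse_eq_divide)
    show "\<forall>\<^sub>F n in sequentially. dist x (u n) \<le> d + 1 / Suc n"
      using u(2) by (intro always_eventually) (auto intro: less_imp_le)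
  qed
  then have min: "norm (x - l) \<le> norm (x - l - k)" if "k \<in> K" for k
    using low[OF csubspace_add[OF K(1) lK that]] by (simp add: dist_norm diff_diff_eq)
  have "x - l \<in> ortho_compl K"
    using norm_sub_minimal_imp_orthogonal[OF K(1) min] by (auto simp: ortho_compl_def)
  with lK show thesis by (rule that)
qed

lemma ortho_compl_trivial_imp_UNIV:
  fixes K :: "'h::chilbert_space set"
  assumes "csubspace K" "closed K" "ortho_compl K = {0}"
  shows "K = UNIV"
proof -
  have "x \<in> K" for x
    using orthogonal_decomposition[OF assms(1,2), of x] assms(3) by auto
  then show ?thesis by blast
qed

lemma Riesz_representation:
  fixes \<phi> :: "'h::chilbert_space \<Rightarrow> complex"
  assumes add: "\<And>x y. \<phi> (x + y) = \<phi> x + \<phi> y" and scale: "\<And>c x. \<phi> (c *\<^sub>C x) = c * \<phi> x"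
    and bound: "\<And>x. cmod (\<phi> x) \<le> B * norm x"
  obtains w where "\<And>y. \<phi> y = cinner y w"
proof -
  define K where "K = {x. \<phi> x = 0}"
  have diff: "\<phi> (x - y) = \<phi> x - \<phi> y" for x y
    using add[of "x - y" y] by simp
  have zero: "\<phi> 0 = 0" using scale[of 0 0] by simp
  have sub: "csubspace K" by (auto simp: csubspace_def K_def add scale zero)
  have "bounded_linear \<phi>"
    by (rule bounded_linear_intro[where K=B])
      (use bound in \<open>auto simp: add scaleR_scaleC scale scaleR_conv_of_real mult.commute\<close>)
  then have cl: "closed K" unfolding K_def
    by (intro closed_Collect_eq linear_continuous_on continuous_on_const)
  show thesis
  proof (cases "K = UNIV")
    case True
    then have "\<phi> y = cinner y 0" for y by (auto simp: K_def)
    then show thesis by (rule that)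
  next
    case False
    then obtain v where v: "v \<in> ortho_compl K" "v \<noteq> 0"
      using ortho_compl_trivial_imp_UNIV[OF sub cl] csubspace_zero[OF csubspace_ortho_compl] by blast
    have pv: "\<phi> v \<noteq> 0"
    proof
      assume "\<phi> v = 0"
      then have "cinner v v = 0" using v(1) by (auto simp: K_def ortho_compl_def)
      then show False using v(2) by simp
    qed
    \<comment> \<open>\<open>v\<close> is rescaled so that both functionals agree at
      \<open>v\<close>; they both vanish on the kernel, and kernel and \<open>v\<close> span the
      space.\<close>
    have "\<phi> y = cinner y ((cnj (\<phi> v) / cinner v v) *\<^sub>C v)" for y
    proof -
      have "\<phi> (y - (\<phi> y / \<phi> v) *\<^sub>C v) = 0" using pv by (simp add: diff scale)
      then have "cinner (y - (\<phi> y / \<phi> v) *\<^sub>C v) v = 0"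
        using v(1) by (auto simp: K_def ortho_compl_def)
      then have "cinner y v = (\<phi> y / \<phi> v) * cinner v v" by (simp add: cinner_simps)
      then show ?thesis using v(2) pv by (simp add: cinner_simps cinner_self)
    qed
    then show thesis by (rule that)
  qed
qed

section \<open>Total families and isometries determined by Gram matrices\<close>

inductive_set lin_span :: "('i \<Rightarrow> 'h::complex_inner) \<Rightarrow> 'h set" for u where
  zero: "0 \<in> lin_span u"
| step: "x \<in> lin_span u \<Longrightarrow> x + c *\<^sub>C u i \<in> lin_span u"

lemma lin_span_base: "u i \<in> lin_span u"
  using lin_span.step[OF lin_span.zero, of 1 u i] by simp

lemma csubspace_lin_span: "csubspace (lin_span u)"
proof -
  have "x + y \<in> lin_span u" if x: "x \<in> lin_span u" and y: "y \<in> lin_span u" for x y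
    using y
  proof induction
    case (step y c i)
    then show ?case using lin_span.step[of "x + y" u c i] by (simp add: add.assoc)
  qed (use x in simp)
  moreover have "c *\<^sub>C x \<in> lin_span u" if x: "x \<in> lin_span u" for x c
    using x
  proof induction
    case (step x d i)
    then show ?case
      using lin_span.step[of "c *\<^sub>C x" u "c * d" i] by (simp add: scaleC_add_right scaleC_scaleC)
  qed (auto intro: lin_span.zero)
  ultimately show ?thesis by (auto simp: csubspace_def lin_span.zero)
qed

lemma lin_span_le: "csubspace K \<Longrightarrow> (\<And>i. u i \<in> K) \<Longrightarrow> lin_span u \<subseteq> K"
proof
  fix x assume K: "csubspace K" "\<And>i. u i \<in> K" and "x \<in> lin_span u"
  from this(3) show "x \<in> K"
    by induction (auto intro!: csubspace_add csubspace_scaleC csubspace_zero K)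
qed

text \<open>The isometry is obtained as the closure of its graph, in which the two norms agree.\<close>

inductive gram_graph :: "('i \<Rightarrow> 'h::complex_inner) \<Rightarrow> ('i \<Rightarrow> 'k::complex_inner) \<Rightarrow> 'h \<Rightarrow> 'k \<Rightarrow> bool"
  for u v where
  zero: "gram_graph u v 0 0"
| step: "gram_graph u v x y \<Longrightarrow> gram_graph u v (x + c *\<^sub>C u i) (y + c *\<^sub>C v i)"

lemma gram_graph_base: "gram_graph u v (u i) (v i)"
  using gram_graph.step[OF gram_graph.zero, of u v 1 i] by simp

lemma gram_graph_add:
  assumes "gram_graph u v x y" "gram_graph u v x' y'"
  shows "gram_graph u v (x + x') (y + y')"
  using assms(2)
proof induction
  case (step x' y' c i)
  then show ?case using gram_graph.step[of u v "x + x'" "y + y'" c i] by (simp add: add.assoc)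
qed (use assms(1) in simp)

lemma gram_graph_scale:
  assumes "gram_graph u v x y"
  shows "gram_graph u v (c *\<^sub>C x) (c *\<^sub>C y)"
  using assms
proof induction
  case (step x y d i)
  then show ?case
    using gram_graph.step[of u v "c *\<^sub>C x" "c *\<^sub>C y" "c * d" i]
    by (simp add: scaleC_add_right scaleC_scaleC)
qed (simp add: gram_graph.zero)

text \<open>One induction per argument. This contains well-definedness: equal norms on both sides
  carry every linear dependency among the \<open>u i\<close> over to the \<open>v i\<close>.\<close>

lemma gram_graph_cinner:
  assumes gram: "\<And>i j. cinner (u i) (u j) = cinner (v i) (v j)"
    and "gram_graph u v x y" "gram_graph u v x' y'"
  shows "cinner x x' = cinner y y'"
proof -
  have 1: "cinner x (u i) = cinner y (v i)" if "gram_graph u v x y" for x y i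
    using that by induction (auto simp: cinner_simps gram)
  show ?thesis using assms(3)
    by induction (auto simp: cinner_simps 1[OF assms(2)])
qed

lemma gram_isometry:
  fixes u :: "'i \<Rightarrow> 'h::chilbert_space" and v :: "'i \<Rightarrow> 'k::chilbert_space"
  assumes gram: "\<And>i j. cinner (u i) (u j) = cinner (v i) (v j)"
    and total: "closure (lin_span u) = UNIV"
  obtains T where "clinear_on UNIV T" "\<And>x y. cinner (T x) (T y) = cinner x y" "\<And>i. T (u i) = v i"
proof -
  define G where "G x y \<longleftrightarrow> (\<exists>X Y. (\<forall>n. gram_graph u v (X n) (Y n)) \<and> X \<longlonglongrightarrow> x \<and> Y \<longlonglongrightarrow> y)" for x y
  have G_cinner: "cinner x x' = cinner y y'" if "G x y" "G x' y'" for x y x' y'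
  proof -
    obtain X Y where X: "\<And>n. gram_graph u v (X n) (Y n)" "X \<longlonglongrightarrow> x" "Y \<longlonglongrightarrow> y"
      using \<open>G x y\<close> by (auto simp: G_def)
    obtain X' Y' where X': "\<And>n. gram_graph u v (X' n) (Y' n)" "X' \<longlonglongrightarrow> x'" "Y' \<longlonglongrightarrow> y'"
      using \<open>G x' y'\<close> by (auto simp: G_def)
    have "(\<lambda>n. cinner (X n) (X' n)) \<longlonglongrightarrow> cinner x x'" by (intro tendsto_intros X X')
    moreover have "(\<lambda>n. cinner (X n) (X' n)) \<longlonglongrightarrow> cinner y y'"
      unfolding gram_graph_cinner[OF gram X(1) X'(1)] by (intro tendsto_intros X X')
    ultimately show ?thesis by (rule LIMSEQ_unique)
  qed
  have G_add: "G (x + x') (y + y')" if xy: "G x y" and xy': "G x' y'" for x y x' y'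
  proof -
    obtain X Y where X: "\<And>n. gram_graph u v (X n) (Y n)" "X \<longlonglongrightarrow> x" "Y \<longlonglongrightarrow> y"
      using xy by (auto simp: G_def)
    obtain X' Y' where X': "\<And>n. gram_graph u v (X' n) (Y' n)" "X' \<longlonglongrightarrow> x'" "Y' \<longlonglongrightarrow> y'"
      using xy' by (auto simp: G_def)
    show ?thesis
      unfolding G_def
      by (intro exI[of _ "\<lambda>n. X n + X' n"] exI[of _ "\<lambda>n. Y n + Y' n"] conjI allI
          gram_graph_add tendsto_add X X')
  qed
  have G_scale: "G (c *\<^sub>C x) (c *\<^sub>C y)" if xy: "G x y" for x y c
  proof -
    obtain X Y where X: "\<And>n. gram_graph u v (X n) (Y n)" "X \<longlonglongrightarrow> x" "Y \<longlonglongrightarrow> y"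
      using xy by (auto simp: G_def)
    show ?thesis
      unfolding G_def
      by (intro exI[of _ "\<lambda>n. c *\<^sub>C X n"] exI[of _ "\<lambda>n. c *\<^sub>C Y n"] conjI allI
          gram_graph_scale tendsto_scaleC tendsto_const X)
  qed
  \<comment> \<open>The difference of the two pairs is \<open>(0, y - y')\<close>, and the second
    component has the norm of the first.\<close>
  have G_unique: "y = y'" if "G x y" "G x y'" for x y y'
  proof -
    have "G 0 (y - y')"
      using G_add[OF that(1) G_scale[OF that(2), of "- 1"]] by (simp add: scaleC_minus_one)
    from G_cinner[OF this this] show ?thesis by simp
  qed
  have dom: "\<exists>y. gram_graph u v x y" if "x \<in> lin_span u" for x
    using that by induction (auto intro: gram_graph.intros)
  have G_total: "\<exists>y. G x y" for x
  proof -
    have "x \<in> closure (lin_span u)" using total by simp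
    then obtain X where X: "\<And>n. X n \<in> lin_span u" "X \<longlonglongrightarrow> x" by (auto simp: closure_sequential)
    obtain Y where Y: "\<And>n. gram_graph u v (X n) (Y n)" using dom[OF X(1)] by metis
    have nrm: "dist (Y m) (Y n) = dist (X m) (X n)" for m n
    proof -
      have "gram_graph u v (X m - X n) (Y m - Y n)"
        using gram_graph_add[OF Y[of m] gram_graph_scale[OF Y[of n], of "- 1"]]
        by (simp add: scaleC_minus_one)
      from gram_graph_cinner[OF gram this this]
      have "complex_of_real ((norm (X m - X n))\<^sup>2) = complex_of_real ((norm (Y m - Y n))\<^sup>2)"
        by (simp only: cinner_self)
      then have "(norm (X m - X n))\<^sup>2 = (norm (Y m - Y n))\<^sup>2" using of_real_eq_iff by blast
      then show ?thesis by (simp add: dist_norm power2_eq_iff_nonneg)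
    qed
    have "Cauchy Y"
      using LIMSEQ_imp_Cauchy[OF X(2)] unfolding Cauchy_def nrm .
    then obtain y where "Y \<longlonglongrightarrow> y" using Cauchy_convergent convergent_def by blast
    then show ?thesis using X Y by (auto simp: G_def)
  qed
  then obtain T where T: "\<And>x. G x (T x)" by metis
  show thesis
  proof (rule that)
    show "clinear_on UNIV T"
      using G_unique[OF T G_add[OF T T]] G_unique[OF T G_scale[OF T]] by (auto simp: clinear_on_def)
    show "cinner (T x) (T y) = cinner x y" for x y using G_cinner[OF T T] by simp
    have "G (u i) (v i)" for i
      unfolding G_def by (rule exI[of _ "\<lambda>n. u i"], rule exI[of _ "\<lambda>n. v i"]) (auto simp: gram_graph_base)
    then show "T (u i) = v i" for i using G_unique[OF T] by blast
  qed
qed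

lemma isometry_norm:
  assumes "\<And>x y. cinner (T x) (T y) = cinner x y"
  shows "norm (T (x::'a::complex_inner)) = norm x"
proof -
  have "complex_of_real ((norm (T x))\<^sup>2) = complex_of_real ((norm x)\<^sup>2)"
    using assms[of x x] by (simp only: cinner_self)
  then have "(norm (T x))\<^sup>2 = (norm x)\<^sup>2" using of_real_eq_iff by blast
  then show ?thesis by (simp add: power2_eq_iff_nonneg)
qed

lemma bounded_linear_clinear:
  fixes T :: "'a::complex_inner \<Rightarrow> 'b::complex_inner"
  assumes "clinear_on UNIV T" "\<And>x. norm (T x) \<le> B * norm x"
  shows "bounded_linear T"
  by (rule bounded_linear_intro[where K=B])
    (use assms in \<open>auto simp: clinear_on_def scaleR_scaleC mult.commute\<close>)

lemma isometry_bounded_linear: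
  fixes T :: "'a::complex_inner \<Rightarrow> 'b::complex_inner"
  assumes "clinear_on UNIV T" "\<And>x y. cinner (T x) (T y) = cinner x y"
  shows "bounded_linear T"
  using assms(1) isometry_norm[of T, OF assms(2)] by (intro bounded_linear_clinear[where B=1]) auto

text \<open>Preimages of a convergent sequence are Cauchy because distances are preserved, so the
  range is closed.\<close>

lemma isometry_surj_of_dense_range:
  fixes T :: "'a::chilbert_space \<Rightarrow> 'b::chilbert_space"
  assumes T: "clinear_on UNIV T" "\<And>x y. cinner (T x) (T y) = cinner x y"
    and dense: "closure (range T) = UNIV"
  shows "surj T"
proof -
  interpret bounded_linear T by (rule isometry_bounded_linear[OF T])
  have "y \<in> range T" for y
  proof -
    have "y \<in> closure (range T)" using dense by simp
    then obtain Y where Y: "\<And>n. Y n \<in> range T" "Y \<longlonglongrightarrow> y" by (auto simp: closure_sequential)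
    have "\<forall>n. \<exists>x. Y n = T x" using Y(1) by blast
    then obtain X where X: "\<And>n. Y n = T (X n)" by metis
    have "dist (X m) (X n) = dist (Y m) (Y n)" for m n
      by (simp add: X dist_norm flip: diff isometry_norm[of T, OF T(2), of "X m - X n"])
    then have "Cauchy X" using LIMSEQ_imp_Cauchy[OF Y(2)] unfolding Cauchy_def by simp
    then obtain x where x: "X \<longlonglongrightarrow> x" using Cauchy_convergent convergent_def by blast
    have "Y \<longlonglongrightarrow> T x" unfolding X by (rule tendsto[OF x])
    then show ?thesis using LIMSEQ_unique[OF Y(2)] by auto
  qed
  then show ?thesis by blast
qed

lemma gram_unitary:
  fixes u :: "'i \<Rightarrow> 'h::chilbert_space" and v :: "'i \<Rightarrow> 'k::chilbert_space"
  assumes gram: "\<And>i j. cinner (u i) (u j) = cinner (v i) (v j)"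
    and total: "closure (lin_span u) = UNIV" "closure (lin_span v) = UNIV"
  obtains T where "unitary T" "\<And>i. T (u i) = v i"
proof -
  obtain T where T: "clinear_on UNIV T" "\<And>x y. cinner (T x) (T y) = cinner x y" "\<And>i. T (u i) = v i"
    using gram_isometry[OF gram total(1)] by blast
  have "x \<in> range T" if "x \<in> lin_span v" for x
    using that
  proof induction
    case zero
    have "T 0 = 0" using T(1) unfolding clinear_on_def by (metis UNIV_I scaleC_zero_left)
    then show ?case by (metis rangeI)
  next
    case (step x c i)
    then obtain y where "x = T y" by blast
    then have "x + c *\<^sub>C v i = T (y + c *\<^sub>C u i)" using T(1,3) by (simp add: clinear_on_def)
    then show ?case by blast
  qed
  then have "closure (lin_span v) \<subseteq> closure (range T)" by (intro closure_mono) auto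
  then have "surj T" using isometry_surj_of_dense_range[OF T(1,2)] total(2) by auto
  then have "unitary T" using T by (auto simp: unitary_def)
  then show thesis using T(3) by (rule that)
qed

lemma unitary_bounded_linear: "unitary T \<Longrightarrow> bounded_linear T"
  by (auto simp: unitary_def intro: isometry_bounded_linear)

lemma unitary_norm: "unitary T \<Longrightarrow> norm (T x) = norm x"
  by (auto simp: unitary_def intro: isometry_norm)

lemma unitary_scaleC: "unitary T \<Longrightarrow> T (c *\<^sub>C x) = c *\<^sub>C T x"
  by (auto simp: unitary_def clinear_on_def)

lemma unitary_add: "unitary T \<Longrightarrow> T (x + y) = T x + T y"
  by (auto simp: unitary_def clinear_on_def)

lemma unitary_diff: "unitary T \<Longrightarrow> T (x - y) = T x - T y"
  by (rule bounded_linear.linear[THEN linear_diff, OF unitary_bounded_linear])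

lemma unitary_cinner: "unitary T \<Longrightarrow> cinner (T x) (T y) = cinner x y"
  by (auto simp: unitary_def)

lemma bounded_linear_eq_on_total:
  fixes S T :: "'h::chilbert_space \<Rightarrow> 'k::complex_inner"
  assumes "bounded_linear S" "clinear_on UNIV S" "bounded_linear T" "clinear_on UNIV T"
    and total: "closure (lin_span u) = UNIV" and eq: "\<And>i. S (u i) = T (u i)"
  shows "S x = T x"
proof -
  have "csubspace {x. S x = T x}"
    using assms(2,4) linear_0[OF bounded_linear.linear[OF assms(1)]]
      linear_0[OF bounded_linear.linear[OF assms(3)]]
    by (auto simp: csubspace_def clinear_on_def)
  then have "lin_span u \<subseteq> {x. S x = T x}" by (rule lin_span_le) (simp add: eq)
  moreover have "closed {x. S x = T x}"
    by (intro closed_Collect_eq linear_continuous_on assms)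
  ultimately have "closure (lin_span u) \<subseteq> {x. S x = T x}" by (rule closure_minimal)
  then show ?thesis using total by blast
qed

lemma unitary_eq_on_total:
  assumes "unitary S" "unitary (T::'h::chilbert_space \<Rightarrow> 'k::chilbert_space)"
    and "closure (lin_span u) = UNIV" "\<And>i. S (u i) = T (u i)"
  shows "S x = T x"
  by (rule bounded_linear_eq_on_total[OF unitary_bounded_linear _ unitary_bounded_linear])
    (use assms in \<open>simp_all add: unitary_def\<close>)

lemma unitary_compose: "unitary S \<Longrightarrow> unitary T \<Longrightarrow> unitary (\<lambda>x. S (T x))"
  unfolding unitary_def clinear_on_def using comp_surj[of T S]
  by (simp add: comp_def)

section \<open>Gaussian integrals\<close>

lemma lborel_integrable_affine_iff:
  fixes f :: "'v::euclidean_space \<Rightarrow> complex"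
  assumes "c \<noteq> 0" and [measurable]: "f \<in> borel_measurable borel"
  shows "integrable lborel (\<lambda>x. f (t + c *\<^sub>R x)) \<longleftrightarrow> integrable lborel f"
proof -
  have "integrable lborel f \<longleftrightarrow>
      integrable (density (distr lborel borel (\<lambda>x. t + c *\<^sub>R x)) (\<lambda>_. ennreal (\<bar>c\<bar> ^ DIM('v)))) f"
    using lborel_affine[OF assms(1), of t] by (simp add: ennreal_power)
  also have "\<dots> \<longleftrightarrow> integrable lborel (\<lambda>x. f (t + c *\<^sub>R x))"
  proof -
    define k where "k = complex_of_real (\<bar>c\<bar> ^ DIM('v))"
    have k: "k \<noteq> 0" using assms(1) by (simp add: k_def)
    have iff: "integrable lborel (\<lambda>x. k * g x) \<longleftrightarrow> integrable lborel g" for g :: "'v \<Rightarrow> complex"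
      using integrable_mult_right[of k lborel g]
        integrable_mult_right[of "1 / k" lborel "\<lambda>x. k * g x"] k by auto
    show ?thesis
      using assms(1) iff[of "\<lambda>x. f (t + c *\<^sub>R x)"]
      by (subst integrable_density) (auto simp: integrable_distr_eq scaleR_conv_of_real k_def)
  qed
  finally show ?thesis ..
qed

lemma lborel_integral_affine:
  fixes f :: "'v::euclidean_space \<Rightarrow> complex"
  assumes "c \<noteq> 0" and [measurable]: "f \<in> borel_measurable borel"
  shows "(\<integral>x. f x \<partial>lborel) = complex_of_real (\<bar>c\<bar> ^ DIM('v)) * (\<integral>x. f (t + c *\<^sub>R x) \<partial>lborel)"
proof -
  have "(\<integral>x. f x \<partial>lborel) =
      (\<integral>x. f x \<partial>(density (distr lborel borel (\<lambda>x. t + c *\<^sub>R x)) (\<lambda>_. ennreal (\<bar>c\<bar> ^ DIM('v)))))"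
    using lborel_affine[OF assms(1), of t] by (simp add: ennreal_power)
  also have "\<dots> = complex_of_real (\<bar>c\<bar> ^ DIM('v)) * (\<integral>x. f (t + c *\<^sub>R x) \<partial>lborel)"
    using assms(1)
    by (subst integral_density) (auto simp: integral_distr scaleR_conv_of_real)
  finally show ?thesis .
qed

lemma lborel_integral_translation:
  fixes f :: "'v::euclidean_space \<Rightarrow> complex"
  assumes "f \<in> borel_measurable borel"
  shows "(\<integral>x. f (x + t) \<partial>lborel) = (\<integral>x. f x \<partial>lborel)"
  using lborel_integral_affine[OF _ assms, of 1 t] by (simp add: add.commute)

lemma lborel_integral_reflection:
  fixes f :: "'v::euclidean_space \<Rightarrow> complex"
  assumes "f \<in> borel_measurable borel"
  shows "(\<integral>x. f (- x) \<partial>lborel) = (\<integral>x. f x \<partial>lborel)"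
  using lborel_integral_affine[OF _ assms, of "- 1" 0] by simp

text \<open>The bound is shaped so that for fixed \<open>x\<close> its dependence on
  \<open>y\<close> is only a translation, which does not change the integral of \<open>b\<close>. A
  shear as \<open>\<phi>\<close> serves the twisted convolution, \<open>\<phi> = 0\<close> the
  smearing argument.\<close>

lemma lborel_fubini:
  fixes F :: "'v::euclidean_space \<Rightarrow> 'v \<Rightarrow> complex"
  assumes cont: "continuous_on UNIV (\<lambda>(x, y). F x y)"
    and le: "\<And>x y. cmod (F x y) \<le> a x * b (y - \<phi> x)"
    and a: "integrable lborel a" "\<And>x. 0 \<le> a x" and b: "integrable lborel b" "\<And>x. 0 \<le> (b x :: real)"
  shows "(\<integral>x. \<integral>y. F x y \<partial>lborel \<partial>lborel) = (\<integral>y. \<integral>x. F x y \<partial>lborel \<partial>lborel)"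
proof -
  have meas: "(\<lambda>(x, y). F x y) \<in> borel_measurable (lborel \<Otimes>\<^sub>M lborel)"
    using borel_measurable_continuous_onI[OF cont] by (simp add: lborel_prod)
  have b': "integrable lborel (\<lambda>y. b (y - t))" "(\<integral>y. b (y - t) \<partial>lborel) = (\<integral>y. b y \<partial>lborel)" for t
    using b(1) lborel_integrable_affine_iff[of 1 "\<lambda>y. complex_of_real (b y)" "- t"]
      lborel_integral_translation[of "\<lambda>y. complex_of_real (b y)" "- t"]
    by (auto dest: borel_measurable_integrable simp: integral_of_real complex_of_real_integrable_eq)
  have Fx: "integrable lborel (\<lambda>y. F x y)" for x
  proof (rule Bochner_Integration.integrable_bound)
    show "integrable lborel (\<lambda>y. a x * b (y - \<phi> x))" using b'(1) by simp
    have "continuous_on UNIV (\<lambda>y. F x y)"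
      using continuous_on_compose2[OF cont, of UNIV "\<lambda>y. (x, y)"] by (simp add: continuous_on_Pair continuous_on_const)
    then show "(\<lambda>y. F x y) \<in> borel_measurable lborel"
      using borel_measurable_continuous_onI by auto
    show "AE y in lborel. norm (F x y) \<le> norm (a x * b (y - \<phi> x))"
      using le a(2) b(2) by (auto intro!: AE_I2)
  qed
  have "integrable (lborel \<Otimes>\<^sub>M lborel) (\<lambda>(x, y). F x y)"
  proof (rule lborel_pair.Fubini_integrable[OF meas])
    show "AE x in lborel. integrable lborel (\<lambda>y. case (x, y) of (x, y) \<Rightarrow> F x y)" using Fx by simp
    show "integrable lborel (\<lambda>x. \<integral>y. norm (case (x, y) of (x, y) \<Rightarrow> F x y) \<partial>lborel)"
    proof (rule Bochner_Integration.integrable_bound)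
      show "integrable lborel (\<lambda>x. a x * (\<integral>y. b y \<partial>lborel))" using a(1) by simp
      show "(\<lambda>x. \<integral>y. norm (case (x, y) of (x, y) \<Rightarrow> F x y) \<partial>lborel) \<in> borel_measurable lborel"
        using meas by measurable
      have "(\<integral>y. norm (F x y) \<partial>lborel) \<le> a x * (\<integral>y. b y \<partial>lborel)" for x
      proof -
        have "(\<integral>y. norm (F x y) \<partial>lborel) \<le> (\<integral>y. a x * b (y - \<phi> x) \<partial>lborel)"
          using Fx b'(1) le by (intro integral_mono) auto
        then show ?thesis using b' by simp
      qed
      then show "AE x in lborel. norm (\<integral>y. norm (case (x, y) of (x, y) \<Rightarrow> F x y) \<partial>lborel)
          \<le> norm (a x * (\<integral>y. b y \<partial>lborel))"
        using a(2) b(2) by (intro AE_I2) (simp add: abs_mult)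
    qed
  qed
  then show ?thesis using lborel_pair.Fubini_integral[of F] by simp
qed

text \<open>Up to the normalisation sqrt (2 pi) this is the characteristic function of the standard
  normal distribution.\<close>

lemma normal_char_integral:
  "integrable lborel (\<lambda>x::real. complex_of_real (exp (- (x\<^sup>2) / 2)) * cis (x * t))"
  "(\<integral>x. complex_of_real (exp (- (x\<^sup>2) / 2)) * cis (x * t) \<partial>lborel)
    = complex_of_real (sqrt (2 * pi) * exp (- (t\<^sup>2) / 2))"
proof -
  have eq: "complex_of_real (exp (- (x\<^sup>2) / 2)) * cis (x * t) =
      complex_of_real (sqrt (2 * pi)) * (std_normal_density x *\<^sub>R iexp (t * x))" for x :: real
    by (simp add: std_normal_density_def scaleR_conv_of_real cis_conv_exp mult_ac)
  have int: "integrable lborel (\<lambda>x. std_normal_density x *\<^sub>R iexp (t * x))"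
    by (rule Bochner_Integration.integrable_bound[OF integrable_normal_density[where \<mu>=0 and \<sigma>=1]])
      (auto simp: normal_density_nonneg)
  then show "integrable lborel (\<lambda>x::real. complex_of_real (exp (- (x\<^sup>2) / 2)) * cis (x * t))"
    unfolding eq by (intro integrable_mult_right)
  have "(\<integral>x. std_normal_density x *\<^sub>R iexp (t * x) \<partial>lborel) = char std_normal_distribution t"
    unfolding char_def by (subst integral_density) (auto simp: normal_density_nonneg)
  then have "(\<integral>x. std_normal_density x *\<^sub>R iexp (t * x) \<partial>lborel) = complex_of_real (exp (- (t\<^sup>2) / 2))"
    by (simp add: char_std_normal_distribution)
  then show "(\<integral>x. complex_of_real (exp (- (x\<^sup>2) / 2)) * cis (x * t) \<partial>lborel)
    = complex_of_real (sqrt (2 * pi) * exp (- (t\<^sup>2) / 2))"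
    unfolding eq by (subst integral_mult_right_zero) (simp add: mult.commute)
qed

lemma cis_sum: "finite A \<Longrightarrow> cis (\<Sum>i\<in>A. f i) = (\<Prod>i\<in>A. cis (f i))"
  by (induction A rule: finite_induct) (auto simp flip: cis_mult)

lemma exp_neg_half_sum:
  fixes a :: "'i \<Rightarrow> real"
  shows "finite A \<Longrightarrow> exp (- (\<Sum>i\<in>A. a i) / 2) = (\<Prod>i\<in>A. exp (- a i / 2))"
  by (simp add: sum_negf flip: exp_sum sum_divide_distrib)

text \<open>In coordinates of the orthonormal basis the integrand is a product of one-dimensional
  ones, and Lebesgue measure is the image of a product measure.\<close>

lemma gaussian_char_integral:
  fixes b :: "'v::euclidean_space"
  shows "integrable lborel (\<lambda>x::'v. complex_of_real (exp (- (norm x)\<^sup>2 / 2)) * cis (x \<bullet> b))"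
    and "(\<integral>x. complex_of_real (exp (- (norm x)\<^sup>2 / 2)) * cis (x \<bullet> b) \<partial>lborel)
      = complex_of_real (sqrt (2 * pi) ^ DIM('v) * exp (- (norm b)\<^sup>2 / 2))"
proof -
  interpret product_sigma_finite "\<lambda>_::'v. lborel :: real measure" by standard
  define f where "f i x = complex_of_real (exp (- (x\<^sup>2) / 2)) * cis (x * (b \<bullet> i))" for i :: 'v and x :: real
  have nrm: "(norm y)\<^sup>2 = (\<Sum>i\<in>Basis. (y \<bullet> i)\<^sup>2)" for y :: 'v
    by (subst power2_norm_eq_inner, subst euclidean_inner) (simp add: power2_eq_square)
  have eq: "complex_of_real (exp (- (norm x)\<^sup>2 / 2)) * cis (x \<bullet> b) = (\<Prod>i\<in>Basis. f i (x \<bullet> i))" for x :: 'v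
    unfolding f_def nrm euclidean_inner[of x b] prod.distrib cis_sum[OF finite_Basis]
      exp_neg_half_sum[OF finite_Basis] of_real_prod ..
  have coord: "(\<Sum>j\<in>Basis. g j *\<^sub>R j) \<bullet> i = g i" if "i \<in> Basis" for g :: "'v \<Rightarrow> real" and i
    using that by simp
  have M: "(\<lambda>x. \<Prod>i\<in>Basis. f i (x \<bullet> i)) \<in> borel_measurable (borel :: 'v measure)"
    unfolding f_def by (intro borel_measurable_continuous_onI continuous_intros) auto
  have MT: "(\<lambda>g. \<Sum>b\<in>Basis. g b *\<^sub>R b) \<in> (\<Pi>\<^sub>M b\<in>Basis. lborel) \<rightarrow>\<^sub>M (borel :: 'v measure)"
    by measurable
  have prodeq: "(\<Prod>i\<in>Basis. f i ((\<Sum>j\<in>Basis. g j *\<^sub>R j) \<bullet> i)) = (\<Prod>i\<in>Basis. f i (g i))" for g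
    by (intro prod.cong) (auto simp: coord)
  have int1: "integrable lborel (f i)" for i
    unfolding f_def by (rule normal_char_integral)
  have "integrable (\<Pi>\<^sub>M b\<in>(Basis::'v set). lborel) (\<lambda>g. \<Prod>i\<in>Basis. f i (g i))"
    by (intro product_integrable_prod int1) auto
  then show "integrable lborel (\<lambda>x::'v. complex_of_real (exp (- (norm x)\<^sup>2 / 2)) * cis (x \<bullet> b))"
    unfolding eq by (subst lborel_eq) (simp add: integrable_distr_eq[OF MT M] prodeq)
  have "(\<integral>x. complex_of_real (exp (- (norm x)\<^sup>2 / 2)) * cis (x \<bullet> b) \<partial>lborel)
      = (\<integral>g. (\<Prod>i\<in>Basis. f i (g i)) \<partial>(\<Pi>\<^sub>M b\<in>(Basis::'v set). lborel))"
    unfolding eq by (subst lborel_eq) (simp add: integral_distr[OF MT M] prodeq)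
  also have "\<dots> = (\<Prod>i\<in>(Basis::'v set). integral\<^sup>L lborel (f i))"
    by (intro product_integral_prod int1) auto
  also have "\<dots> = (\<Prod>i\<in>(Basis::'v set). complex_of_real (sqrt (2 * pi) * exp (- ((b \<bullet> i)\<^sup>2) / 2)))"
    unfolding f_def normal_char_integral(2) ..
  also have "\<dots> = complex_of_real (sqrt (2 * pi) ^ DIM('v) * exp (- (norm b)\<^sup>2 / 2))"
    unfolding nrm exp_neg_half_sum[OF finite_Basis] of_real_mult of_real_prod prod.distrib
    by simp
  finally show "(\<integral>x. complex_of_real (exp (- (norm x)\<^sup>2 / 2)) * cis (x \<bullet> b) \<partial>lborel)
      = complex_of_real (sqrt (2 * pi) ^ DIM('v) * exp (- (norm b)\<^sup>2 / 2))" .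
qed

lemma integrable_gaussian:
  fixes c :: real
  assumes "c > 0"
  shows "integrable lborel (\<lambda>x::'v::euclidean_space. exp (- c * (norm x)\<^sup>2))"
proof -
  have "integrable lborel (\<lambda>x::'v. complex_of_real (exp (- (norm x)\<^sup>2 / 2)))"
    using gaussian_char_integral(1)[of 0] by simp
  \<comment> \<open>The factor sqrt (2 c) turns |x|^2 / 2 into c |x|^2.\<close>
  then have "integrable lborel (\<lambda>x::'v. complex_of_real (exp (- (norm (0 + sqrt (2 * c) *\<^sub>R x))\<^sup>2 / 2)))"
    using assms
    by (subst lborel_integrable_affine_iff) (auto intro!: borel_measurable_continuous_onI continuous_intros)
  then have "integrable lborel (\<lambda>x::'v. complex_of_real (exp (- c * (norm x)\<^sup>2)))"
    using assms by (simp add: power_mult_distrib)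
  from integrable_Re[OF this] show ?thesis by simp
qed

section \<open>The vacuum of a Weyl system\<close>

text \<open>
  A Weyl system over a phase space with symplectic form \<open>\<omega>(z, w) = z \<bullet> J w\<close>. Von Neumann's operator
  \<open>\<integral> exp (-|z|\<^sup>2/4) W(z) dz\<close> is a multiple of the projection onto the vacuum vectors.
\<close>

locale weyl_system =
  fixes W :: "'v::euclidean_space \<Rightarrow> 'h::chilbert_space \<Rightarrow> 'h" and J :: "'v \<Rightarrow> 'v"
  assumes W_unitary: "unitary (W z)"
    and W_mult: "W z (W w x) = cis ((z \<bullet> J w) / 2) *\<^sub>C W (z + w) x"
    and W_continuous: "continuous_on UNIV (\<lambda>z. W z x)"
    and J_linear: "linear J"
    and J_norm: "norm (J z) = norm z"
    and J_skew: "z \<bullet> J w = - (w \<bullet> J z)"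
begin

lemma J_self: "z \<bullet> J z = 0"
  using J_skew[of z z] by simp

lemmas J_simps = linear_add[OF J_linear] linear_diff[OF J_linear] linear_cmul[OF J_linear]
  linear_neg[OF J_linear] linear_0[OF J_linear]

lemma J_continuous [continuous_intros]: "continuous_on S f \<Longrightarrow> continuous_on S (\<lambda>x. J (f x))"
  by (rule bounded_linear.continuous_on[OF linear_conv_bounded_linear[THEN iffD1, OF J_linear]])

text \<open>\<open>W 0\<close> is idempotent by the multiplication rule and injective as an
  isometry.\<close>

lemma W_zero: "W 0 x = x"
proof -
  have "W 0 (W 0 x) = W 0 x" using W_mult[of 0 0 x] by (simp add: J_simps)
  then have "W 0 (W 0 x - x) = 0" by (simp add: unitary_diff[OF W_unitary])
  then show ?thesis using unitary_norm[OF W_unitary[of 0], of "W 0 x - x"] by simp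
qed

lemma W_inverse: "W z (W (- z) x) = x"
  using W_mult[of z "- z" x] by (simp add: W_zero J_simps J_self)

lemma W_adjoint: "cinner (W z x) y = cinner x (W (- z) y)"
  using unitary_cinner[OF W_unitary[of z], of x "W (- z) y"] by (simp add: W_inverse)

lemma W_continuous_compose [continuous_intros]:
  "continuous_on S f \<Longrightarrow> continuous_on S (\<lambda>s. W (f s) x)"
  using continuous_on_compose2[OF W_continuous] by auto

lemma cmod_coefficient_le: "cmod (cinner (W z x) y) \<le> norm x * norm y"
  using cmod_cinner_le[of "W z x" y] by (simp add: unitary_norm[OF W_unitary])

text \<open>The width is forced. For exp (-a |z|^2), completing the square in the twisted
  convolution leaves the growth exp (a |w + s|^2 / 2), and the Fourier transform contributes the
  decay exp (-|w + s|^2 / (32 a)); they cancel only for a = 1/4.\<close>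

definition gauss :: "'v \<Rightarrow> real" where "gauss z = exp (- (norm z)\<^sup>2 / 4)"

lemma gauss_pos: "0 < gauss z" by (simp add: gauss_def)

lemma gauss_minus: "gauss (- z) = gauss z" by (simp add: gauss_def)

lemma gauss_integrable: "integrable lborel gauss"
  using integrable_gaussian[of "1/4", where 'v='v] by (simp add: gauss_def[abs_def])

lemma gauss_continuous [continuous_intros]: "continuous_on S f \<Longrightarrow> continuous_on S (\<lambda>x. gauss (f x))"
  unfolding gauss_def by (intro continuous_intros) auto

text \<open>The sesquilinear form of von Neumann's operator, so that only scalar functions are
  integrated.\<close>

definition vac_form :: "'h \<Rightarrow> 'h \<Rightarrow> complex" where
  "vac_form x y = (\<integral>z. complex_of_real (gauss z) * cinner (W z x) y \<partial>lborel)"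

lemma vac_form_integrable: "integrable lborel (\<lambda>z. complex_of_real (gauss z) * cinner (W z x) y)"
proof (rule Bochner_Integration.integrable_bound)
  show "integrable lborel (\<lambda>z. gauss z * (norm x * norm y))"
    using gauss_integrable by simp
  show "(\<lambda>z. complex_of_real (gauss z) * cinner (W z x) y) \<in> borel_measurable lborel"
    using borel_measurable_continuous_onI
    by (simp, intro borel_measurable_continuous_onI continuous_intros)
  show "AE z in lborel. norm (complex_of_real (gauss z) * cinner (W z x) y) \<le> norm (gauss z * (norm x * norm y))"
    using gauss_pos cmod_coefficient_le
    by (intro AE_I2) (simp add: norm_mult abs_mult mult_left_mono less_imp_le)
qed

lemma vac_form_bound: "cmod (vac_form x y) \<le> ((\<integral>z. gauss z \<partial>lborel) * norm x) * norm y"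
proof -
  have "cmod (vac_form x y) \<le> (\<integral>z. gauss z * (norm x * norm y) \<partial>lborel)"
    unfolding vac_form_def
  proof (rule Bochner_Integration.integral_norm_bound_integral[OF vac_form_integrable])
    show "integrable lborel (\<lambda>z. gauss z * (norm x * norm y))" using gauss_integrable by simp
    show "norm (complex_of_real (gauss z) * cinner (W z x) y) \<le> gauss z * (norm x * norm y)" for z
      using gauss_pos[of z] cmod_coefficient_le[of z x y] by (simp add: norm_mult mult_left_mono less_imp_le)
  qed
  then show ?thesis by (simp add: mult.assoc)
qed

text \<open>The adjoint of \<open>W z\<close> is \<open>W (- z)\<close>, and the Gaussian is
  even.\<close>

lemma vac_form_adjoint: "vac_form x y = cnj (vac_form y x)"
proof -
  have "vac_form x y = (\<integral>z. cnj (complex_of_real (gauss (- z)) * cinner (W (- z) y) x) \<partial>lborel)"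
  proof -
    have "cinner (W z x) y = cnj (cinner (W (- z) y) x)" for z
      by (subst W_adjoint) (rule cinner_commute)
    then show ?thesis by (simp add: vac_form_def gauss_minus)
  qed
  also have "\<dots> = cnj (\<integral>z. complex_of_real (gauss (- z)) * cinner (W (- z) y) x \<partial>lborel)"
    by (rule Bochner_Integration.integral_cnj)
  also have "(\<integral>z. complex_of_real (gauss (- z)) * cinner (W (- z) y) x \<partial>lborel) = vac_form y x"
    unfolding vac_form_def
    by (rule lborel_integral_reflection[of "\<lambda>z. complex_of_real (gauss z) * cinner (W z y) x"])
      (intro borel_measurable_continuous_onI continuous_intros)
  finally show ?thesis .
qed

text \<open>The form is linear in its first argument, so the Riesz vector appears in the second one;
  Hermitian symmetry then moves it to the first.\<close>

lemma vacuum_operator_exists: "\<exists>P. \<forall>x y. cinner (P x) y = vac_form x y"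
proof -
  have "\<exists>w. \<forall>y. vac_form y x = cinner y w" for x
  proof -
    have 1: "vac_form (y + y') x = vac_form y x + vac_form y' x" for y y'
      unfolding vac_form_def
      by (subst Bochner_Integration.integral_add[symmetric, OF vac_form_integrable vac_form_integrable])
        (simp add: unitary_add[OF W_unitary] cinner_simps distrib_left)
    have 2: "vac_form (c *\<^sub>C y) x = c * vac_form y x" for c y
      unfolding vac_form_def
      by (subst integral_mult_right_zero[symmetric])
        (simp add: unitary_scaleC[OF W_unitary] cinner_simps mult_ac)
    have 3: "cmod (vac_form y x) \<le> ((\<integral>z. gauss z \<partial>lborel) * norm x) * norm y" for y
      using vac_form_bound[of y x] by (simp add: mult_ac)
    show ?thesis by (rule Riesz_representation[of "\<lambda>y. vac_form y x", OF 1 2 3]) blast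
  qed
  then obtain P where "\<And>x y. vac_form y x = cinner y (P x)" by metis
  then have "cinner (P x) y = vac_form x y" for x y
    by (metis cinner_commute vac_form_adjoint)
  then show ?thesis by blast
qed

definition vac_op :: "'h \<Rightarrow> 'h" where
  "vac_op = (SOME P. \<forall>x y. cinner (P x) y = vac_form x y)"

lemma cinner_vac_op: "cinner (vac_op x) y = vac_form x y"
  using someI_ex[OF vacuum_operator_exists] by (auto simp: vac_op_def)

lemma vac_op_selfadjoint: "cinner (vac_op x) y = cinner x (vac_op y)"
  by (metis cinner_vac_op vac_form_adjoint cinner_commute)

text \<open>The integral of exp (-|z|^2 / 2), the product of two factors \<open>gauss\<close>, and
  not that of \<open>gauss\<close> itself.\<close>

definition gauss_mass :: real where "gauss_mass = sqrt (2 * pi) ^ DIM('v)"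

lemma gauss_mass_pos: "gauss_mass > 0" by (simp add: gauss_mass_def)

text \<open>
  After completing the square, the growth \<open>exp (|w + s|\<^sup>2/8)\<close> is compensated by the Fourier
  transform of the Gaussian, because \<open>J\<close> is isometric.
\<close>

lemma gauss_twisted_convolution:
  "(\<integral>z. complex_of_real (gauss z * gauss (s - z - w)) * cis ((z \<bullet> J w + (z + w) \<bullet> J s) / 2) \<partial>lborel)
    = complex_of_real (gauss_mass * gauss w * gauss s)"
proof -
  define v where "v = w + s"
  define f where "f z = complex_of_real (gauss z * gauss (s - z - w)) *
    cis ((z \<bullet> J w + (z + w) \<bullet> J s) / 2)" for z
  have meas: "f \<in> borel_measurable borel"
    unfolding f_def
    by (intro borel_measurable_continuous_onI continuous_intros) auto
  \<comment> \<open>The two factors are centred at 0 and at \<open>s - w\<close>; the shift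
    \<open>(1/2) *\<^sub>R v - w\<close> is the midpoint of these centres.\<close>
  have *: "f (y + ((1/2) *\<^sub>R v - w)) =
      complex_of_real (exp (((norm v)\<^sup>2 / 2 - (norm w)\<^sup>2 - (norm s)\<^sup>2 ) / 4 - (norm v)\<^sup>2 / 8 + (norm v)\<^sup>2 / 8))
      * (complex_of_real (exp (- (norm y)\<^sup>2 / 2)) * cis (y \<bullet> ((1/2) *\<^sub>R J v)))" for y
  proof -
    define u where "u = y + (1/2) *\<^sub>R v"
    have u1: "y + ((1/2) *\<^sub>R v - w) = u - w" by (simp add: u_def)
    have e: "- (norm (u - w))\<^sup>2 / 4 + - (norm (s - u))\<^sup>2 / 4 =
      ((norm v)\<^sup>2 / 2 - (norm w)\<^sup>2 - (norm s)\<^sup>2) / 4 - (norm y)\<^sup>2 / 2"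
      unfolding u_def v_def power2_norm_eq_inner
      by (simp add: inner_simps inner_commute algebra_simps) (simp add: field_simps)
    \<comment> \<open>The shift drops out of the phase because
      \<open>v \<bullet> J v = 0\<close>.\<close>
    have ph: "((u - w) \<bullet> J w + (u - w + w) \<bullet> J s) / 2 = y \<bullet> ((1/2) *\<^sub>R J v)"
    proof -
      have "(u - w) \<bullet> J w + u \<bullet> J s = u \<bullet> J v" by (simp add: v_def J_simps inner_simps J_self)
      also have "\<dots> = y \<bullet> J v" by (simp add: u_def inner_simps J_self)
      finally show ?thesis by simp
    qed
    have g: "gauss (u - w) * gauss (s - u) =
        exp (((norm v)\<^sup>2 / 2 - (norm w)\<^sup>2 - (norm s)\<^sup>2) / 4) * exp (- (norm y)\<^sup>2 / 2)"
      unfolding gauss_def exp_add[symmetric] e by simp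
    have "f (u - w) = complex_of_real (gauss (u - w) * gauss (s - u)) * cis (y \<bullet> ((1/2) *\<^sub>R J v))"
      unfolding f_def ph by simp
    then show ?thesis unfolding u1 g by (simp add: mult_ac)
  qed
  have "(\<integral>z. f z \<partial>lborel) = (\<integral>y. f (y + ((1/2) *\<^sub>R v - w)) \<partial>lborel)"
    by (rule lborel_integral_translation[symmetric, OF meas])
  also have "\<dots> = complex_of_real (exp (((norm v)\<^sup>2 / 2 - (norm w)\<^sup>2 - (norm s)\<^sup>2 ) / 4))
      * complex_of_real (gauss_mass * exp (- (norm ((1/2) *\<^sub>R J v))\<^sup>2 / 2))"
    unfolding * integral_mult_right_zero gaussian_char_integral(2) gauss_mass_def by simp
  also have "\<dots> = complex_of_real (gauss_mass * (exp (((norm v)\<^sup>2 / 2 - (norm w)\<^sup>2 - (norm s)\<^sup>2 ) / 4)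
      * exp (- (norm v)\<^sup>2 / 8)))"
    by (simp add: J_norm power_mult_distrib power_divide)
  also have "exp (((norm v)\<^sup>2 / 2 - (norm w)\<^sup>2 - (norm s)\<^sup>2 ) / 4) * exp (- (norm v)\<^sup>2 / 8)
      = gauss w * gauss s"
    unfolding gauss_def exp_add[symmetric] by (rule arg_cong[of _ _ exp]) (simp add: field_simps)
  finally show ?thesis unfolding f_def by (simp add: mult.assoc)
qed

text \<open>Von Neumann's identity for \<open>P W(w) P\<close>. The product of \<open>W z\<close>,
  \<open>W w\<close>, \<open>W z'\<close> is a phase times \<open>W s\<close> with s = z + w + z'.
  Taking \<open>s\<close> as the new variable and exchanging the integrals leaves the twisted
  convolution as the weight of \<open>W s\<close>.\<close>

lemma vac_op_sandwich: "vac_op (W w (vac_op x)) = complex_of_real (gauss_mass * gauss w) *\<^sub>C vac_op x"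
proof -
  have "cinner (vac_op (W w (vac_op x))) y = cinner (complex_of_real (gauss_mass * gauss w) *\<^sub>C vac_op x) y" for y
  proof -
    define F where "F z s = complex_of_real (gauss z * gauss (s - z - w)) *
      cis ((z \<bullet> J w + (z + w) \<bullet> J s) / 2) * cinner (W s x) y" for z s
    have inner: "complex_of_real (gauss z) * cinner (W z (W w (vac_op x))) y = (\<integral>s. F z s \<partial>lborel)" for z
    proof -
      define f where "f z' = complex_of_real (gauss z') * cinner (W z' x) (W (- w) (W (- z) y))" for z'
      \<comment> \<open>The phases from the two multiplications combine; the part of the second one
        that comes from subtracting \<open>z + w\<close> vanishes by skewness.\<close>
      have f: "complex_of_real (gauss z) * f (s - (z + w)) = F z s" for s
      proof -
        have "cinner (W (s - (z + w)) x) (W (- w) (W (- z) y)) = cinner (W z (W w (W (s - (z + w)) x))) y"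
          by (simp add: W_adjoint)
        also have "W z (W w (W (s - (z + w)) x)) = cis ((z \<bullet> J w + (z + w) \<bullet> J (s - (z + w))) / 2) *\<^sub>C W s x"
          by (simp add: W_mult unitary_scaleC[OF W_unitary] scaleC_scaleC cis_mult add.assoc)
            (simp add: J_simps inner_simps add_divide_distrib diff_divide_distrib algebra_simps)
        also have "(z + w) \<bullet> J (s - (z + w)) = (z + w) \<bullet> J s"
          by (simp only: J_simps(2) inner_diff_right J_self)
        finally show ?thesis by (simp add: f_def F_def cinner_simps diff_diff_eq)
      qed
      have "cinner (W z (W w (vac_op x))) y = (\<integral>z'. f z' \<partial>lborel)"
        by (simp add: W_adjoint cinner_vac_op vac_form_def f_def)
      also have "\<dots> = (\<integral>s. f (s - (z + w)) \<partial>lborel)"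
      proof -
        have "f \<in> borel_measurable borel"
          unfolding f_def by (intro borel_measurable_continuous_onI continuous_intros)
        from lborel_integral_translation[OF this, of "- (z + w)"] show ?thesis
          by (simp only: add_uminus_conv_diff)
      qed
      finally have "complex_of_real (gauss z) * cinner (W z (W w (vac_op x))) y
          = (\<integral>s. complex_of_real (gauss z) * f (s - (z + w)) \<partial>lborel)" by simp
      then show ?thesis unfolding f .
    qed
    have "cinner (vac_op (W w (vac_op x))) y = (\<integral>z. \<integral>s. F z s \<partial>lborel \<partial>lborel)"
      unfolding cinner_vac_op vac_form_def inner ..
    also have "\<dots> = (\<integral>s. \<integral>z. F z s \<partial>lborel \<partial>lborel)"
    proof (rule lborel_fubini[where a="\<lambda>z. gauss z * (norm x * norm y)" and b=gauss and \<phi>="\<lambda>z. z + w"])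
      show "continuous_on UNIV (\<lambda>(z, s). F z s)"
        unfolding F_def case_prod_beta by (intro continuous_intros) auto
      show "cmod (F z s) \<le> gauss z * (norm x * norm y) * gauss (s - (z + w))" for z s
        using mult_left_mono[OF cmod_coefficient_le[of s x y], of "gauss z * gauss (s - z - w)"]
          gauss_pos[of z] gauss_pos[of "s - z - w"]
        by (simp add: F_def norm_mult diff_diff_eq mult_ac)
    qed (use gauss_integrable gauss_pos in \<open>auto simp: less_imp_le\<close>)
    also have "\<dots> = (\<integral>s. complex_of_real (gauss_mass * gauss w) *
        (complex_of_real (gauss s) * cinner (W s x) y) \<partial>lborel)"
      unfolding F_def integral_mult_left_zero gauss_twisted_convolution by (simp add: mult_ac)
    also have "\<dots> = complex_of_real (gauss_mass * gauss w) * cinner (vac_op x) y"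
      unfolding integral_mult_right_zero cinner_vac_op vac_form_def ..
    finally show ?thesis by (simp add: cinner_simps)
  qed
  then have "cinner (vac_op (W w (vac_op x)) - complex_of_real (gauss_mass * gauss w) *\<^sub>C vac_op x) y = 0" for y
    by (simp add: cinner_simps)
  from this[of "vac_op (W w (vac_op x)) - complex_of_real (gauss_mass * gauss w) *\<^sub>C vac_op x"]
  show ?thesis by (simp only: cinner_self_eq_zero right_minus_eq)
qed

text \<open>
  Averaging the conjugates \<open>W(-tw) P W(tw)\<close> of the vacuum operator \<open>P\<close> over a Gaussian in \<open>w\<close>
  replaces \<open>exp (-|z|\<^sup>2/4)\<close> by a Gaussian concentrating at \<open>0\<close> as \<open>t\<close> grows; so \<open>P = 0\<close> would
  force \<open>W(0) = 0\<close>.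
\<close>

lemma vac_op_conjugate:
  "cinner (vac_op (W w x)) (W w y) =
    (\<integral>z. complex_of_real (gauss z) * cis (z \<bullet> J w) * cinner (W z x) y \<partial>lborel)"
proof -
  have "cinner (W z (W w x)) (W w y) = cis (z \<bullet> J w) * cinner (W z x) y" for z
  proof -
    have "cinner (W z (W w x)) (W w y) = cinner (W (- w) (W z (W w x))) y"
      by (simp add: W_adjoint[of "- w"])
    also have "W (- w) (W z (W w x)) = cis (z \<bullet> J w) *\<^sub>C W z x"
      by (simp add: W_mult unitary_scaleC[OF W_unitary] scaleC_scaleC cis_mult)
        (simp add: J_simps inner_simps J_self J_skew[of w z])
    finally show ?thesis by (simp add: cinner_simps)
  qed
  then show ?thesis unfolding cinner_vac_op vac_form_def by (simp add: mult.assoc)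
qed

lemma vac_op_nonzero:
  assumes "(x::'h) \<noteq> 0"
  shows "\<exists>w. vac_op (W w x) \<noteq> 0"
proof (rule ccontr)
  assume "\<not> ?thesis"
  then have zero: "(\<integral>z. complex_of_real (gauss z) * cis (z \<bullet> J w) * cinner (W z x) x \<partial>lborel) = 0" for w
    using vac_op_conjugate[of w x x] by simp
  define c where "c z = cinner (W z x) x" for z
  define e where "e z = exp (- (norm z)\<^sup>2 / 2)" for z :: 'v
  have c_cont: "continuous_on S f \<Longrightarrow> continuous_on S (\<lambda>s. c (f s))" for S and f :: "'b::topological_space \<Rightarrow> 'v"
    unfolding c_def by (intro continuous_intros)
  have e_cont: "continuous_on S f \<Longrightarrow> continuous_on S (\<lambda>s. e (f s))" for S and f :: "'b::topological_space \<Rightarrow> 'v"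
    unfolding e_def by (intro continuous_intros) auto
  have e_int: "integrable lborel e"
    using integrable_gaussian[of "1/2", where 'v='v] by (simp add: e_def[abs_def])
  have e_nonneg: "0 \<le> e z" for z by (simp add: e_def)
  have c_le: "cmod (c z) \<le> (norm x)\<^sup>2" for z
    using cmod_coefficient_le[of z x x] by (simp add: c_def power2_eq_square)
  have smear: "(\<integral>z. complex_of_real (gauss z * e (t *\<^sub>R z)) * c z \<partial>lborel) = 0" for t
  proof -
    \<comment> \<open>The vanishing integrals for the points \<open>t *\<^sub>R w\<close> are
      averaged over \<open>w\<close> with the Gaussian \<open>e\<close>.\<close>
    define F where "F w z = complex_of_real (e w) * (complex_of_real (gauss z) * cis (z \<bullet> J (t *\<^sub>R w)) * c z)" for w z
    have "0 = (\<integral>w. \<integral>z. F w z \<partial>lborel \<partial>lborel)"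
      unfolding F_def integral_mult_right_zero c_def zero by simp
    also have "\<dots> = (\<integral>z. \<integral>w. F w z \<partial>lborel \<partial>lborel)"
    proof (rule lborel_fubini[where a="\<lambda>w. e w * (norm x)\<^sup>2" and b=gauss and \<phi>="\<lambda>_. 0"])
      show "continuous_on UNIV (\<lambda>(w, z). F w z)"
        unfolding F_def case_prod_beta by (intro continuous_intros c_cont e_cont)
      show "cmod (F w z) \<le> e w * (norm x)\<^sup>2 * gauss (z - 0)" for w z
        using mult_left_mono[OF c_le[of z], of "e w * gauss z"] gauss_pos[of z]
        by (simp add: F_def norm_mult e_def mult_ac)
    qed (use gauss_integrable gauss_pos e_int e_nonneg in \<open>auto simp: less_imp_le\<close>)
    also have "\<dots> = (\<integral>z. complex_of_real gauss_mass * (complex_of_real (gauss z * e (t *\<^sub>R z)) * c z) \<partial>lborel)"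
    proof (rule Bochner_Integration.integral_cong[OF refl])
      fix z
      \<comment> \<open>As a function of \<open>w\<close> this is a Gaussian times a character, with
        frequency \<open>- t *\<^sub>R J z\<close>; since \<open>J\<close> is isometric its
        transform is \<open>e (t *\<^sub>R z)\<close>.\<close>
      have "F w z = complex_of_real (gauss z) * c z *
          (complex_of_real (exp (- (norm w)\<^sup>2 / 2)) * cis (w \<bullet> (- t *\<^sub>R J z)))" for w
        using J_skew[of z w] by (simp add: F_def e_def J_simps mult_ac)
      then have "(\<integral>w. F w z \<partial>lborel) = complex_of_real (gauss z) * c z *
          complex_of_real (gauss_mass * exp (- (norm (- t *\<^sub>R J z))\<^sup>2 / 2))"
        by (simp only: integral_mult_right_zero gaussian_char_integral(2) gauss_mass_def)
      also have "norm (- t *\<^sub>R J z) = norm (t *\<^sub>R z)" by (simp add: J_norm)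
      finally show "(\<integral>w. F w z \<partial>lborel) =
          complex_of_real gauss_mass * (complex_of_real (gauss z * e (t *\<^sub>R z)) * c z)"
        by (simp add: e_def mult_ac)
    qed
    finally show ?thesis using gauss_mass_pos by simp
  qed
  \<comment> \<open>Rescaling \<open>z\<close> by \<open>1 / Suc n\<close> makes the concentrating
    Gaussian the fixed function \<open>e\<close>, while the remaining factors are evaluated ever
    closer to 0.\<close>
  define s where "s n z = complex_of_real (gauss ((1 / Suc n) *\<^sub>R z) * e z) * c ((1 / Suc n) *\<^sub>R z)" for n z
  have "(\<integral>z. s n z \<partial>lborel) = 0" for n
  proof -
    define f where "f z = complex_of_real (gauss z * e (real (Suc n) *\<^sub>R z)) * c z" for z
    have "f \<in> borel_measurable borel"
      unfolding f_def by (intro borel_measurable_continuous_onI continuous_intros c_cont e_cont)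
    from lborel_integral_affine[OF _ this, of "1 / Suc n" 0]
    have "(\<integral>z. f (0 + (1 / real (Suc n)) *\<^sub>R z) \<partial>lborel) = 0"
      using smear[of "Suc n"] unfolding f_def[abs_def] by (simp del: of_nat_Suc)
    moreover have "f (0 + (1 / real (Suc n)) *\<^sub>R z) = s n z" for z
      by (simp add: f_def s_def del: of_nat_Suc)
    ultimately show ?thesis by simp
  qed
  \<comment> \<open>By continuity at 0 the limit is the mass of \<open>e\<close> times |x|^2, which
    is not 0.\<close>
  moreover have "(\<lambda>n. \<integral>z. s n z \<partial>lborel) \<longlonglongrightarrow> (\<integral>z. complex_of_real (e z) * complex_of_real ((norm x)\<^sup>2) \<partial>lborel)"
  proof (rule integral_dominated_convergence[where w="\<lambda>z. e z * (norm x)\<^sup>2"])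
    show "(\<lambda>z. complex_of_real (e z) * complex_of_real ((norm x)\<^sup>2)) \<in> borel_measurable lborel"
      by (simp, intro borel_measurable_continuous_onI continuous_intros e_cont)
    show "s n \<in> borel_measurable lborel" for n
      unfolding s_def[abs_def] by (simp, intro borel_measurable_continuous_onI continuous_intros c_cont e_cont)
    show "integrable lborel (\<lambda>z. e z * (norm x)\<^sup>2)" using e_int by simp
    have c0: "c 0 = complex_of_real ((norm x)\<^sup>2)" by (simp add: c_def W_zero cinner_self)
    have lim: "(\<lambda>n. s n z) \<longlonglongrightarrow> complex_of_real (e z) * complex_of_real ((norm x)\<^sup>2)" for z
    proof -
      have z: "(\<lambda>n. (1 / Suc n) *\<^sub>R z) \<longlonglongrightarrow> 0"
        using tendsto_scaleR[OF LIMSEQ_inverse_real_of_nat tendsto_const[of z]] by (simp add: inverse_eq_divide)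
      have "isCont c 0" "isCont gauss 0"
        using c_cont[OF continuous_on_id, of UNIV] gauss_continuous[OF continuous_on_id, of UNIV]
        by (auto simp: continuous_on_eq_continuous_at)
      then have "(\<lambda>n. c ((1 / Suc n) *\<^sub>R z)) \<longlonglongrightarrow> c 0" "(\<lambda>n. gauss ((1 / Suc n) *\<^sub>R z)) \<longlonglongrightarrow> gauss 0"
        using isCont_tendsto_compose z by blast+
      then have "(\<lambda>n. complex_of_real (gauss ((1 / Suc n) *\<^sub>R z) * e z) * c ((1 / Suc n) *\<^sub>R z))
          \<longlonglongrightarrow> complex_of_real (gauss 0 * e z) * c 0"
        by (intro tendsto_intros)
      then show ?thesis by (simp add: s_def c0 gauss_def)
    qed
    then show "AE z in lborel. (\<lambda>n. s n z) \<longlonglongrightarrow> complex_of_real (e z) * complex_of_real ((norm x)\<^sup>2)"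
      by simp
    show "AE z in lborel. norm (s n z) \<le> e z * (norm x)\<^sup>2" for n
    proof (rule AE_I2)
      fix z
      have "gauss ((1 / Suc n) *\<^sub>R z) * e z \<le> 1 * e z"
        by (intro mult_right_mono) (auto simp: gauss_def e_def)
      then have "(gauss ((1 / Suc n) *\<^sub>R z) * e z) * cmod (c ((1 / Suc n) *\<^sub>R z)) \<le> e z * (norm x)\<^sup>2"
        using c_le by (intro mult_mono) (auto simp: e_def)
      moreover have "norm (s n z) = (gauss ((1 / Suc n) *\<^sub>R z) * e z) * cmod (c ((1 / Suc n) *\<^sub>R z))"
        unfolding s_def norm_mult[of "complex_of_real _"] norm_of_real
        using gauss_pos by (simp add: e_def less_imp_le)
      ultimately show "norm (s n z) \<le> e z * (norm x)\<^sup>2" by simp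
    qed
  qed
  ultimately have "(\<integral>z. complex_of_real (e z) * complex_of_real ((norm x)\<^sup>2) \<partial>lborel) = 0"
    using LIMSEQ_unique[OF tendsto_const] by fastforce
  moreover have "(\<integral>z. complex_of_real (e z) \<partial>lborel) = complex_of_real gauss_mass"
    using gaussian_char_integral(2)[of "0::'v"] by (simp add: e_def gauss_mass_def)
  ultimately have "complex_of_real gauss_mass * complex_of_real ((norm x)\<^sup>2) = 0"
    by (simp only: integral_mult_left_zero)
  then show False using gauss_mass_pos assms by simp
qed

text \<open>For \<open>y = P x'\<close> selfadjointness gives \<langle>W(w) y, y\<rangle> =
  \<langle>P W(w) P x', x'\<rangle>, and the sandwich identity makes this a multiple of the
  Gaussian. The value at \<open>w = 0\<close> identifies the factor with |y|^2, so normalising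
  \<open>y\<close> suffices.\<close>

lemma vacuum_vector_exists:
  assumes "(x::'h) \<noteq> 0"
  obtains \<Omega> where "\<And>w. cinner (W w \<Omega>) \<Omega> = complex_of_real (exp (- (norm w)\<^sup>2 / 4))"
proof -
  obtain w0 where w0: "vac_op (W w0 x) \<noteq> 0" using vac_op_nonzero[OF assms] by blast
  define y where "y = vac_op (W w0 x)"
  have y: "cinner (W w y) y = complex_of_real (gauss_mass * gauss w) * cinner (vac_op (W w0 x)) (W w0 x)" for w
  proof -
    have "cinner (W w y) y = cinner (vac_op (W w y)) (W w0 x)"
      by (simp add: y_def vac_op_selfadjoint)
    then show ?thesis unfolding y_def vac_op_sandwich by (simp add: cinner_simps)
  qed
  have "cinner y y = complex_of_real gauss_mass * cinner (vac_op (W w0 x)) (W w0 x)"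
    using y[of 0] by (simp add: W_zero gauss_def)
  then have yw: "cinner (W w y) y = complex_of_real (gauss w * (norm y)\<^sup>2)" for w
    unfolding y by (simp add: cinner_self)
  have ny: "norm y \<noteq> 0" using w0 by (simp add: y_def)
  have "cinner (W w ((1 / complex_of_real (norm y)) *\<^sub>C y)) ((1 / complex_of_real (norm y)) *\<^sub>C y)
      = complex_of_real (exp (- (norm w)\<^sup>2 / 4))" for w
    using ny yw[of w] by (simp add: cinner_simps unitary_scaleC[OF W_unitary] gauss_def power2_eq_square)
  then show thesis by (rule that)
qed

end

section \<open>Uniqueness\<close>

lemma C_k_SucI:
  assumes "\<And>x. (f has_derivative f' x) (at x)" "\<And>v. C_k k (\<lambda>x. f' x v)"
  shows "C_k (Suc k) f"
proof -
  \<comment> \<open>\<open>C_k\<close> refers to the chosen derivative; uniqueness identifies it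
    with the given one.\<close>
  have "frechet_derivative f (at x) = f' x" for x
    using frechet_derivative_at[OF assms(1)] by simp
  then show ?thesis using assms by (auto simp: differentiable_def)
qed

lemma C_k_SucD: "C_k (Suc k) f \<Longrightarrow> C_k k f"
proof (induction k arbitrary: f)
  case 0
  then show ?case by (auto intro!: differentiable_imp_continuous_on simp: differentiable_on_def)
next
  case (Suc k)
  have "C_k (Suc k) (\<lambda>x. frechet_derivative f (at x) v)" for v
    using Suc.prems unfolding C_k.simps(2)[of "Suc k"] by blast
  then have "\<forall>v. C_k k (\<lambda>x. frechet_derivative f (at x) v)"
    using Suc.IH by blast
  moreover have "\<forall>x. f differentiable (at x)" using Suc.prems by simp
  ultimately show ?case by simp
qed

lemma C_k_bounded_linear:
  assumes T: "bounded_linear T"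
  shows "C_k k f \<Longrightarrow> C_k k (\<lambda>x. T (f x))"
proof (induction k arbitrary: f)
  case 0
  then show ?case using bounded_linear.continuous_on[OF T] by simp
next
  case (Suc k)
  show ?case
  proof (rule C_k_SucI)
    show "((\<lambda>x. T (f x)) has_derivative (\<lambda>v. T (frechet_derivative f (at x) v))) (at x)" for x
      using Suc.prems by (intro bounded_linear.has_derivative[OF T]) (simp add: frechet_derivative_works[symmetric])
    show "C_k k (\<lambda>x. T (frechet_derivative f (at x) v))" for v
      using Suc.prems by (intro Suc.IH) simp
  qed
qed

lemma smooth_bounded_linear: "bounded_linear T \<Longrightarrow> smooth f \<Longrightarrow> smooth (\<lambda>x. T (f x))"
  by (simp add: smooth_def C_k_bounded_linear)

lemma C_k_add: "C_k k f \<Longrightarrow> C_k k g \<Longrightarrow> C_k k (\<lambda>x. f x + g x)"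
proof (induction k arbitrary: f g)
  case 0
  then show ?case by (auto intro: continuous_intros)
next
  case (Suc k)
  show ?case
  proof (rule C_k_SucI)
    show "((\<lambda>x. f x + g x) has_derivative (\<lambda>v. frechet_derivative f (at x) v + frechet_derivative g (at x) v)) (at x)" for x
      using Suc.prems by (intro has_derivative_add) (simp_all add: frechet_derivative_works[symmetric])
    show "C_k k (\<lambda>x. frechet_derivative f (at x) v + frechet_derivative g (at x) v)" for v
      using Suc.prems by (intro Suc.IH) simp_all
  qed
qed

text \<open>Linear scalar factors are what the Heisenberg group produces: its left-invariant vector
  fields have affine coefficients in exponential coordinates.\<close>

lemma C_k_scaleR:
  assumes l: "bounded_linear l"
  shows "C_k k f \<Longrightarrow> C_k k (\<lambda>x. l x *\<^sub>R f x)"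
proof (induction k arbitrary: f)
  case 0
  then show ?case using linear_continuous_on[OF l] by (auto intro: continuous_intros)
next
  case (Suc k)
  show ?case
  proof (rule C_k_SucI)
    show "((\<lambda>x. l x *\<^sub>R f x) has_derivative (\<lambda>v. l x *\<^sub>R frechet_derivative f (at x) v + l v *\<^sub>R f x)) (at x)" for x
      using Suc.prems bounded_linear_imp_has_derivative[OF l]
      by (intro has_derivative_scaleR) (simp_all add: frechet_derivative_works[symmetric])
    show "C_k k (\<lambda>x. l x *\<^sub>R frechet_derivative f (at x) v + l v *\<^sub>R f x)" for v
    proof (rule C_k_add)
      show "C_k k (\<lambda>x. l x *\<^sub>R frechet_derivative f (at x) v)"
        using Suc.prems by (intro Suc.IH) simp
      show "C_k k (\<lambda>x. l v *\<^sub>R f x)"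
        by (rule C_k_bounded_linear[OF bounded_linear_scaleR_right C_k_SucD[OF Suc.prems]])
    qed
  qed
qed

lemma smooth_add: "smooth f \<Longrightarrow> smooth g \<Longrightarrow> smooth (\<lambda>x. f x + g x)"
  by (simp add: smooth_def C_k_add)

lemma smooth_scaleR: "bounded_linear l \<Longrightarrow> smooth f \<Longrightarrow> smooth (\<lambda>x. l x *\<^sub>R f x)"
  by (simp add: smooth_def C_k_scaleR)

lemma smooth_frechet_derivative: "smooth f \<Longrightarrow> smooth (\<lambda>x. frechet_derivative f (at x) v)"
  unfolding smooth_def by (metis C_k.simps(2))

lemma smooth_differentiable: "smooth f \<Longrightarrow> f differentiable (at x)"
  unfolding smooth_def by (metis C_k.simps(2))

lemma bounded_linear_scaleC: "bounded_linear (\<lambda>x::'a::complex_inner. c *\<^sub>C x)"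
  by (rule bounded_bilinear.bounded_linear_right[OF bounded_bilinear_scaleC])

section \<open>Star-representations in terms of generators, projections and unitaries\<close>

lemma star_repD:
  assumes "star_rep R D \<rho>"
  shows "csubspace D" "closure D = UNIV" "clinear_on D (\<rho> t)"
    "v \<in> D \<Longrightarrow> \<rho> t v \<in> D"
    "v \<in> D \<Longrightarrow> star_cong R s t \<Longrightarrow> \<rho> s v = \<rho> t v"
    "v \<in> D \<Longrightarrow> \<rho> (Const c) v = c *\<^sub>C v"
    "v \<in> D \<Longrightarrow> \<rho> (s \<oplus> t) v = \<rho> s v + \<rho> t v"
    "v \<in> D \<Longrightarrow> \<rho> (s \<odot> t) v = \<rho> s (\<rho> t v)"
    "u \<in> D \<Longrightarrow> v \<in> D \<Longrightarrow> cinner (\<rho> t u) v = cinner u (\<rho> (t\<^sup>\<star>) v)"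
  using assms by (auto simp: star_rep_def image_subset_iff)

lemma star_rep_star:
  assumes "star_rep R D \<rho>" and "v \<in> D"
  shows "\<rho> ((Const c)\<^sup>\<star>) v = cnj c *\<^sub>C v" "\<rho> ((s \<oplus> t)\<^sup>\<star>) v = \<rho> (s\<^sup>\<star>) v + \<rho> (t\<^sup>\<star>) v"
    "\<rho> ((s \<odot> t)\<^sup>\<star>) v = \<rho> (t\<^sup>\<star>) (\<rho> (s\<^sup>\<star>) v)" "\<rho> (s\<^sup>\<star>\<^sup>\<star>) v = \<rho> s v"
  using star_repD(5)[OF assms sc_star_const] star_repD(5)[OF assms sc_star_add]
    star_repD(5)[OF assms sc_star_mul] star_repD(5)[OF assms sc_star_star] star_repD(6-8)[OF assms(1,2)]
  by simp_all

text \<open>The induction treats \<open>t\<close> and its adjoint together, because the star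
  constructor exchanges them.\<close>

lemma star_rep_invariant:
  assumes rep: "star_rep R D \<rho>" and K: "csubspace K"
    and gen: "\<And>g v. v \<in> D \<Longrightarrow> v \<in> K \<Longrightarrow> \<rho> (Gen g) v \<in> K \<and> \<rho> ((Gen g)\<^sup>\<star>) v \<in> K"
    and v: "v \<in> D" "v \<in> K"
  shows "\<rho> t v \<in> K"
proof -
  have "\<forall>v\<in>D \<inter> K. \<rho> t v \<in> K \<and> \<rho> (t\<^sup>\<star>) v \<in> K"
    by (induction t)
      (use gen in \<open>auto simp: star_repD[OF rep] star_rep_star[OF rep] csubspace_add[OF K] csubspace_scaleC[OF K]\<close>)
  then show ?thesis using v by auto
qed

lemma star_rep_intertwine:
  assumes rep: "star_rep R D \<rho>" and rep': "star_rep R' D' \<rho>'" and T: "clinear_on UNIV T" "\<And>v. v \<in> D \<Longrightarrow> T v \<in> D'"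
    and gen: "\<And>g v. v \<in> D \<Longrightarrow> T (\<rho> (Gen g) v) = \<rho>' (Gen g) (T v) \<and> T (\<rho> ((Gen g)\<^sup>\<star>) v) = \<rho>' ((Gen g)\<^sup>\<star>) (T v)"
    and v: "v \<in> D"
  shows "T (\<rho> t v) = \<rho>' t (T v)"
proof -
  have T': "T (x + y) = T x + T y" "T (c *\<^sub>C x) = c *\<^sub>C T x" for x y c
    using T(1) by (auto simp: clinear_on_def)
  have "\<forall>v\<in>D. T (\<rho> t v) = \<rho>' t (T v) \<and> T (\<rho> (t\<^sup>\<star>) v) = \<rho>' (t\<^sup>\<star>) (T v)"
    by (induction t)
      (use gen T(2) in \<open>auto simp: star_repD[OF rep] star_rep_star[OF rep] star_repD[OF rep'] star_rep_star[OF rep'] T'\<close>)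
  then show ?thesis using v by auto
qed

text \<open>The last clause is the working form: linearity and commutation with an operator reduce
  to checking a candidate for the projected vector.\<close>

lemma orthogonal_projection:
  fixes K :: "'h::chilbert_space set"
  assumes K: "csubspace K" "closed K"
  obtains P where "clinear_on UNIV P" "bounded_linear P" "\<And>x. P x \<in> K" "\<And>x. x - P x \<in> ortho_compl K"
    "\<And>x y. y \<in> K \<Longrightarrow> x - y \<in> ortho_compl K \<Longrightarrow> P x = y"
proof -
  have "\<forall>x. \<exists>u. u \<in> K \<and> x - u \<in> ortho_compl K"
    using orthogonal_decomposition[OF K] by blast
  then obtain P where P: "\<And>x. P x \<in> K" "\<And>x. x - P x \<in> ortho_compl K"
    by metis
  have unique: "P x = y" if y: "y \<in> K" "x - y \<in> ortho_compl K" for x y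
  proof -
    have "(x - y) - (x - P x) \<in> ortho_compl K"
      by (rule csubspace_diff[OF csubspace_ortho_compl y(2) P(2)])
    then have "P x - y \<in> ortho_compl K" by simp
    moreover have "P x - y \<in> K" by (rule csubspace_diff[OF K(1) P(1) y(1)])
    ultimately have "cinner (P x - y) (P x - y) = 0" unfolding ortho_compl_def by blast
    then show ?thesis by simp
  qed
  have lin: "clinear_on UNIV P"
    unfolding clinear_on_def
  proof (intro conjI ballI allI)
    fix x y c
    have "x + y - (P x + P y) \<in> ortho_compl K"
      using csubspace_add[OF csubspace_ortho_compl P(2)[of x] P(2)[of y]] by (simp add: algebra_simps)
    then show "P (x + y) = P x + P y" by (intro unique csubspace_add[OF K(1)] P)
    have "c *\<^sub>C x - c *\<^sub>C P x \<in> ortho_compl K"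
      using csubspace_scaleC[OF csubspace_ortho_compl P(2)[of x]] by (simp add: scaleC_diff_right)
    then show "P (c *\<^sub>C x) = c *\<^sub>C P x" by (intro unique csubspace_scaleC[OF K(1)] P)
  qed
  have "norm (P x) \<le> 1 * norm x" for x
  proof -
    have "cinner (P x) (x - P x) = 0" using P by (simp add: ortho_compl_def)
    then have "inner (P x) (x - P x) = 0" by (simp add: inner_eq_Re_cinner)
    then have "(norm x)\<^sup>2 = (norm (P x))\<^sup>2 + (norm (x - P x))\<^sup>2"
      unfolding power2_norm_eq_inner by (simp add: inner_diff_left inner_diff_right inner_commute)
    then have "(norm (P x))\<^sup>2 \<le> (norm x)\<^sup>2" by simp
    then show ?thesis by (simp add: power2_le_iff_abs_le)
  qed
  then have "bounded_linear P" by (rule bounded_linear_clinear[OF lin])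
  with lin show thesis using P unique by (rule that)
qed

lemma unitary_inv:
  assumes T: "unitary T"
  obtains S where "unitary S" "\<And>x. S (T x) = x" "\<And>y. T (S y) = y"
proof -
  have inj: "x = y" if "T x = T y" for x y
    using that unitary_norm[OF T, of "x - y"] by (simp add: unitary_diff[OF T])
  have "\<forall>y. \<exists>x. T x = y" using T unfolding unitary_def surj_def by metis
  then obtain S where S: "\<And>y. T (S y) = y" by metis
  have ST: "S (T x) = x" for x by (rule inj) (simp add: S)
  have "unitary S"
    unfolding unitary_def clinear_on_def
  proof (intro conjI ballI allI)
    show "S (x + y) = S x + S y" for x y by (rule inj) (simp add: S unitary_add[OF T])
    show "S (c *\<^sub>C x) = c *\<^sub>C S x" for x c by (rule inj) (simp add: S unitary_scaleC[OF T])
    show "surj S" using ST by (metis surjI)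
    show "cinner (S x) (S y) = cinner x y" for x y
      using unitary_cinner[OF T, of "S x" "S y"] by (simp add: S)
  qed
  then show thesis using ST S by (rule that)
qed

section \<open>Unitary representations of the Heisenberg group\<close>

lemma heis_mult_eq: "heis_mult (p, q, t) (p', q', t') = (p + p', q + q', t + t' + (p \<bullet> q' - q \<bullet> p') / 2)"
  by (simp add: heis_mult_def)

lemma heis_mult_inverse: "heis_mult (- g) g = 0" "heis_mult g (- g) = 0"
  by (cases g, simp add: heis_mult_def zero_prod_def inner_commute)+

lemma heis_rep_unitary: "heis_rep U \<Longrightarrow> unitary (U g)"
  and heis_rep_mult: "heis_rep U \<Longrightarrow> U (heis_mult g h) v = U g (U h v)"
  and heis_rep_continuous: "heis_rep U \<Longrightarrow> continuous_on UNIV (\<lambda>g. U g v)"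
  unfolding heis_rep_def by blast+

lemma heis_rep_zero:
  assumes "heis_rep U"
  shows "U 0 v = v"
proof -
  have "U 0 (U 0 v) = U 0 v"
    using heis_rep_mult[OF assms, of 0 0 v] by (simp add: heis_mult_def zero_prod_def)
  then have "U 0 (U 0 v - v) = 0" by (simp add: unitary_diff[OF heis_rep_unitary[OF assms]])
  then show ?thesis using unitary_norm[OF heis_rep_unitary[OF assms], of 0 "U 0 v - v"] by simp
qed

lemma heis_rep_inverse:
  assumes "heis_rep U"
  shows "U (- g) (U g v) = v" "U g (U (- g) v) = v"
  by (simp_all add: heis_mult_inverse heis_rep_zero[OF assms] flip: heis_rep_mult[OF assms])

lemma heis_rep_adjoint:
  assumes "heis_rep U"
  shows "cinner (U g x) y = cinner x (U (- g) y)"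
  using unitary_cinner[OF heis_rep_unitary[OF assms], of g x "U (- g) y"]
  by (simp add: heis_rep_inverse[OF assms])

text \<open>Names the group representation that \<open>integrable_rep\<close> only asserts to
  exist.\<close>

locale integrable_ccr =
  fixes D :: "'h::chilbert_space set" and \<rho> :: "'n::finite star_expr \<Rightarrow> 'h \<Rightarrow> 'h"
    and U :: "'n heis \<Rightarrow> 'h \<Rightarrow> 'h"
  assumes rep: "star_rep ccr_rels D \<rho>" and U: "heis_rep U" and D_smooth: "D = smooth_vectors U"
    and deriv: "v \<in> D \<Longrightarrow> ((\<lambda>s. U (s *\<^sub>R X) v) has_vector_derivative heis_lie_act \<rho> X v) (at 0)"
begin

text \<open>On \<open>D\<close> the centre is generated by the scalar \<i>, so
  \<open>cis (- s) *\<^sub>C U (0, 0, s) v\<close> has derivative 0 and is constant in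
  \<open>s\<close>; density of \<open>D\<close> extends the result. This fixes the phases that a
  Weyl system requires.\<close>

lemma central_action: "U (0, 0, s) v = cis s *\<^sub>C v"
proof -
  let ?Z = "(0, 0, 1) :: 'n heis"
  have D: "U (0, 0, s) v = cis s *\<^sub>C v" if v: "v \<in> D" for v s
  proof -
    define \<phi> where "\<phi> s = cis (- s) *\<^sub>C U (0, 0, s) v" for s
    have 0: "((\<lambda>s. U (0, 0, s) v) has_vector_derivative \<i> *\<^sub>C v) (at 0)"
      using deriv[OF v, of ?Z] by (simp add: heis_lie_act_def)
    have \<phi>: "(\<phi> has_derivative (\<lambda>h. 0)) (at s)" for s
    proof -
      \<comment> \<open>The derivative is given at 0 only; the group law transports it to
        \<open>s\<close>.\<close>
      have "((\<lambda>r. U (0, 0, r - s) v) has_vector_derivative \<i> *\<^sub>C v) (at s)"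
      proof -
        have "((\<lambda>r. r - s) has_vector_derivative 1) (at s)"
          by (auto intro!: derivative_eq_intros)
        moreover have "((\<lambda>s. U (0, 0, s) v) has_vector_derivative \<i> *\<^sub>C v) (at (s - s))" using 0 by simp
        ultimately have "((\<lambda>s. U (0, 0, s) v) \<circ> (\<lambda>r. r - s) has_vector_derivative 1 *\<^sub>R (\<i> *\<^sub>C v)) (at s)"
          by (rule vector_diff_chain_at)
        then show ?thesis by (simp add: comp_def)
      qed
      from bounded_linear.has_vector_derivative[OF unitary_bounded_linear[OF heis_rep_unitary[OF U]] this, of "(0, 0, s)"]
      have "((\<lambda>r. U (0, 0, s) (U (0, 0, r - s) v)) has_vector_derivative U (0, 0, s) (\<i> *\<^sub>C v)) (at s)" .
      then have d: "((\<lambda>r. U (0, 0, r) v) has_vector_derivative \<i> *\<^sub>C U (0, 0, s) v) (at s)"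
        by (simp add: heis_mult_eq unitary_scaleC[OF heis_rep_unitary[OF U]] flip: heis_rep_mult[OF U])
      have "((\<lambda>r. cis (- r)) has_derivative (\<lambda>t. (- t) *\<^sub>R (\<i> * cis (- s)))) (at s)"
        by (auto intro!: derivative_eq_intros)
      from bounded_bilinear.FDERIV[OF bounded_bilinear_scaleC this d[unfolded has_vector_derivative_def]]
      have "(\<phi> has_derivative (\<lambda>h. cis (- s) *\<^sub>C (h *\<^sub>R (\<i> *\<^sub>C U (0, 0, s) v)) +
          (- h *\<^sub>R (\<i> * cis (- s))) *\<^sub>C U (0, 0, s) v)) (at s)"
        unfolding \<phi>_def .
      moreover have "cis (- s) *\<^sub>C (h *\<^sub>R (\<i> *\<^sub>C U (0, 0, s) v)) +
          (- h *\<^sub>R (\<i> * cis (- s))) *\<^sub>C U (0, 0, s) v = 0" for h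
        by (simp add: scaleR_scaleC scaleC_scaleC scaleR_conv_of_real mult_ac scaleC_minus_left)
      ultimately show ?thesis by simp
    qed
    then have "\<exists>c. \<forall>x\<in>UNIV. \<phi> x = c" by (intro has_derivative_zero_constant) auto
    then have "\<phi> s = \<phi> 0" by auto
    also have "\<dots> = v" using heis_rep_zero[OF U, of v] by (simp add: \<phi>_def zero_prod_def)
    finally have "cis s *\<^sub>C \<phi> s = cis s *\<^sub>C v" by simp
    then show ?thesis by (simp add: \<phi>_def scaleC_scaleC cis_mult)
  qed
  have "closed {v. U (0, 0, s) v = cis s *\<^sub>C v}"
    by (intro closed_Collect_eq linear_continuous_on unitary_bounded_linear heis_rep_unitary[OF U] bounded_linear_scaleC)
  then have "closure D \<subseteq> {v. U (0, 0, s) v = cis s *\<^sub>C v}" using D by (intro closure_minimal) auto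
  then show ?thesis using star_repD(2)[OF rep] by auto
qed

lemma central_factor: "U (p, q, t) v = cis t *\<^sub>C U (p, q, 0) v"
proof -
  have "U (p, q, t) v = U (0, 0, t) (U (p, q, 0) v)"
    by (simp add: heis_mult_eq flip: heis_rep_mult[OF U])
  then show ?thesis by (simp add: central_action)
qed

text \<open>The rotation \<open>(p, q) \<mapsto> (q, - p)\<close> is the isometry that expresses the
  symplectic form of the group law through the inner product.\<close>

lemma weyl: "weyl_system (\<lambda>(p, q). U (p, q, 0)) (\<lambda>(p, q). (q, - p))"
proof (rule weyl_system.intro)
  show "unitary (case z of (p, q) \<Rightarrow> U (p, q, 0))" for z
    by (cases z) (simp add: heis_rep_unitary[OF U])
  show "(case z of (p, q) \<Rightarrow> U (p, q, 0)) ((case w of (p, q) \<Rightarrow> U (p, q, 0)) x) =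
      cis ((z \<bullet> (case w of (p, q) \<Rightarrow> (q, - p))) / 2) *\<^sub>C (case z + w of (p, q) \<Rightarrow> U (p, q, 0)) x" for z w x
  proof (cases z, cases w)
    fix p q p' q' assume "z = (p, q)" "w = (p', q')"
    then show ?thesis
      using central_factor[of "p + p'" "q + q'" "(p \<bullet> q' - q \<bullet> p') / 2" x]
      by (simp add: heis_mult_eq flip: heis_rep_mult[OF U])
  qed
  show "continuous_on UNIV (\<lambda>z. (case z of (p, q) \<Rightarrow> U (p, q, 0)) x)" for x
    unfolding case_prod_beta
    by (rule continuous_on_compose2[OF heis_rep_continuous[OF U, of x]]) (auto intro!: continuous_intros)
  show "linear (\<lambda>(p, q). (q, - p))" by unfold_locales auto
  show "norm (case z of (p, q) \<Rightarrow> (q, - p)) = norm z" for z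
    by (cases z) (simp add: norm_Pair add.commute)
  show "z \<bullet> (case w of (p, q) \<Rightarrow> (q, - p)) = - (w \<bullet> (case z of (p, q) \<Rightarrow> (q, - p)))" for z w
    by (cases z; cases w) (simp add: inner_commute)
qed

lemma vacuum_exists:
  assumes "\<exists>v::'h. v \<noteq> 0"
  obtains \<Omega> where "\<And>p q t. cinner (U (p, q, t) \<Omega>) \<Omega> = cis t * complex_of_real (exp (- (norm (p, q))\<^sup>2 / 4))"
proof -
  interpret weyl_system "\<lambda>(p, q). U (p, q, 0)" "\<lambda>(p, q). (q, - p)" by (rule weyl)
  obtain v :: 'h where "v \<noteq> 0" using assms by blast
  from vacuum_vector_exists[OF this] obtain \<Omega> where
    "\<And>w. cinner ((case w of (p, q) \<Rightarrow> U (p, q, 0)) \<Omega>) \<Omega> = complex_of_real (exp (- (norm w)\<^sup>2 / 4))"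
    by blast
  from this[of "(_, _)"] have "cinner (U (p, q, t) \<Omega>) \<Omega> = cis t * complex_of_real (exp (- (norm (p, q))\<^sup>2 / 4))" for p q t
    by (simp add: central_factor[of p q t] cinner_simps)
  then show thesis by (rule that)
qed

text \<open>Annihilation and creation operators recovered from position and momentum. Whatever is
  proved about derivatives of the group action thereby reaches all of \<open>\<rho>\<close>.\<close>

lemma rep_gen_eq:
  assumes "v \<in> D"
  shows "\<rho> ((Gen j)\<^sup>\<star>) v = complex_of_real (1 / sqrt 2) *\<^sub>C
      (heis_lie_act \<rho> (axis j 1, 0, 0) v - \<i> *\<^sub>C heis_lie_act \<rho> (0, axis j 1, 0) v)"
    and "\<rho> (Gen j) v = - (complex_of_real (1 / sqrt 2) *\<^sub>C
      (heis_lie_act \<rho> (axis j 1, 0, 0) v + \<i> *\<^sub>C heis_lie_act \<rho> (0, axis j 1, 0) v))"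
proof -
  have s2: "complex_of_real (sqrt 2) * complex_of_real (sqrt 2) = 2"
    by (simp flip: of_real_mult)
  have sum_axis: "(\<Sum>k\<in>UNIV. complex_of_real (axis j 1 $ k / sqrt 2) *\<^sub>C f k) = complex_of_real (1 / sqrt 2) *\<^sub>C f j"
    "(\<Sum>k\<in>UNIV. (\<i> * complex_of_real (axis j 1 $ k / sqrt 2)) *\<^sub>C f k) = (\<i> * complex_of_real (1 / sqrt 2)) *\<^sub>C f j"
    for f :: "'n \<Rightarrow> 'h"
  proof -
    have "(\<Sum>k\<in>UNIV. complex_of_real (axis j 1 $ k / sqrt 2) *\<^sub>C f k)
        = (\<Sum>k\<in>UNIV. if k = j then complex_of_real (1 / sqrt 2) *\<^sub>C f j else 0)"
      by (intro sum.cong) (auto simp: axis_def)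
    then show "(\<Sum>k\<in>UNIV. complex_of_real (axis j 1 $ k / sqrt 2) *\<^sub>C f k) = complex_of_real (1 / sqrt 2) *\<^sub>C f j"
      by simp
    have "(\<Sum>k\<in>UNIV. (\<i> * complex_of_real (axis j 1 $ k / sqrt 2)) *\<^sub>C f k)
        = (\<Sum>k\<in>UNIV. if k = j then (\<i> * complex_of_real (1 / sqrt 2)) *\<^sub>C f j else 0)"
      by (intro sum.cong) (auto simp: axis_def)
    then show "(\<Sum>k\<in>UNIV. (\<i> * complex_of_real (axis j 1 $ k / sqrt 2)) *\<^sub>C f k) = (\<i> * complex_of_real (1 / sqrt 2)) *\<^sub>C f j"
      by simp
  qed
  let ?a = "\<rho> ((Gen j)\<^sup>\<star>) v" and ?c = "\<rho> (Gen j) v" and ?r = "complex_of_real (1 / sqrt 2)"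
  have A: "heis_lie_act \<rho> (axis j 1, 0, 0) v = ?r *\<^sub>C (?a - ?c)"
    unfolding heis_lie_act_def prod.case sum.distrib sum_axis by simp
  have B: "heis_lie_act \<rho> (0, axis j 1, 0) v = (\<i> * ?r) *\<^sub>C (?a + ?c)"
    unfolding heis_lie_act_def prod.case sum.distrib sum_axis by simp
  have iB: "\<i> *\<^sub>C heis_lie_act \<rho> (0, axis j 1, 0) v = - (?r *\<^sub>C (?a + ?c))"
    unfolding B scaleC_scaleC by (simp add: scaleC_minus_left flip: mult.assoc)
  have half: "?r *\<^sub>C ?r *\<^sub>C (2 *\<^sub>R x) = x" for x :: 'h
    using s2 by (simp add: scaleR_scaleC scaleC_scaleC field_simps)
  have "heis_lie_act \<rho> (axis j 1, 0, 0) v - \<i> *\<^sub>C heis_lie_act \<rho> (0, axis j 1, 0) v = ?r *\<^sub>C (2 *\<^sub>R ?a)"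
    unfolding A iB by (simp add: scaleR_2 flip: scaleC_add_right)
  then show "?a = ?r *\<^sub>C (heis_lie_act \<rho> (axis j 1, 0, 0) v - \<i> *\<^sub>C heis_lie_act \<rho> (0, axis j 1, 0) v)"
    by (simp only: half)
  have "heis_lie_act \<rho> (axis j 1, 0, 0) v + \<i> *\<^sub>C heis_lie_act \<rho> (0, axis j 1, 0) v = - (?r *\<^sub>C (2 *\<^sub>R ?c))"
    unfolding A iB by (simp add: scaleR_2 scaleC_add_right scaleC_diff_right)
  then show "?c = - (?r *\<^sub>C (heis_lie_act \<rho> (axis j 1, 0, 0) v + \<i> *\<^sub>C heis_lie_act \<rho> (0, axis j 1, 0) v))"
    by (simp only: scaleC_minus_right half minus_minus)
qed

text \<open>The orbit of \<open>v\<close> stays in \<open>K\<close>, so the projection onto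
  \<open>K\<close> fixes the curve and therefore its derivative.\<close>

lemma lie_act_in_closed_invariant:
  assumes K: "csubspace K" "closed K" "\<And>g x. x \<in> K \<Longrightarrow> U g x \<in> K" and v: "v \<in> D" "v \<in> K"
  shows "heis_lie_act \<rho> X v \<in> K"
proof -
  obtain P where P: "bounded_linear P" "\<And>x. P x \<in> K" "\<And>x y. y \<in> K \<Longrightarrow> x - y \<in> ortho_compl K \<Longrightarrow> P x = y"
    using orthogonal_projection[OF K(1,2)] by metis
  have PK: "P x = x" if "x \<in> K" for x
    by (rule P(3)[OF that]) (simp add: csubspace_zero[OF csubspace_ortho_compl])
  have "((\<lambda>s. U (s *\<^sub>R X) v) has_vector_derivative P (heis_lie_act \<rho> X v)) (at 0)"
    using bounded_linear.has_vector_derivative[OF P(1) deriv[OF v(1), of X]] by (simp add: PK K(3) v(2))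
  then have "heis_lie_act \<rho> X v = P (heis_lie_act \<rho> X v)"
    by (rule vector_derivative_unique_at[OF deriv[OF v(1)]])
  then show ?thesis using P(2) by metis
qed

lemma rep_in_closed_invariant:
  assumes K: "csubspace K" "closed K" "\<And>g x. x \<in> K \<Longrightarrow> U g x \<in> K" and v: "v \<in> D" "v \<in> K"
  shows "\<rho> t v \<in> K"
proof (rule star_rep_invariant[OF rep K(1) _ v])
  fix j v assume v: "v \<in> D" "v \<in> K"
  note act = lie_act_in_closed_invariant[OF K v]
  have "- x \<in> K" if "x \<in> K" for x
    using csubspace_diff[OF K(1) csubspace_zero[OF K(1)] that] by simp
  then show "\<rho> (Gen j) v \<in> K \<and> \<rho> ((Gen j)\<^sup>\<star>) v \<in> K"
    unfolding rep_gen_eq[OF v(1)]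
    by (metis K(1) act csubspace_scaleC csubspace_diff csubspace_add)
qed

text \<open>The closed span of the orbit and its complement are invariant under the group, hence
  under \<open>\<rho>\<close>. Irreducibility applies once the projection is known to split the
  domain as well.\<close>

lemma cyclic:
  assumes irr: "irreducible_rep D \<rho>" and "\<Omega> \<noteq> 0"
  shows "closure (lin_span (\<lambda>g. U g \<Omega>)) = UNIV"
proof -
  define K where "K = closure (lin_span (\<lambda>g. U g \<Omega>))"
  have sub: "csubspace K" unfolding K_def by (intro csubspace_closure csubspace_lin_span)
  have cl: "closed K" by (simp add: K_def)
  have inv: "U g x \<in> K" if "x \<in> K" for g x
  proof -
    have bl: "bounded_linear (U g)" by (rule unitary_bounded_linear[OF heis_rep_unitary[OF U]])
    have "csubspace {x. U g x \<in> K}"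
      using linear_0[OF bounded_linear.linear[OF bl]]
      by (auto simp: csubspace_def unitary_add[OF heis_rep_unitary[OF U]]
          unitary_scaleC[OF heis_rep_unitary[OF U]] csubspace_add[OF sub] csubspace_scaleC[OF sub] csubspace_zero[OF sub])
    moreover have "U g (U h \<Omega>) \<in> K" for h
      using lin_span_base[of "\<lambda>g. U g \<Omega>" "heis_mult g h"] closure_subset
      by (auto simp: K_def heis_rep_mult[OF U])
    ultimately have "lin_span (\<lambda>g. U g \<Omega>) \<subseteq> {x. U g x \<in> K}" by (intro lin_span_le) auto
    moreover have "closed {x. U g x \<in> K}"
      using continuous_closed_vimage[OF cl, of "U g"] linear_continuous_at[OF bl] by (simp add: vimage_def)
    ultimately have "K \<subseteq> {x. U g x \<in> K}" unfolding K_def by (rule closure_minimal)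
    then show ?thesis using that by blast
  qed
  have inv': "U g y \<in> ortho_compl K" if "y \<in> ortho_compl K" for g y
    unfolding ortho_compl_def
  proof (intro CollectI ballI)
    fix x assume "x \<in> K"
    then have "cinner (U (- g) x) y = 0" using inv that by (auto simp: ortho_compl_def)
    then show "cinner x (U g y) = 0" using heis_rep_adjoint[OF U, of "- g" x y] by simp
  qed
  obtain P where P: "clinear_on UNIV P" "bounded_linear P" "\<And>x. P x \<in> K" "\<And>x. x - P x \<in> ortho_compl K"
    "\<And>x y. y \<in> K \<Longrightarrow> x - y \<in> ortho_compl K \<Longrightarrow> P x = y"
    using orthogonal_projection[OF sub cl] by blast
  have comm: "P (U g x) = U g (P x)" for g x
  proof (rule P(5))
    show "U g (P x) \<in> K" by (intro inv P)
    have "U g (x - P x) \<in> ortho_compl K" by (intro inv' P)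
    then show "U g x - U g (P x) \<in> ortho_compl K" by (simp add: unitary_diff[OF heis_rep_unitary[OF U]])
  qed
  \<comment> \<open>The projection commutes with the group, so the orbit map of \<open>P v\<close>
    is a bounded linear image of that of \<open>v\<close>.\<close>
  have PD: "P v \<in> D" if "v \<in> D" for v
    using smooth_bounded_linear[OF P(2)] that by (simp add: D_smooth smooth_vectors_def comm[symmetric])
  have "K = {0} \<or> K = UNIV"
  proof -
    have 1: "\<forall>v\<in>D. \<exists>u \<in> D \<inter> K. \<exists>w \<in> D \<inter> ortho_compl K. v = u + w"
    proof
      fix v assume v: "v \<in> D"
      have "v - P v \<in> D \<inter> ortho_compl K"
        using csubspace_diff[OF star_repD(1)[OF rep] v PD[OF v]] P(4) by blast
      moreover have "P v \<in> D \<inter> K" using PD[OF v] P(3) by blast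
      ultimately show "\<exists>u \<in> D \<inter> K. \<exists>w \<in> D \<inter> ortho_compl K. v = u + w"
        by (intro bexI[of _ "P v"] bexI[of _ "v - P v"]) auto
    qed
    have 2: "\<forall>t. \<rho> t ` (D \<inter> K) \<subseteq> K"
      using rep_in_closed_invariant[OF sub cl inv] by auto
    have 3: "\<forall>t. \<rho> t ` (D \<inter> ortho_compl K) \<subseteq> ortho_compl K"
      using rep_in_closed_invariant[OF csubspace_ortho_compl closed_ortho_compl inv'] by auto
    show ?thesis using irr sub cl 1 2 3 unfolding irreducible_rep_def by blast
  qed
  moreover have "\<Omega> \<in> K"
    using lin_span_base[of "\<lambda>g. U g \<Omega>" 0] closure_subset by (auto simp: K_def heis_rep_zero[OF U])
  ultimately show ?thesis using \<open>\<Omega> \<noteq> 0\<close> by (auto simp: K_def)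
qed

end

text \<open>By unitarity the Gram matrix depends on \<open>heis_mult (- h) g\<close> only, that is
  on the positive definite function of the vector.\<close>

lemma heis_gram:
  assumes "heis_rep U" "heis_rep U'"
    and eq: "\<And>g. cinner (U g \<Omega>) \<Omega> = cinner (U' g \<Omega>') \<Omega>'"
  shows "cinner (U g \<Omega>) (U h \<Omega>) = cinner (U' g \<Omega>') (U' h \<Omega>')"
proof -
  have "cinner (U g \<Omega>) (U h \<Omega>) = cinner (U (- h) (U g \<Omega>)) \<Omega>"
    using heis_rep_adjoint[OF assms(1), of "- h" "U g \<Omega>" \<Omega>] by simp
  also have "\<dots> = cinner (U' (- h) (U' g \<Omega>')) \<Omega>'"
    by (simp add: eq flip: heis_rep_mult[OF assms(1)] heis_rep_mult[OF assms(2)])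
  also have "\<dots> = cinner (U' g \<Omega>') (U' h \<Omega>')"
    using heis_rep_adjoint[OF assms(2), of "- h" "U' g \<Omega>'" \<Omega>'] by simp
  finally show ?thesis .
qed

theorem Stone_von_Neumann:
  fixes D :: "'h::chilbert_space set" and D' :: "'k::chilbert_space set"
    and \<rho> :: "'n::finite star_expr \<Rightarrow> 'h \<Rightarrow> 'h"
  assumes "star_rep ccr_rels D \<rho>" "integrable_rep D \<rho>" and irr: "irreducible_rep D \<rho>"
    and "star_rep ccr_rels D' \<rho>'" "integrable_rep D' \<rho>'" and irr': "irreducible_rep D' \<rho>'"
  shows "unitarily_equivalent D \<rho> D' \<rho>'"
proof -
  obtain U where "integrable_ccr D \<rho> U"
    using assms(1,2) unfolding integrable_rep_def integrable_ccr_def by blast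
  then interpret A: integrable_ccr D \<rho> U .
  obtain U' where "integrable_ccr D' \<rho>' U'"
    using assms(4,5) unfolding integrable_rep_def integrable_ccr_def by blast
  then interpret B: integrable_ccr D' \<rho>' U' .
  obtain \<Omega> where \<Omega>: "\<And>p q t. cinner (U (p, q, t) \<Omega>) \<Omega> = cis t * complex_of_real (exp (- (norm (p, q))\<^sup>2 / 4))"
    using A.vacuum_exists irr unfolding irreducible_rep_def by blast
  obtain \<Omega>' where \<Omega>': "\<And>p q t. cinner (U' (p, q, t) \<Omega>') \<Omega>' = cis t * complex_of_real (exp (- (norm (p, q))\<^sup>2 / 4))"
    using B.vacuum_exists irr' unfolding irreducible_rep_def by blast
  have "\<Omega> \<noteq> 0" "\<Omega>' \<noteq> 0" using \<Omega>[of 0 0 0] \<Omega>'[of 0 0 0] by auto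
  note total = A.cyclic[OF irr this(1)] B.cyclic[OF irr' this(2)]
  have "cinner (U g \<Omega>) \<Omega> = cinner (U' g \<Omega>') \<Omega>'" for g by (cases g) (simp only: \<Omega> \<Omega>')
  note gram = heis_gram[OF A.U B.U this]
  obtain T where T: "unitary T" "\<And>g. T (U g \<Omega>) = U' g \<Omega>'"
    using gram_unitary[OF gram total] by blast
  \<comment> \<open>Both sides are unitary, and they agree on the total orbit by the group
    law.\<close>
  have TU: "T (U g x) = U' g (T x)" for g x
    by (rule unitary_eq_on_total[OF unitary_compose[OF T(1) heis_rep_unitary[OF A.U]]
          unitary_compose[OF heis_rep_unitary[OF B.U] T(1)] total(1)])
      (simp add: T(2) flip: heis_rep_mult[OF A.U] heis_rep_mult[OF B.U])
  obtain S where S: "unitary S" "\<And>x. S (T x) = x" "\<And>y. T (S y) = y"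
    using unitary_inv[OF T(1)] by blast
  have SU: "S (U' g y) = U g (S y)" for g y
    using arg_cong[OF TU[of g "S y"], of S] by (simp add: S)
  \<comment> \<open>The domains match because they are exactly the smooth vectors and
    \<open>T\<close> intertwines the group actions.\<close>
  have TD: "T v \<in> D'" if "v \<in> D" for v
    using smooth_bounded_linear[OF unitary_bounded_linear[OF T(1)]] that
    by (simp add: A.D_smooth B.D_smooth smooth_vectors_def TU[symmetric])
  have SD: "S v \<in> D" if "v \<in> D'" for v
    using smooth_bounded_linear[OF unitary_bounded_linear[OF S(1)]] that
    by (simp add: A.D_smooth B.D_smooth smooth_vectors_def SU[symmetric])
  have "T ` D = D'" using TD SD S by (metis image_subset_iff subsetI subset_antisym imageI)
  \<comment> \<open>The Lie algebra actions are derivatives of the intertwined curves, and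
    derivatives are unique.\<close>
  moreover have act: "T (heis_lie_act \<rho> X v) = heis_lie_act \<rho>' X (T v)" if v: "v \<in> D" for X v
  proof (rule vector_derivative_unique_at)
    show "((\<lambda>s. U' (s *\<^sub>R X) (T v)) has_vector_derivative T (heis_lie_act \<rho> X v)) (at 0)"
      using bounded_linear.has_vector_derivative[OF unitary_bounded_linear[OF T(1)] A.deriv[OF v, of X]]
      by (simp add: TU)
    show "((\<lambda>s. U' (s *\<^sub>R X) (T v)) has_vector_derivative heis_lie_act \<rho>' X (T v)) (at 0)"
      by (rule B.deriv[OF TD[OF v]])
  qed
  have neg: "T (- x) = - T x" for x using unitary_scaleC[OF T(1), of "- 1" x] by (simp add: scaleC_minus_one)
  have "T (\<rho> t v) = \<rho>' t (T v)" if v: "v \<in> D" for t v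
  proof (rule star_rep_intertwine[OF A.rep B.rep _ TD _ v])
    show "clinear_on UNIV T" using T(1) by (simp add: unitary_def)
    fix j v assume v: "v \<in> D"
    show "T (\<rho> (Gen j) v) = \<rho>' (Gen j) (T v) \<and> T (\<rho> ((Gen j)\<^sup>\<star>) v) = \<rho>' ((Gen j)\<^sup>\<star>) (T v)"
      unfolding A.rep_gen_eq[OF v] B.rep_gen_eq[OF TD[OF v]]
      by (simp add: neg unitary_scaleC[OF T(1)] unitary_add[OF T(1)] unitary_diff[OF T(1)] act[OF v])
  qed
  ultimately show ?thesis using T(1) unfolding unitarily_equivalent_def by blast
qed

section \<open>Creation and annihilation operators on the Fock space\<close>

type_synonym occ = "nat \<times> nat \<times> nat"

definition cnt :: "3 \<Rightarrow> occ \<Rightarrow> nat" where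
  "cnt j n = (case n of (k, l, m) \<Rightarrow> if j = 1 then k else if j = 2 then l else m)"

definition inc :: "3 \<Rightarrow> occ \<Rightarrow> occ" where
  "inc j n = (case n of (k, l, m) \<Rightarrow> if j = 1 then (Suc k, l, m) else if j = 2 then (k, Suc l, m) else (k, l, Suc m))"

text \<open>Subtraction truncates at an empty mode; \<open>cr\<close> multiplies by the square root
  of the occupation number, which is 0 there.\<close>

definition dec :: "3 \<Rightarrow> occ \<Rightarrow> occ" where
  "dec j n = (case n of (k, l, m) \<Rightarrow> if j = 1 then (k - 1, l, m) else if j = 2 then (k, l - 1, m) else (k, l, m - 1))"

text \<open>The eigenvalue of 1 plus the number operator.\<close>

definition wt :: "occ \<Rightarrow> real" where
  "wt n = (case n of (k, l, m) \<Rightarrow> 1 + real k + real l + real m)"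

lemma cases_3:
  fixes j :: 3
  obtains "j = 1" | "j = 2" | "j = 3"
  using exhaust_3[of j] by blast

lemma cnt_inc: "cnt i (inc j n) = (if i = j then Suc (cnt i n) else cnt i n)"
  by (cases n; cases i rule: cases_3; cases j rule: cases_3) (auto simp: cnt_def inc_def)

lemma cnt_dec: "cnt i (dec j n) = (if i = j then cnt i n - 1 else cnt i n)"
  by (cases n; cases i rule: cases_3; cases j rule: cases_3) (auto simp: cnt_def dec_def)

lemma dec_inc [simp]: "dec j (inc j n) = n"
  by (cases n; cases j rule: cases_3) (auto simp: dec_def inc_def)

lemma inc_dec: "cnt j n \<noteq> 0 \<Longrightarrow> inc j (dec j n) = n"
  by (cases n; cases j rule: cases_3) (auto simp: dec_def inc_def cnt_def)

lemma inc_commute: "inc i (inc j n) = inc j (inc i n)"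
  by (cases n; cases i rule: cases_3; cases j rule: cases_3) (auto simp: inc_def)

lemma dec_commute: "dec i (dec j n) = dec j (dec i n)"
  by (cases n; cases i rule: cases_3; cases j rule: cases_3) (auto simp: dec_def)

lemma dec_inc_other: "i \<noteq> j \<Longrightarrow> dec i (inc j n) = inc j (dec i n)"
  by (cases n; cases i rule: cases_3; cases j rule: cases_3) (auto simp: dec_def inc_def)

lemma wt_inc: "wt (inc j n) = wt n + 1"
  by (cases n; cases j rule: cases_3) (auto simp: wt_def inc_def)

lemma wt_cnt: "wt n = 1 + (\<Sum>j\<in>UNIV. real (cnt j n))"
  by (cases n) (simp add: wt_def cnt_def sum_3)

lemma wt_ge_1: "1 \<le> wt n"
  by (cases n) (simp add: wt_def)

lemma cnt_less_wt: "real (cnt j n) + 1 \<le> wt n"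
  by (cases n; cases j rule: cases_3) (auto simp: wt_def cnt_def)

text \<open>\<open>cr\<close> and \<open>an\<close> act on all families, summable or not, so the
  commutation relations hold pointwise and without domains.\<close>

definition cr :: "3 \<Rightarrow> (occ \<Rightarrow> complex) \<Rightarrow> occ \<Rightarrow> complex" where
  "cr j f n = complex_of_real (sqrt (real (cnt j n))) * f (dec j n)"

definition an :: "3 \<Rightarrow> (occ \<Rightarrow> complex) \<Rightarrow> occ \<Rightarrow> complex" where
  "an j f n = complex_of_real (sqrt (real (cnt j n) + 1)) * f (inc j n)"

lemma cr_linear: "cr j (\<lambda>n. f n + g n) = (\<lambda>n. cr j f n + cr j g n)" "cr j (\<lambda>n. c * f n) = (\<lambda>n. c * cr j f n)"
  by (auto simp: cr_def fun_eq_iff algebra_simps)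

lemma an_linear: "an j (\<lambda>n. f n + g n) = (\<lambda>n. an j f n + an j g n)" "an j (\<lambda>n. c * f n) = (\<lambda>n. c * an j f n)"
  by (auto simp: an_def fun_eq_iff algebra_simps)

lemma cr_minus: "cr j (\<lambda>n. - f n) = (\<lambda>n. - cr j f n)"
  by (auto simp: cr_def)

lemma an_minus: "an j (\<lambda>n. - f n) = (\<lambda>n. - an j f n)"
  by (auto simp: an_def)

lemma sqrt_sqrt_of_real: "0 \<le> x \<Longrightarrow> complex_of_real (sqrt x) * (complex_of_real (sqrt x) * z) = complex_of_real x * z"
  by (simp flip: of_real_mult mult.assoc)

lemma cr_an: "cr j (an j f) n = of_nat (cnt j n) * f n"
  using sqrt_sqrt_of_real[of "real (cnt j n)"]
  by (cases "cnt j n = 0") (auto simp: cr_def an_def inc_dec cnt_dec)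

lemma an_cr_same: "an j (cr j f) = (\<lambda>n. cr j (an j f) n + f n)"
proof (rule ext)
  fix n
  have "an j (cr j f) n = complex_of_real (sqrt (real (cnt j n) + 1)) * (complex_of_real (sqrt (real (cnt j n) + 1)) * f n)"
    by (simp add: an_def cr_def cnt_inc add.commute)
  also have "\<dots> = complex_of_real (real (cnt j n) + 1) * f n" by (rule sqrt_sqrt_of_real) simp
  finally show "an j (cr j f) n = cr j (an j f) n + f n" by (simp add: cr_an algebra_simps)
qed

lemma an_cr_other: "i \<noteq> j \<Longrightarrow> an i (cr j f) = cr j (an i f)"
  by (auto simp: an_def cr_def fun_eq_iff cnt_inc cnt_dec dec_inc_other)

lemma cr_commute: "cr i (cr j f) = cr j (cr i f)"
  by (cases "i = j") (auto simp: cr_def fun_eq_iff cnt_dec dec_commute)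

lemma an_commute: "an i (an j f) = an j (an i f)"
  by (cases "i = j") (auto simp: an_def fun_eq_iff cnt_inc inc_commute)

section \<open>Rapidly decreasing families\<close>

definition rapid :: "(occ \<Rightarrow> complex) \<Rightarrow> bool" where
  "rapid f \<longleftrightarrow> (\<forall>N. \<exists>C. \<forall>n. wt n ^ N * cmod (f n) \<le> C)"

lemma rapid_add: 
  assumes "rapid f" "rapid g"
  shows "rapid (\<lambda>n. f n + g n)"
  unfolding rapid_def
proof
  fix N
  obtain C where C: "\<And>n. wt n ^ N * cmod (f n) \<le> C" using assms unfolding rapid_def by blast
  obtain D where D: "\<And>n. wt n ^ N * cmod (g n) \<le> D" using assms unfolding rapid_def by blast
  have "wt n ^ N * cmod (f n + g n) \<le> C + D" for n
  proof -
    have "wt n ^ N * cmod (f n + g n) \<le> wt n ^ N * (cmod (f n) + cmod (g n))"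
      using wt_ge_1[of n] by (intro mult_left_mono norm_triangle_ineq) auto
    then show ?thesis using C[of n] D[of n] by (simp add: distrib_left)
  qed
  then show "\<exists>C. \<forall>n. wt n ^ N * cmod (f n + g n) \<le> C" by blast
qed

lemma rapid_scale:
  assumes "rapid f"
  shows "rapid (\<lambda>n. c * f n)"
  unfolding rapid_def
proof
  fix N
  obtain C where C: "\<And>n. wt n ^ N * cmod (f n) \<le> C" using assms unfolding rapid_def by blast
  have "wt n ^ N * cmod (c * f n) \<le> cmod c * C" for n
    using mult_left_mono[OF C[of n], of "cmod c"] by (simp add: norm_mult mult_ac)
  then show "\<exists>C. \<forall>n. wt n ^ N * cmod (c * f n) \<le> C" by blast
qed

lemma rapid_zero: "rapid (\<lambda>n. 0)" by (auto simp: rapid_def)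

text \<open>One additional power of the weight absorbs the square root, and passing to
  \<open>inc j n\<close> only enlarges the weight.\<close>

lemma rapid_an:
  assumes "rapid f"
  shows "rapid (an j f)"
  unfolding rapid_def
proof
  fix N
  obtain C where C: "\<And>n. wt n ^ Suc N * cmod (f n) \<le> C" using assms unfolding rapid_def by blast
  have "wt n ^ N * cmod (an j f n) \<le> C" for n
  proof -
    have "sqrt (real (cnt j n) + 1) \<le> real (cnt j n) + 1"
      by (rule real_le_lsqrt) (auto simp: power2_eq_square algebra_simps)
    then have s: "sqrt (real (cnt j n) + 1) \<le> wt (inc j n)"
      using cnt_less_wt[of j n] wt_inc[of j n] by linarith
    have "wt n ^ N \<le> wt (inc j n) ^ N"
      using wt_ge_1[of n] by (intro power_mono) (auto simp: wt_inc)
    then have "wt n ^ N * sqrt (real (cnt j n) + 1) \<le> wt (inc j n) ^ N * wt (inc j n)"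
      using s wt_ge_1[of n] by (intro mult_mono) (auto simp: wt_inc)
    then have "(wt n ^ N * sqrt (real (cnt j n) + 1)) * cmod (f (inc j n)) \<le> wt (inc j n) ^ Suc N * cmod (f (inc j n))"
      by (intro mult_right_mono) (auto simp: mult.commute)
    then show ?thesis using C[of "inc j n"] by (simp add: an_def norm_mult mult.assoc)
  qed
  then show "\<exists>C. \<forall>n. wt n ^ N * cmod (an j f n) \<le> C" by blast
qed

lemma rapid_cr:
  assumes "rapid f"
  shows "rapid (cr j f)"
  unfolding rapid_def
proof
  fix N
  obtain C where C: "\<And>n. wt n ^ Suc N * cmod (f n) \<le> C" using assms unfolding rapid_def by blast
  \<comment> \<open>\<open>max 0\<close> covers an empty mode, where the left-hand side is
    0.\<close>
  have "wt n ^ N * cmod (cr j f n) \<le> max 0 (2 ^ Suc N * C)" for n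
  proof (cases "cnt j n = 0")
    case False
    define m where "m = dec j n"
    have n: "n = inc j m" using inc_dec[OF False] by (simp add: m_def)
    \<comment> \<open>Lowering a mode costs a factor of at most 2 in the weight, since the weight is
      at least 1.\<close>
    have w: "wt n \<le> 2 * wt m" using wt_ge_1[of m] by (simp add: n wt_inc)
    have "sqrt (real (cnt j n)) \<le> real (cnt j n)" using False by (intro real_le_lsqrt) (auto simp: power2_eq_square)
    then have s: "sqrt (real (cnt j n)) \<le> 2 * wt m" using cnt_less_wt[of j n] w by linarith
    have "wt n ^ N * sqrt (real (cnt j n)) \<le> (2 * wt m) ^ N * (2 * wt m)"
      using s w wt_ge_1[of n] wt_ge_1[of m] by (intro mult_mono power_mono) auto
    then have "(wt n ^ N * sqrt (real (cnt j n))) * cmod (f m) \<le> ((2 * wt m) ^ N * (2 * wt m)) * cmod (f m)"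
      by (intro mult_right_mono) auto
    also have "\<dots> = 2 ^ Suc N * (wt m ^ Suc N * cmod (f m))"
      by (simp add: power_mult_distrib mult_ac)
    also have "\<dots> \<le> 2 ^ Suc N * C" by (intro mult_left_mono C) auto
    finally show ?thesis by (simp add: cr_def norm_mult m_def mult.assoc)
  qed (simp add: cr_def)
  then show "\<exists>C. \<forall>n. wt n ^ N * cmod (cr j f n) \<le> C" by blast
qed

text \<open>The stronger bound 2 - 1 / (1 + M), with one more summand, telescopes because 1 / n^2
  \<le> 1 / (n - 1) - 1 / n.\<close>

lemma sum_inverse_squares_le: "(\<Sum>k<M. 1 / (1 + real k)\<^sup>2) \<le> 2"
proof -
  have "(\<Sum>k<Suc M. 1 / (1 + real k)\<^sup>2) \<le> 2 - 1 / (1 + real M)"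
  proof (induction M)
    case (Suc M)
    have "1 / (1 + real (Suc M))\<^sup>2 \<le> 1 / (1 + real M) - 1 / (1 + real (Suc M))"
    proof -
      have "1 / (1 + real M) - 1 / (1 + real (Suc M)) = 1 / ((1 + real M) * (1 + real (Suc M)))"
        by (simp add: field_simps)
      moreover have "1 / (1 + real (Suc M))\<^sup>2 \<le> 1 / ((1 + real M) * (1 + real (Suc M)))"
        by (intro divide_left_mono) (auto simp: power2_eq_square)
      ultimately show ?thesis by simp
    qed
    then show ?case using Suc.IH by simp
  qed simp
  moreover have "(\<Sum>k<M. 1 / (1 + real k)\<^sup>2) \<le> (\<Sum>k<Suc M. 1 / (1 + real k)\<^sup>2)" by simp
  moreover have "0 \<le> 1 / (1 + real M)" by simp
  ultimately show ?thesis by linarith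
qed

text \<open>Three powers of the weight give one for each variable; squaring then yields a product of
  three inverse squares.\<close>

lemma rapid_sq_summable:
  assumes "rapid f"
  shows "sq_summable f"
proof -
  obtain C where C: "\<And>n. wt n ^ 3 * cmod (f n) \<le> C" using assms unfolding rapid_def by blast
  define g where "g k = 1 / (1 + real k)\<^sup>2" for k :: nat
  have g0: "0 \<le> g k" for k by (simp add: g_def)
  have le: "(cmod (f (k, l, m)))\<^sup>2 \<le> C\<^sup>2 * (g k * (g l * g m))" for k l m
  proof -
    have "(1 + real k) * ((1 + real l) * (1 + real m)) \<le> wt (k, l, m) * (wt (k, l, m) * wt (k, l, m))"
      by (intro mult_mono) (auto simp: wt_def)
    then have "(1 + real k) * ((1 + real l) * (1 + real m)) * cmod (f (k, l, m)) \<le> wt (k, l, m) ^ 3 * cmod (f (k, l, m))"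
      by (intro mult_right_mono) (auto simp: power3_eq_cube)
    then have "(1 + real k) * ((1 + real l) * (1 + real m)) * cmod (f (k, l, m)) \<le> C"
      using C order_trans by blast
    then have "((1 + real k) * ((1 + real l) * (1 + real m)) * cmod (f (k, l, m)))\<^sup>2 \<le> C\<^sup>2"
      by (intro power_mono) auto
    then have "(1 + real k)\<^sup>2 * (1 + real l)\<^sup>2 * (1 + real m)\<^sup>2 * (cmod (f (k, l, m)))\<^sup>2 \<le> C\<^sup>2"
      by (simp add: power_mult_distrib mult.assoc)
    moreover have "0 < (1 + real k)\<^sup>2 * (1 + real l)\<^sup>2 * (1 + real m)\<^sup>2" by (simp add: zero_less_mult_iff)
    ultimately show ?thesis
      by (simp add: g_def pos_le_divide_eq mult_ac)
  qed
  show ?thesis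
  proof (rule sq_summableI)
    fix F :: "occ set" assume F: "finite F"
    obtain M where M: "F \<subseteq> {..<M} \<times> {..<M} \<times> {..<M}"
    proof -
      have "finite (fst ` F \<union> fst ` snd ` F \<union> snd ` snd ` F)" using F by auto
      then obtain M where "fst ` F \<union> fst ` snd ` F \<union> snd ` snd ` F \<subseteq> {..<M}"
        using finite_nat_iff_bounded by blast
      then have "F \<subseteq> {..<M} \<times> {..<M} \<times> {..<M}" by force
      then show thesis by (rule that)
    qed
    have "(\<Sum>n\<in>F. (cmod (f n))\<^sup>2) \<le> (\<Sum>n\<in>{..<M} \<times> {..<M} \<times> {..<M}. (cmod (f n))\<^sup>2)"
      using M by (intro sum_mono2) auto
    also have "\<dots> = (\<Sum>k<M. \<Sum>l<M. \<Sum>m<M. (cmod (f (k, l, m)))\<^sup>2)"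
      by (simp add: sum.cartesian_product)
    also have "\<dots> \<le> (\<Sum>k<M. \<Sum>l<M. \<Sum>m<M. C\<^sup>2 * (g k * (g l * g m)))"
      by (intro sum_mono le)
    also have "\<dots> = C\<^sup>2 * ((\<Sum>k<M. g k) * ((\<Sum>l<M. g l) * (\<Sum>m<M. g m)))"
      by (simp only: sum_distrib_left[symmetric] sum_distrib_right[symmetric])
    also have "\<dots> \<le> C\<^sup>2 * (2 * (2 * 2))"
      using sum_inverse_squares_le[of M] g0
      by (intro mult_left_mono mult_mono) (auto simp: g_def[symmetric] intro!: sum_nonneg mult_nonneg_nonneg)
    finally show "(\<Sum>n\<in>F. (cmod (f n))\<^sup>2) \<le> C\<^sup>2 * (2 * (2 * 2))" .
  qed
qed

lemma rapidly_decreasing_iff: "f \<in> rapidly_decreasing \<longleftrightarrow> rapid (ell2_coord f)"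
  by (simp add: rapidly_decreasing_def rapid_def wt_def)

text \<open>The value is unspecified for families that are not square summable.\<close>

definition ell2_of :: "(occ \<Rightarrow> complex) \<Rightarrow> occ ell2" where
  "ell2_of f = Abs_ell2 f"

lemma coord_ell2_of: "sq_summable f \<Longrightarrow> ell2_coord (ell2_of f) = f"
  by (simp add: ell2_of_def Abs_ell2_inverse)

lemma coord_ell2_of_rapid [simp]: "rapid f \<Longrightarrow> ell2_coord (ell2_of f) = f"
  by (intro coord_ell2_of rapid_sq_summable)

lemma ell2_of_rapid [simp]: "rapid f \<Longrightarrow> ell2_of f \<in> rapidly_decreasing"
  by (simp add: rapidly_decreasing_iff)

lemma ell2_of_coord [simp]: "ell2_of (ell2_coord f) = f"
  by (simp add: ell2_of_def ell2_coord_inverse)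

lemma csubspace_rapidly_decreasing: "csubspace rapidly_decreasing"
  by (auto simp: csubspace_def rapidly_decreasing_iff zero_ell2.rep_eq plus_ell2.rep_eq scaleC_ell2.rep_eq
      rapid_zero rapid_add rapid_scale)

lemma cinner_has_sum: "((\<lambda>n. ell2_coord f n * cnj (ell2_coord g n)) has_sum cinner f g) UNIV"
  unfolding cinner_ell2.rep_eq
  using sq_summable_prod[OF sq_summable_coord[of f] sq_summable_coord[of g]] by (rule has_sum_infsum)

text \<open>Reindexing by \<open>inc j\<close>: the indices outside its range have an empty mode
  \<open>j\<close>, where \<open>cr j g\<close> vanishes.\<close>

lemma an_cr_adjoint:
  assumes "rapid f" "rapid g"
  shows "cinner (ell2_of (an j f)) (ell2_of g) = cinner (ell2_of f) (ell2_of (cr j g))"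
proof (rule has_sum_unique)
  let ?h = "\<lambda>n. f n * cnj (cr j g n)"
  show "((\<lambda>n. an j f n * cnj (g n)) has_sum cinner (ell2_of (an j f)) (ell2_of g)) UNIV"
    using cinner_has_sum[of "ell2_of (an j f)" "ell2_of g"] assms by (simp add: rapid_an)
  have h: "(?h has_sum cinner (ell2_of f) (ell2_of (cr j g))) UNIV"
    using cinner_has_sum[of "ell2_of f" "ell2_of (cr j g)"] assms by (simp add: rapid_cr)
  have "inj (inc j)" by (metis dec_inc injI)
  moreover have "(?h has_sum cinner (ell2_of f) (ell2_of (cr j g))) (range (inc j))"
  proof (rule has_sum_cong_neutral[THEN iffD1, OF _ _ _ h])
    show "?h n = 0" if "n \<in> UNIV - range (inc j)" for n
    proof -
      have "cnt j n = 0" using that inc_dec[of j n] by (metis DiffD2 rangeI)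
      then show ?thesis by (simp add: cr_def)
    qed
  qed auto
  ultimately have "((?h \<circ> inc j) has_sum cinner (ell2_of f) (ell2_of (cr j g))) UNIV"
    by (simp add: has_sum_reindex)
  also have "?h \<circ> inc j = (\<lambda>n. an j f n * cnj (g n))"
    by (auto simp: fun_eq_iff cr_def an_def cnt_inc add.commute)
  finally show "((\<lambda>n. an j f n * cnj (g n)) has_sum cinner (ell2_of f) (ell2_of (cr j g))) UNIV" .
qed

section \<open>The Fock representation of the CCR algebra\<close>

text \<open>The Boolean argument selects the operator or its formal adjoint.\<close>

primrec interp :: "3 star_expr \<Rightarrow> bool \<Rightarrow> (occ \<Rightarrow> complex) \<Rightarrow> occ \<Rightarrow> complex" where
  "interp (Gen j) b f = (if b then an j f else cr j f)"
| "interp (Const c) b f = (\<lambda>n. (if b then cnj c else c) * f n)"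
| "interp (s \<oplus> t) b f = (\<lambda>n. interp s b f n + interp t b f n)"
| "interp (s \<odot> t) b f = (if b then interp t b (interp s b f) else interp s b (interp t b f))"
| "interp (s\<^sup>\<star>) b f = interp s (\<not> b) f"

lemma interp_rapid: "rapid f \<Longrightarrow> rapid (interp t b f)"
  by (induction t arbitrary: b f) (auto simp: rapid_an rapid_cr rapid_add rapid_scale)

lemma interp_linear:
  "interp t b (\<lambda>n. f n + g n) = (\<lambda>n. interp t b f n + interp t b g n)"
  "interp t b (\<lambda>n. c * f n) = (\<lambda>n. c * interp t b f n)"
  by (induction t arbitrary: b f g) (auto simp: an_linear cr_linear algebra_simps)

lemma interp_linear':
  "interp t b (\<lambda>n. 0) = (\<lambda>n. 0)" "interp t b (\<lambda>n. f n * c) = (\<lambda>n. c * interp t b f n)"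
  using interp_linear(2)[of t b 0] interp_linear(2)[of t b c f] by (simp_all add: mult.commute)

lemma ell2_of_add: "rapid f \<Longrightarrow> rapid g \<Longrightarrow> ell2_of (\<lambda>n. f n + g n) = ell2_of f + ell2_of g"
  by (intro ell2_eqI) (simp add: plus_ell2.rep_eq rapid_add)

lemma ell2_of_scale: "rapid f \<Longrightarrow> ell2_of (\<lambda>n. c * f n) = c *\<^sub>C ell2_of f"
  by (intro ell2_eqI) (simp add: scaleC_ell2.rep_eq rapid_scale)

lemma interp_adjoint:
  "rapid f \<Longrightarrow> rapid g \<Longrightarrow> cinner (ell2_of (interp t b f)) (ell2_of g) = cinner (ell2_of f) (ell2_of (interp t (\<not> b) g))"
proof (induction t arbitrary: b f g)
  case (Gen j)
  have "cinner (ell2_of (cr j f)) (ell2_of g) = cinner (ell2_of f) (ell2_of (an j g))"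
    using an_cr_adjoint[OF Gen(2,1), of j] by (metis cinner_commute)
  then show ?case using an_cr_adjoint[OF Gen, of j] by simp
qed (auto simp: ell2_of_scale ell2_of_add cinner_simps interp_rapid)

text \<open>Every rule of the congruence becomes an identity of operators. Both values of
  \<open>b\<close> are needed, since the rule for stars exchanges them. The substitution lets the
  same induction serve the CCR (with \<open>Gen\<close>) and the algebra mapped into it.\<close>

lemma interp_star_cong:
  assumes R: "\<And>s t b f. (s, t) \<in> R \<Longrightarrow> interp (star_subst \<phi> s) b f = interp (star_subst \<phi> t) b f"
    and "star_cong R s t"
  shows "interp (star_subst \<phi> s) b f = interp (star_subst \<phi> t) b f"
  using assms(2)
proof (induction arbitrary: b f)
qed (auto simp: R interp_linear interp_linear' algebra_simps)

definition fock_rep :: "3 star_expr \<Rightarrow> occ ell2 \<Rightarrow> occ ell2" where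
  "fock_rep t v = ell2_of (interp t False (ell2_coord v))"

lemma coord_fock_rep: "v \<in> rapidly_decreasing \<Longrightarrow> ell2_coord (fock_rep t v) = interp t False (ell2_coord v)"
  by (simp add: fock_rep_def rapidly_decreasing_iff interp_rapid)

lemma fock_rep_rapid: "v \<in> rapidly_decreasing \<Longrightarrow> fock_rep t v \<in> rapidly_decreasing"
  by (simp add: fock_rep_def rapidly_decreasing_iff interp_rapid)

text \<open>Density is a hypothesis here; it is derived below from the totality of the exponential
  vectors.\<close>

lemma fock_star_rep_subst:
  assumes R: "\<And>s t b f. (s, t) \<in> R \<Longrightarrow> interp (star_subst \<phi> s) b f = interp (star_subst \<phi> t) b f"
    and dense: "closure rapidly_decreasing = UNIV"
  shows "star_rep R rapidly_decreasing (\<lambda>t. fock_rep (star_subst \<phi> t))"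
proof -
  have "cinner (fock_rep (star_subst \<phi> t) u) v = cinner u (fock_rep (star_subst \<phi> (t\<^sup>\<star>)) v)"
    if "u \<in> rapidly_decreasing" "v \<in> rapidly_decreasing" for t u v
    using interp_adjoint[of "ell2_coord u" "ell2_coord v" "star_subst \<phi> t" False] that
    by (simp add: fock_rep_def rapidly_decreasing_iff)
  then show ?thesis
    unfolding star_rep_def using dense csubspace_rapidly_decreasing
    by (auto simp: clinear_on_def fock_rep_rapid coord_fock_rep interp_star_cong[OF R] plus_ell2.rep_eq
        scaleC_ell2.rep_eq interp_linear csubspace_add[OF csubspace_rapidly_decreasing]
        csubspace_scaleC[OF csubspace_rapidly_decreasing] intro!: ell2_eqI)
qed

lemma ccr_relation_interp: "(s, t) \<in> ccr_rels \<Longrightarrow> interp s b f = interp t b f"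
  by (auto simp: ccr_rels_def an_cr_same an_cr_other cr_commute an_commute an_minus cr_minus fun_eq_iff)

lemma star_subst_Gen: "star_subst Gen t = t"
  by (induction t) auto

lemma fock_star_rep:
  assumes "closure rapidly_decreasing = UNIV"
  shows "star_rep ccr_rels rapidly_decreasing fock_rep"
  using fock_star_rep_subst[of ccr_rels Gen, OF _ assms]
  by (simp add: star_subst_Gen ccr_relation_interp)

section \<open>Exponential vectors and the Weyl operators\<close>

lemma has_sum_times:
  fixes f :: "'a \<Rightarrow> complex" and g :: "'b \<Rightarrow> complex"
  assumes f: "(f has_sum a) UNIV" and g: "(g has_sum b) UNIV"
  shows "((\<lambda>(x, y). f x * g y) has_sum a * b) UNIV"
proof -
  have fs: "(\<lambda>x. norm (f x)) summable_on UNIV" and gs: "(\<lambda>x. norm (g x)) summable_on UNIV"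
    using f g by (auto simp: summable_on_iff_abs_summable_on_complex[symmetric] summable_on_def)
  have "(\<lambda>p. norm (case p of (x, y) \<Rightarrow> f x * g y)) summable_on (UNIV \<times> UNIV)"
  proof (rule Infinite_Sum.abs_summable_on_Sigma_iff[THEN iffD2], intro conjI ballI)
    show "(\<lambda>y. norm (case (x, y) of (x, y) \<Rightarrow> f x * g y)) summable_on UNIV" for x
      using summable_on_cmult_right[OF gs] by (simp add: norm_mult)
    show "(\<lambda>x. norm (\<Sum>\<^sub>\<infinity>y. norm (case (x, y) of (x, y) \<Rightarrow> f x * g y))) summable_on UNIV"
      using summable_on_cmult_left[OF fs] by (simp add: norm_mult infsum_cmult_right' abs_mult infsum_nonneg)
  qed
  then have s: "(\<lambda>(x, y). f x * g y) summable_on (UNIV \<times> UNIV)" by (rule abs_summable_summable)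
  have "((\<lambda>(x, y). f x * g y) has_sum a * b) (UNIV \<times> UNIV)"
  proof (rule has_sum_SigmaI[where g="\<lambda>x. f x * b"])
    show "((\<lambda>y. case (x, y) of (x, y) \<Rightarrow> f x * g y) has_sum f x * b) UNIV" for x
      using has_sum_cmult_right[OF g] by simp
    show "((\<lambda>x. f x * b) has_sum a * b) UNIV" using has_sum_cmult_left[OF f] .
  qed (rule s)
  then show ?thesis by simp
qed

lemma powser_sums_zero_imp_zero:
  fixes a :: "nat \<Rightarrow> complex"
  assumes "\<And>w. (\<lambda>n. a n * w ^ n) sums 0"
  shows "a n = 0"
proof -
  \<comment> \<open>Convergence at 1 gives a positive radius, which suffices for the identity
    theorem.\<close>
  have "summable (\<lambda>n. a n * 1 ^ n)" using assms sums_summable by blast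
  from conv_radius_geI[OF this] have "conv_radius a \<ge> 1" by (simp add: one_ereal_def)
  then have r: "fps_conv_radius (Abs_fps a) > 0"
    by (simp add: fps_conv_radius_def less_le_trans[OF _ \<open>conv_radius a \<ge> 1\<close>])
  have "Abs_fps a = 0"
  proof (rule eval_fps_eqD[OF r])
    show "\<forall>\<^sub>F z in nhds 0. eval_fps (Abs_fps a) z = eval_fps 0 z"
      using assms by (intro always_eventually) (auto simp: eval_fps_def sums_iff)
  qed simp
  then show ?thesis by (metis fps_nth_Abs_fps fps_zero_nth)
qed

text \<open>Summing over \<open>x\<close> first leaves a power series in \<open>w\<close> that
  vanishes identically. Repeated use removes the variables of a multiple power series one by
  one.\<close>

lemma power_sum_separate:
  fixes h :: "nat \<times> 'b \<Rightarrow> complex"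
  assumes "\<And>w. ((\<lambda>(k, x). h (k, x) * w ^ k) has_sum 0) UNIV"
  shows "((\<lambda>x. h (k, x)) has_sum 0) UNIV"
proof -
  have "(\<lambda>(k, x). h (k, x)) summable_on (UNIV \<times> UNIV)"
    using assms[of 1] by (auto simp: summable_on_def)
  then have s: "(\<lambda>x. h (k, x)) summable_on UNIV" for k
    using summable_on_SigmaD1[of "\<lambda>k x. h (k, x)" UNIV "\<lambda>_. UNIV" k] by simp
  define a where "a k = (\<Sum>\<^sub>\<infinity>x. h (k, x))" for k
  have a: "((\<lambda>x. h (k, x)) has_sum a k) UNIV" for k
    unfolding a_def using s by (rule has_sum_infsum)
  have "(\<lambda>k. a k * w ^ k) sums 0" for w
  proof -
    have "((\<lambda>k. a k * w ^ k) has_sum 0) UNIV"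
    proof (rule has_sum_SigmaD)
      show "((\<lambda>(k, x). h (k, x) * w ^ k) has_sum 0) (UNIV \<times> UNIV)" using assms[of w] by simp
      show "((\<lambda>x. case (k, x) of (k, x) \<Rightarrow> h (k, x) * w ^ k) has_sum a k * w ^ k) UNIV" for k
        using has_sum_cmult_left[OF a[of k], of "w ^ k"] by simp
    qed
    then show ?thesis by (rule has_sum_imp_sums)
  qed
  then have "a k = 0" for k by (rule powser_sums_zero_imp_zero)
  then show ?thesis using a[of k] by simp
qed

section \<open>Exponential vectors\<close>

definition hdot :: "complex ^ 3 \<Rightarrow> complex ^ 3 \<Rightarrow> complex" where
  "hdot w z = (\<Sum>j\<in>UNIV. w $ j * cnj (z $ j))"

lemma hdot_simps:
  "hdot (w + w') z = hdot w z + hdot w' z" "hdot w (z + z') = hdot w z + hdot w z'"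
  "hdot (r *\<^sub>R w) z = complex_of_real r * hdot w z" "hdot w (r *\<^sub>R z) = complex_of_real r * hdot w z"
  "hdot (- w) z = - hdot w z" "hdot w (- z) = - hdot w z" "hdot 0 z = 0" "hdot w 0 = 0"
  by (auto simp: hdot_def sum_3 algebra_simps scaleR_conv_of_real[where 'a=complex])

lemma cnj_hdot: "cnj (hdot w z) = hdot z w"
  by (simp add: hdot_def sum_3 mult.commute)

lemma hdot_self: "hdot z z = complex_of_real ((norm z)\<^sup>2)"
  unfolding hdot_def power2_norm_eq_inner inner_vec_def complex_norm_square[symmetric] of_real_sum
  by (simp add: power2_norm_eq_inner[symmetric])

lemma hdot_continuous [continuous_intros]:
  "continuous_on S f \<Longrightarrow> continuous_on S g \<Longrightarrow> continuous_on S (\<lambda>x. hdot (f x) (g x))"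
  unfolding hdot_def by (intro continuous_intros)

text \<open>The coordinates of the unnormalised coherent state exp (x c) e_0 of one mode, with
  \<open>c\<close> the creation operator.\<close>

definition expc :: "complex \<Rightarrow> nat \<Rightarrow> complex" where
  "expc x k = x ^ k / complex_of_real (sqrt (fact k))"

lemma expc_has_sum: "((\<lambda>k. expc x k * cnj (expc y k)) has_sum exp (x * cnj y)) UNIV"
proof -
  have "expc x k * cnj (expc y k) = (x * cnj y) ^ k /\<^sub>R fact k" for k
    by (simp add: expc_def power_mult_distrib scaleR_conv_of_real field_simps flip: of_real_mult)
  then show ?thesis
    using norm_summable_imp_has_sum[OF summable_norm_exp exp_converges, of "x * cnj y"] by simp
qed

lemma expc_Suc: "complex_of_real (sqrt (real k + 1)) * expc x (Suc k) = x * expc x k"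
proof -
  have "sqrt (fact (Suc k)) = sqrt (real k + 1) * sqrt (fact k)"
    by (simp add: real_sqrt_mult add.commute)
  moreover have "complex_of_real (sqrt (real k + 1)) \<noteq> 0" by (simp add: add_nonneg_eq_0_iff)
  ultimately show ?thesis by (simp add: expc_def)
qed

definition mon :: "complex ^ 3 \<Rightarrow> occ \<Rightarrow> complex" where
  "mon w n = (case n of (k, l, m) \<Rightarrow> expc (w $ 1) k * (expc (w $ 2) l * expc (w $ 3) m))"

lemma mon_has_sum: "((\<lambda>n. mon w n * cnj (mon z n)) has_sum exp (hdot w z)) UNIV"
proof -
  have "((\<lambda>(k, l, m). (expc (w $ 1) k * cnj (expc (z $ 1) k)) * ((expc (w $ 2) l * cnj (expc (z $ 2) l)) *
      (expc (w $ 3) m * cnj (expc (z $ 3) m)))) has_sum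
      exp (w $ 1 * cnj (z $ 1)) * (exp (w $ 2 * cnj (z $ 2)) * exp (w $ 3 * cnj (z $ 3)))) UNIV"
    using has_sum_times[OF expc_has_sum has_sum_times[OF expc_has_sum expc_has_sum]]
    by (simp add: case_prod_unfold)
  moreover have "exp (w $ 1 * cnj (z $ 1)) * (exp (w $ 2 * cnj (z $ 2)) * exp (w $ 3 * cnj (z $ 3))) = exp (hdot w z)"
    by (simp add: hdot_def sum_3 exp_add)
  moreover have "(\<lambda>(k, l, m). (expc (w $ 1) k * cnj (expc (z $ 1) k)) * ((expc (w $ 2) l * cnj (expc (z $ 2) l)) *
      (expc (w $ 3) m * cnj (expc (z $ 3) m)))) = (\<lambda>n. mon w n * cnj (mon z n))"
    by (auto simp: mon_def)
  ultimately show ?thesis by simp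
qed

lemma mon_sq_summable: "sq_summable (mon w)"
proof -
  have "(\<lambda>n. complex_of_real ((cmod (mon w n))\<^sup>2)) summable_on UNIV"
    using mon_has_sum[of w w] by (auto simp: summable_on_def simp flip: complex_norm_square)
  then show ?thesis
    unfolding sq_summable_def using summable_on_Re by fastforce
qed

text \<open>The weight is at most 2 to the total occupation, so its \<open>N\<close>-th power is
  absorbed by scaling \<open>w\<close> with \<open>2 ^ N\<close>; the coordinates of the scaled
  vector are bounded by its norm.\<close>

lemma mon_rapid: "rapid (mon w)"
  unfolding rapid_def
proof
  fix N
  have "wt n ^ N * cmod (mon w n) \<le> norm (ell2_of (mon ((2 ^ N) *\<^sub>R w)))" for n
  proof (cases n)
    case n: (fields k l m)
    have "real (k + l + m) + 1 \<le> 2 ^ (k + l + m)"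
      using less_exp[of "k + l + m"] by (metis Suc_leI of_nat_Suc of_nat_le_iff of_nat_numeral of_nat_power add.commute)
    then have "wt n ^ N \<le> (2 ^ (k + l + m)) ^ N"
      using wt_ge_1[of n] by (intro power_mono) (auto simp: n wt_def)
    then have "wt n ^ N * cmod (mon w n) \<le> (2 ^ (k + l + m)) ^ N * cmod (mon w n)"
      by (intro mult_right_mono) auto
    also have "\<dots> = cmod (mon ((2 ^ N) *\<^sub>R w) n)"
    proof -
      have e: "expc ((2 ^ N) *\<^sub>R x) k = (2 ^ k) ^ N * expc x k" for x k
        by (simp add: expc_def scaleR_conv_of_real power_mult_distrib) (simp add: mult.commute flip: power_mult)
      show ?thesis by (simp add: n mon_def e norm_mult norm_power power_add power_mult_distrib)
    qed
    also have "\<dots> \<le> norm (ell2_of (mon ((2 ^ N) *\<^sub>R w)))"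
      using ell2_coord_le[of "ell2_of (mon ((2 ^ N) *\<^sub>R w))" n] by (simp add: coord_ell2_of mon_sq_summable)
    finally show ?thesis .
  qed
  then show "\<exists>C. \<forall>n. wt n ^ N * cmod (mon w n) \<le> C" by blast
qed

definition expv :: "complex ^ 3 \<Rightarrow> occ ell2" where "expv w = ell2_of (mon w)"

lemma coord_expv [simp]: "ell2_coord (expv w) = mon w"
  by (simp add: expv_def mon_rapid)

lemma expv_rapid: "expv w \<in> rapidly_decreasing"
  by (simp add: expv_def mon_rapid)

lemma cinner_expv: "cinner (expv w) (expv z) = exp (hdot w z)"
  using has_sum_unique[OF cinner_has_sum[of "expv w" "expv z"]] mon_has_sum[of w z] by simp

lemma an_mon: "an j (mon w) = (\<lambda>n. w $ j * mon w n)"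
proof (rule ext)
  fix n
  show "an j (mon w) n = w $ j * mon w n"
    by (cases n; cases j rule: cases_3) (auto simp: an_def mon_def cnt_def inc_def mult_ac expc_Suc expc_Suc[unfolded mult.commute[of "complex_of_real _"]])
qed

text \<open>A vector orthogonal to all exponential vectors yields a power series in the three
  parameters that vanishes identically, and its coefficients determine the vector.\<close>

lemma expv_total: "closure (lin_span expv) = UNIV"
proof (rule ortho_compl_trivial_imp_UNIV[OF csubspace_closure[OF csubspace_lin_span]])
  have "f = 0" if f: "f \<in> ortho_compl (closure (lin_span expv))" for f
  proof (rule ell2_eqI)
    fix n :: occ
    \<comment> \<open>The square roots of factorials are absorbed so that plain monomials
      remain.\<close>
    define F where "F = (\<lambda>(k, l, m). cnj (ell2_coord f (k, l, m)) /
      complex_of_real (sqrt (fact k) * sqrt (fact l) * sqrt (fact m)))"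
    have "cinner (expv w) f = 0" for w
      using f lin_span_base[of expv w] closure_subset by (auto simp: ortho_compl_def)
    then have sum0: "((\<lambda>n. mon w n * cnj (ell2_coord f n)) has_sum 0) UNIV" for w
      using cinner_has_sum[of "expv w" f] by simp
    have 1: "((\<lambda>(k, l, m). F (k, l, m) * x ^ l * y ^ m * w ^ k) has_sum 0) UNIV" for w x y
    proof -
      have "(\<lambda>n. mon (vector [w, x, y]) n * cnj (ell2_coord f n)) = (\<lambda>(k, l, m). F (k, l, m) * x ^ l * y ^ m * w ^ k)"
        by (auto simp: mon_def F_def expc_def fun_eq_iff vector_3 mult_ac)
      then show ?thesis using sum0[of "vector [w, x, y]"] by simp
    qed
    have 2: "((\<lambda>(l, m). F (k, l, m) * y ^ m * x ^ l) has_sum 0) UNIV" for k x y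
      using power_sum_separate[of "\<lambda>(k, l, m). F (k, l, m) * x ^ l * y ^ m" k] 1
      by (simp add: case_prod_unfold mult_ac)
    have 3: "((\<lambda>m. F (k, l, m) * y ^ m) has_sum 0) UNIV" for k l y
      using power_sum_separate[of "\<lambda>(l, m). F (k, l, m) * y ^ m" l] 2
      by (simp add: case_prod_unfold)
    have "F (k, l, m) = 0" for k l m
      using powser_sums_zero_imp_zero[of "\<lambda>m. F (k, l, m)"] has_sum_imp_sums[OF 3] by blast
    then have "F n = 0" by (cases n) auto
    then show "ell2_coord f n = ell2_coord 0 n"
      by (cases n) (auto simp: F_def zero_ell2.rep_eq)
  qed
  then show "ortho_compl (closure (lin_span expv)) = {0}"
    using csubspace_zero[OF csubspace_ortho_compl] by blast
qed simp

lemma rapidly_decreasing_dense: "closure rapidly_decreasing = UNIV"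
proof -
  have "lin_span expv \<subseteq> rapidly_decreasing"
    by (rule lin_span_le[OF csubspace_rapidly_decreasing expv_rapid])
  then show ?thesis using closure_mono expv_total by blast
qed

lemmas fock_rep_star_rep = fock_star_rep[OF rapidly_decreasing_dense]

section \<open>The Weyl operators\<close>

text \<open>
  The parameter \<open>z\<close> for which the Lie algebra element \<open>(p, q, t)\<close> acts as
  \<open>\<Sum>j. z\<^sub>j c\<^sub>j - cnj z\<^sub>j c\<^sub>j\<^sup>* + \<i> t\<close>.
\<close>

definition zvec :: "3 heis \<Rightarrow> complex ^ 3" where
  "zvec g = (case g of (p, q, t) \<Rightarrow> \<chi> j. Complex (- (p $ j) / sqrt 2) (q $ j / sqrt 2))"

lemma zvec_simps: "zvec (g + h) = zvec g + zvec h" "zvec (r *\<^sub>R g) = r *\<^sub>R zvec g" "zvec (- g) = - zvec g"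
  "zvec (heis_mult g h) = zvec g + zvec h" "zvec (0, 0, t) = 0" "zvec 0 = 0"
  by (auto simp: zvec_def heis_mult_def vec_eq_iff complex_eq_iff field_simps case_prod_beta)

lemma zvec_surj: "\<exists>p q. zvec (p, q, 0) = z"
  by (intro exI[of _ "\<chi> j. - sqrt 2 * Re (z $ j)"] exI[of _ "\<chi> j. sqrt 2 * Im (z $ j)"])
    (auto simp: zvec_def vec_eq_iff complex_eq_iff)

lemma hdot_commutator:
  "hdot (zvec (p, q, t)) (zvec (p', q', t')) - hdot (zvec (p', q', t')) (zvec (p, q, t)) =
    \<i> * complex_of_real (p \<bullet> q' - q \<bullet> p')"
  by (simp add: hdot_def zvec_def inner_vec_def sum_3 complex_eq_iff)

lemma zvec_continuous [continuous_intros]: "continuous_on S f \<Longrightarrow> continuous_on S (\<lambda>x. zvec (f x))"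
proof -
  have "linear zvec" by (rule linearI) (simp_all add: zvec_simps)
  then have "bounded_linear zvec" by (rule linear_conv_bounded_linear[THEN iffD1])
  then show "continuous_on S f \<Longrightarrow> continuous_on S (\<lambda>x. zvec (f x))"
    by (rule bounded_linear.continuous_on)
qed

definition coef :: "3 heis \<Rightarrow> complex ^ 3 \<Rightarrow> complex" where
  "coef g w = exp (\<i> * complex_of_real (snd (snd g)) - hdot (zvec g) (zvec g) / 2 - hdot w (zvec g))"

text \<open>A cocycle identity: the antisymmetric part of \<open>hdot\<close> on group parameters is
  exactly the commutator term in the central coordinate.\<close>

lemma coef_mult: "coef (heis_mult g h) w = coef h w * coef g (w + zvec h)"
proof (cases g, cases h)
  fix p q t p' q' t' assume gh: "g = (p, q, t)" "h = (p', q', t')"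
  have t: "snd (snd (heis_mult g h)) = t + t' + (p \<bullet> q' - q \<bullet> p') / 2" by (simp add: gh heis_mult_def)
  define W where "W = p \<bullet> q' - q \<bullet> p'"
  have c: "hdot (zvec g) (zvec h) - hdot (zvec h) (zvec g) = \<i> * complex_of_real W"
    using hdot_commutator[of p q t p' q' t'] by (simp add: gh W_def)
  have ph: "\<i> * complex_of_real (t + t' + (p \<bullet> q' - q \<bullet> p') / 2) =
      \<i> * complex_of_real t + \<i> * complex_of_real t' + (hdot (zvec g) (zvec h) - hdot (zvec h) (zvec g)) / 2"
    unfolding c W_def[symmetric] by (simp add: algebra_simps)
  have "snd (snd g) = t" "snd (snd h) = t'" by (simp_all add: gh)
  then show ?thesis
    unfolding coef_def t ph exp_add[symmetric] zvec_simps hdot_simps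
    by (intro arg_cong[of _ _ exp]) (simp add: diff_divide_distrib add_divide_distrib)
qed

lemma coef_gram:
  "cinner (coef g w *\<^sub>C expv (w + zvec g)) (coef g z *\<^sub>C expv (z + zvec g)) = cinner (expv w) (expv z)"
  unfolding cinner_simps cinner_expv coef_def exp_cnj exp_add[symmetric] mult.assoc[symmetric] hdot_simps
  by (intro arg_cong[of _ _ exp]) (simp add: cnj_hdot field_simps)

lemma weyl_op_exists: "\<exists>T. unitary T \<and> (\<forall>w. T (expv w) = coef g w *\<^sub>C expv (w + zvec g))"
proof -
  let ?v = "\<lambda>w. coef g w *\<^sub>C expv (w + zvec g)"
  \<comment> \<open>Translation of the parameter is bijective and \<open>coef\<close> never
    vanishes, so the image family has the same span.\<close>
  have "expv w \<in> lin_span ?v" for w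
    using csubspace_scaleC[OF csubspace_lin_span lin_span_base[of ?v "w - zvec g"], of "1 / coef g (w - zvec g)"]
    by (simp add: scaleC_scaleC coef_def)
  then have "lin_span expv \<subseteq> lin_span ?v" by (intro lin_span_le[OF csubspace_lin_span])
  then have total: "closure (lin_span ?v) = UNIV" using closure_mono expv_total by blast
  show ?thesis by (rule gram_unitary[OF coef_gram[symmetric] expv_total total]) blast
qed

definition weyl_op :: "3 heis \<Rightarrow> occ ell2 \<Rightarrow> occ ell2" where
  "weyl_op g = (SOME T. unitary T \<and> (\<forall>w. T (expv w) = coef g w *\<^sub>C expv (w + zvec g)))"

lemma weyl_op_unitary: "unitary (weyl_op g)"
  and weyl_op_expv: "weyl_op g (expv w) = coef g w *\<^sub>C expv (w + zvec g)"
  using someI_ex[OF weyl_op_exists[of g]] by (auto simp: weyl_op_def)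

text \<open>The Gram matrix gives the squared distance as a continuous expression that vanishes at
  the base point.\<close>

lemma expv_continuous: "continuous_on UNIV expv"
  unfolding continuous_on_eq_continuous_at[OF open_UNIV] isCont_def
proof
  fix a
  let ?d = "\<lambda>w. Re (exp (hdot w w) - exp (hdot w a) - exp (hdot a w) + exp (hdot a a))"
  have d: "(norm (expv w - expv a))\<^sup>2 = ?d w" for w
  proof -
    have "(norm (expv w - expv a))\<^sup>2 = Re (cinner (expv w - expv a) (expv w - expv a))"
      by (simp add: cinner_self)
    then show ?thesis by (simp add: cinner_simps cinner_expv)
  qed
  have n: "norm (expv w - expv a) = sqrt (?d w)" for w
    by (simp only: d[symmetric] real_sqrt_abs abs_norm_cancel)
  have "continuous_on UNIV (\<lambda>w. sqrt (?d w))" by (intro continuous_intros)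
  then have "isCont (\<lambda>w. sqrt (?d w)) a" by (simp add: continuous_on_eq_continuous_at)
  then have "((\<lambda>w. sqrt (?d w)) \<longlongrightarrow> sqrt (?d a)) (at a)" by (simp only: isCont_def)
  then have "((\<lambda>w. norm (expv w - expv a)) \<longlongrightarrow> 0) (at a)"
    unfolding n by simp
  then show "(expv \<longlongrightarrow> expv a) (at a)" by (subst tendsto_dist_iff) (simp add: dist_norm)
qed

lemma coef_continuous [continuous_intros]:
  "continuous_on S f \<Longrightarrow> continuous_on S (\<lambda>x. coef (f x) w)"
  unfolding coef_def by (intro continuous_intros) auto

text \<open>The vectors with continuous orbit form a closed subspace: as the operators are
  isometric, approximation of a vector is uniform along its orbit.\<close>

lemma weyl_op_continuous: "continuous_on UNIV (\<lambda>g. weyl_op g v)"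
proof -
  let ?C = "{v. continuous_on UNIV (\<lambda>g. weyl_op g v)}"
  have E: "expv w \<in> ?C" for w
    unfolding mem_Collect_eq weyl_op_expv
    by (intro continuous_intros continuous_on_compose2[OF expv_continuous]) auto
  have "csubspace ?C"
    using linear_0[OF bounded_linear.linear[OF unitary_bounded_linear[OF weyl_op_unitary]]]
    by (auto simp: csubspace_def unitary_add[OF weyl_op_unitary] unitary_scaleC[OF weyl_op_unitary]
        intro!: continuous_intros)
  then have "lin_span expv \<subseteq> ?C" using E by (rule lin_span_le)
  moreover have "closed ?C"
    unfolding closed_sequential_limits
  proof (intro allI impI, elim conjE)
    fix X v assume X: "\<forall>n. X n \<in> ?C" "X \<longlonglongrightarrow> v"
    have "uniform_limit UNIV (\<lambda>n g. weyl_op g (X n)) (\<lambda>g. weyl_op g v) sequentially"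
      unfolding uniform_limit_iff
    proof (intro allI impI)
      fix e :: real assume "e > 0"
      then have "\<forall>\<^sub>F n in sequentially. dist (X n) v < e" using X(2) tendstoD by blast
      then show "\<forall>\<^sub>F n in sequentially. \<forall>g\<in>UNIV. dist (weyl_op g (X n)) (weyl_op g v) < e"
        by (simp add: dist_norm unitary_norm[OF weyl_op_unitary] flip: unitary_diff[OF weyl_op_unitary])
    qed
    moreover have "\<forall>\<^sub>F n in sequentially. continuous_on UNIV (\<lambda>g. weyl_op g (X n))"
      using X(1) by (intro always_eventually) simp
    ultimately show "v \<in> ?C"
      unfolding mem_Collect_eq by (intro uniform_limit_theorem[OF _ _ trivial_limit_sequentially])
  qed
  ultimately have "closure (lin_span expv) \<subseteq> ?C" by (rule closure_minimal)
  then show ?thesis using expv_total by blast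
qed

lemma weyl_op_heis_rep: "heis_rep weyl_op"
  unfolding heis_rep_def
proof (intro conjI allI)
  show "weyl_op (heis_mult g h) v = weyl_op g (weyl_op h v)" for g h v
    by (rule unitary_eq_on_total[OF weyl_op_unitary unitary_compose[OF weyl_op_unitary weyl_op_unitary] expv_total])
      (simp add: weyl_op_expv unitary_scaleC[OF weyl_op_unitary] scaleC_scaleC coef_mult zvec_simps add_ac)
qed (rule weyl_op_unitary weyl_op_continuous)+

section \<open>Smooth vectors on the Fock space\<close>

lemma quadratic_remainder_has_derivative:
  fixes f :: "'a::real_normed_vector \<Rightarrow> 'b::real_normed_vector"
  assumes "0 < e" and L: "bounded_linear L"
    and le: "\<And>y. norm (y - x) < e \<Longrightarrow> norm (f y - f x - L (y - x)) \<le> C * (norm (y - x))\<^sup>2"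
  shows "(f has_derivative L) (at x)"
proof (rule has_derivativeI_sandwich[OF \<open>0 < e\<close> L])
  show "norm ((f y - f x) - L (y - x)) / norm (y - x) \<le> C * norm (y - x)" if "y \<noteq> x" "dist y x < e" for y
    using le[of y] that by (simp add: dist_norm pos_divide_le_eq power2_eq_square mult.assoc)
  have "((\<lambda>y. C * norm (y - x)) \<longlongrightarrow> C * norm (x - x)) (at x)" by (intro tendsto_intros)
  then show "((\<lambda>y. C * norm (y - x)) \<longlongrightarrow> 0) (at x)" by simp
qed

lemma vector_derivative_bound_01:
  fixes \<phi> :: "real \<Rightarrow> 'b::real_normed_vector"
  assumes d: "\<And>s. (\<phi> has_vector_derivative \<phi>' s) (at s)" and le: "\<And>s. 0 \<le> s \<Longrightarrow> s \<le> 1 \<Longrightarrow> norm (\<phi>' s) \<le> B"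
  shows "norm (\<phi> 1 - \<phi> 0) \<le> B"
proof -
  have "norm (\<phi> 1 - \<phi> 0) \<le> B * norm (1 - 0 :: real)"
  proof (rule differentiable_bound[where S="{0..1}" and f'="\<lambda>s h. h *\<^sub>R \<phi>' s"])
    show "(\<phi> has_derivative (\<lambda>h. h *\<^sub>R \<phi>' s)) (at s within {0..1})" for s
      using d[of s] unfolding has_vector_derivative_def by (rule has_derivative_at_withinI)
    show "onorm (\<lambda>h. h *\<^sub>R \<phi>' s) \<le> B" if "s \<in> {0..1}" for s
    proof (rule onorm_bound)
      show "0 \<le> B" using order_trans[OF norm_ge_zero le[of s]] that by simp
      show "norm (h *\<^sub>R \<phi>' s) \<le> B * norm h" for h
        using mult_right_mono[OF le[of s], of "norm h"] that by (simp add: mult.commute)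
    qed
  qed auto
  then show ?thesis by simp
qed

text \<open>By continuity the bound extends to \<open>g = x\<close>. In this way derivatives known
  only weakly still give norm estimates.\<close>

lemma norm_le_of_dense:
  fixes x :: "'h::complex_inner"
  assumes dense: "closure G = UNIV" and "0 \<le> B" and le: "\<And>g. g \<in> G \<Longrightarrow> cmod (cinner x g) \<le> B * norm g"
  shows "norm x \<le> B"
proof -
  have "closed {g. cmod (cinner x g) \<le> B * norm g}"
    by (intro closed_Collect_le continuous_intros)
  then have "closure G \<subseteq> {g. cmod (cinner x g) \<le> B * norm g}" using le by (intro closure_minimal) auto
  then have "cmod (cinner x x) \<le> B * norm x" unfolding dense by blast
  then have "norm x * norm x \<le> B * norm x"
    unfolding cinner_self norm_of_real by (simp add: power2_eq_square)
  then show ?thesis using \<open>0 \<le> B\<close> by (cases "norm x = 0") auto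
qed

section \<open>The Lie algebra action on rapidly decreasing vectors\<close>

abbreviation act :: "3 heis \<Rightarrow> occ ell2 \<Rightarrow> occ ell2" where "act \<equiv> heis_lie_act fock_rep"

lemma heis_lie_act_eq:
  "heis_lie_act \<rho> X v = (\<Sum>j\<in>UNIV. (zvec X $ j) *\<^sub>C \<rho> (Gen j) v - cnj (zvec X $ j) *\<^sub>C \<rho> ((Gen j)\<^sup>\<star>) v)
    + (\<i> * complex_of_real (snd (snd X))) *\<^sub>C v"
proof (cases X)
  case (fields p q t)
  have eq: "complex_of_real (p $ j / sqrt 2) *\<^sub>C (a - c) + (\<i> * complex_of_real (q $ j / sqrt 2)) *\<^sub>C (a + c)
      = (zvec X $ j) *\<^sub>C c - cnj (zvec X $ j) *\<^sub>C a" for j a c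
  proof -
    have z: "zvec X $ j = - complex_of_real (p $ j / sqrt 2) + \<i> * complex_of_real (q $ j / sqrt 2)"
      by (simp add: fields zvec_def complex_eq_iff)
    show ?thesis unfolding z
      by (simp add: scaleC_add_right scaleC_diff_right scaleC_add_left scaleC_minus_left scaleC_diff_left)
  qed
  show ?thesis
    by (simp only: heis_lie_act_def fields prod.case snd_conv eq[unfolded fields])
qed

text \<open>The formal version of \<open>act\<close> for arbitrary coefficient families. It remains
  meaningful for a smooth vector whose rapid decrease is not yet established, where
  \<open>fock_rep\<close> may be unspecified.\<close>

definition actf :: "3 heis \<Rightarrow> (occ \<Rightarrow> complex) \<Rightarrow> occ \<Rightarrow> complex" where
  "actf X f n = (\<Sum>j\<in>UNIV. (zvec X $ j) * cr j f n - cnj (zvec X $ j) * an j f n) + (\<i> * complex_of_real (snd (snd X))) * f n"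

lemma coord_act: "f \<in> rapidly_decreasing \<Longrightarrow> ell2_coord (act X f) n = actf X (ell2_coord f) n"
  by (simp add: heis_lie_act_eq actf_def sum_3 plus_ell2.rep_eq minus_ell2.rep_eq scaleC_ell2.rep_eq coord_fock_rep)

lemma act_rapid: "f \<in> rapidly_decreasing \<Longrightarrow> act X f \<in> rapidly_decreasing"
  unfolding heis_lie_act_eq sum_3
  by (intro csubspace_add csubspace_diff csubspace_scaleC csubspace_rapidly_decreasing fock_rep_rapid)

lemma actf_linear:
  "actf X (\<lambda>n. f n + g n) n = actf X f n + actf X g n" "actf X (\<lambda>n. c * f n) n = c * actf X f n"
  "actf (X + Y) f n = actf X f n + actf Y f n" "actf (r *\<^sub>R X) f n = complex_of_real r * actf X f n"
  by (simp_all add: actf_def sum_3 zvec_simps cr_linear an_linear algebra_simps scaleR_conv_of_real[where 'a=complex])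

lemma act_linear_left: "act (X + Y) f = act X f + act Y f" "act (r *\<^sub>R X) f = r *\<^sub>R act X f"
  by (simp_all add: heis_lie_act_eq sum_3 zvec_simps scaleC_add_left scaleC_diff_left scaleR_scaleC scaleC_add_right
      scaleC_diff_right scaleC_scaleC scaleR_conv_of_real[where 'a=complex] mult_ac algebra_simps)

lemma act_add_right:
  "f \<in> rapidly_decreasing \<Longrightarrow> g \<in> rapidly_decreasing \<Longrightarrow> act X (f + g) = act X f + act X g"
  by (auto intro!: ell2_eqI simp: coord_act actf_linear plus_ell2.rep_eq csubspace_add[OF csubspace_rapidly_decreasing])

lemma act_scale_right:
  assumes "f \<in> rapidly_decreasing"
  shows "act X (c *\<^sub>C f) = c *\<^sub>C act X f" "act X (r *\<^sub>R f) = r *\<^sub>R act X f"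
  using assms
  by (auto intro!: ell2_eqI simp: coord_act actf_linear scaleC_ell2.rep_eq scaleR_scaleC
      csubspace_scaleC[OF csubspace_rapidly_decreasing])

lemma act_skew:
  assumes "f \<in> rapidly_decreasing" "g \<in> rapidly_decreasing"
  shows "cinner (act X f) g = cinner f (act (- X) g)"
proof -
  note rep = fock_rep_star_rep
  have "cinner (fock_rep (Gen j) f) g = cinner f (fock_rep ((Gen j)\<^sup>\<star>) g)"
    "cinner (fock_rep ((Gen j)\<^sup>\<star>) f) g = cinner f (fock_rep (Gen j) g)" for j
    using star_repD(9)[OF rep assms] star_rep_star(4)[OF rep assms(2)] by auto
  then show ?thesis
    unfolding heis_lie_act_eq by (simp add: sum_3 cinner_simps zvec_simps algebra_simps)
qed

section \<open>Derivatives along exponential vectors\<close>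

text \<open>
  The curve \<open>s \<mapsto> expv (s z)\<close> is differentiable at \<open>0\<close> because the squared remainder is
  \<open>exp (s\<^sup>2|z|\<^sup>2) - 1 - s\<^sup>2|z|\<^sup>2\<close>; the Weyl operators transport this to other base points.
\<close>

definition cre :: "complex ^ 3 \<Rightarrow> occ ell2 \<Rightarrow> occ ell2" where
  "cre z v = (\<Sum>j\<in>UNIV. (z $ j) *\<^sub>C fock_rep (Gen j) v)"

lemma fock_annihilation_expv: "fock_rep ((Gen j)\<^sup>\<star>) (expv w) = (w $ j) *\<^sub>C expv w"
  by (intro ell2_eqI) (simp add: coord_fock_rep expv_rapid an_mon scaleC_ell2.rep_eq)

lemma cinner_creation_left:
  assumes "f \<in> rapidly_decreasing" "g \<in> rapidly_decreasing"
  shows "cinner (fock_rep (Gen j) f) g = cinner f (fock_rep ((Gen j)\<^sup>\<star>) g)"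
  by (rule star_repD(9)[OF fock_rep_star_rep assms])

lemma cinner_creation_right:
  assumes "f \<in> rapidly_decreasing" "g \<in> rapidly_decreasing"
  shows "cinner f (fock_rep (Gen j) g) = cinner (fock_rep ((Gen j)\<^sup>\<star>) f) g"
  using cinner_creation_left[OF assms(2,1)] by (metis cinner_commute)

lemma annihilation_creation_vacuum:
  "fock_rep ((Gen i)\<^sup>\<star>) (fock_rep (Gen j) (expv 0)) = (if i = j then expv 0 else 0)"
proof (intro ell2_eqI)
  fix n
  have "an i (mon 0) = (\<lambda>n. 0)" for i by (simp add: an_mon)
  then show "ell2_coord (fock_rep ((Gen i)\<^sup>\<star>) (fock_rep (Gen j) (expv 0))) n = ell2_coord (if i = j then expv 0 else 0) n"
    by (simp add: coord_fock_rep fock_rep_rapid expv_rapid an_cr_same an_cr_other zero_ell2.rep_eq)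
      (simp add: cr_def)
qed

lemma cinner_cre_vacuum:
  "cinner (expv w) (cre z (expv 0)) = hdot w z" "cinner (cre z (expv 0)) (expv w) = hdot z w"
  "cinner (cre z (expv 0)) (cre z (expv 0)) = hdot z z"
proof -
  have z: "hdot w 0 = 0" "hdot 0 w = 0" for w by (simp_all add: hdot_simps)
  show "cinner (expv w) (cre z (expv 0)) = hdot w z"
    by (simp add: cre_def sum_3 cinner_simps cinner_creation_right expv_rapid fock_annihilation_expv cinner_expv z)
      (simp add: hdot_def sum_3 mult.commute)
  then show "cinner (cre z (expv 0)) (expv w) = hdot z w"
    by (metis cinner_commute cnj_hdot)
  show "cinner (cre z (expv 0)) (cre z (expv 0)) = hdot z z"
    by (simp add: cre_def sum_3 cinner_simps cinner_creation_right expv_rapid fock_rep_rapid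
        annihilation_creation_vacuum cinner_expv z) (simp add: hdot_def sum_3 mult.commute)
qed

lemma expv_remainder:
  "(norm (expv w - expv 0 - cre w (expv 0)))\<^sup>2 = exp ((norm w)\<^sup>2) - 1 - (norm w)\<^sup>2"
proof -
  have z: "hdot w 0 = 0" "hdot 0 w = 0" for w by (simp_all add: hdot_simps)
  have "(norm (expv w - expv 0 - cre w (expv 0)))\<^sup>2 =
      Re (cinner (expv w - expv 0 - cre w (expv 0)) (expv w - expv 0 - cre w (expv 0)))"
    by (simp add: cinner_self)
  also have "cinner (expv w - expv 0 - cre w (expv 0)) (expv w - expv 0 - cre w (expv 0)) = exp (hdot w w) - 1 - hdot w w"
    by (simp add: cinner_simps cinner_cre_vacuum cinner_expv z)
  also have "Re \<dots> = exp ((norm w)\<^sup>2) - 1 - (norm w)\<^sup>2"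
    unfolding hdot_self exp_of_real
    by (simp only: minus_complex.sel one_complex.sel Re_complex_of_real)
  finally show ?thesis .
qed

lemma expv_deriv_vacuum: "((\<lambda>s. expv (s *\<^sub>R z)) has_vector_derivative cre z (expv 0)) (at 0)"
  unfolding has_vector_derivative_def
proof (rule quadratic_remainder_has_derivative[where C="(norm z)\<^sup>2" and e="1 / (1 + norm z)"])
  show "bounded_linear (\<lambda>s. s *\<^sub>R cre z (expv 0))" by (rule bounded_linear_scaleR_left)
  \<comment> \<open>Within this radius |s| |z| \<le> 1, the range in which exp x \<le> 1 + x + x^2
    is applied.\<close>
  show "0 < 1 / (1 + norm z)" by (simp add: add_pos_nonneg)
  fix s :: real assume "norm (s - 0) < 1 / (1 + norm z)"
  then have "\<bar>s\<bar> * (1 + norm z) < 1" by (simp add: pos_less_divide_eq add_pos_nonneg)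
  then have "\<bar>s\<bar> * norm z \<le> 1" by (simp add: distrib_left)
  then have x: "(norm (s *\<^sub>R z))\<^sup>2 \<le> 1" by (simp add: abs_square_le_1)
  have "cre (s *\<^sub>R z) (expv 0) = s *\<^sub>R cre z (expv 0)"
    by (simp add: cre_def sum_3 scaleR_scaleC scaleC_add_right scaleC_scaleC scaleR_conv_of_real[where 'a=complex])
  then have "(norm (expv (s *\<^sub>R z) - expv (0 *\<^sub>R z) - (s - 0) *\<^sub>R cre z (expv 0)))\<^sup>2
      = exp ((norm (s *\<^sub>R z))\<^sup>2) - 1 - (norm (s *\<^sub>R z))\<^sup>2"
    using expv_remainder[of "s *\<^sub>R z"] by simp
  also have "\<dots> \<le> ((norm (s *\<^sub>R z))\<^sup>2)\<^sup>2" using exp_bound[OF _ x] by simp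
  finally have "norm (expv (s *\<^sub>R z) - expv (0 *\<^sub>R z) - (s - 0) *\<^sub>R cre z (expv 0)) \<le> (norm (s *\<^sub>R z))\<^sup>2"
    by (rule power2_le_imp_le) simp
  then show "norm (expv (s *\<^sub>R z) - expv (0 *\<^sub>R z) - (s - 0) *\<^sub>R cre z (expv 0)) \<le> (norm z)\<^sup>2 * (norm (s - 0))\<^sup>2"
    by (simp add: power_mult_distrib mult.commute)
qed

lemma expc_deriv:
  "((\<lambda>s::real. expc (a + complex_of_real s * b) k) has_vector_derivative
     b * (complex_of_real (sqrt (real k)) * expc a (k - 1))) (at 0)"
proof -
  have 1: "((\<lambda>s::real. a + complex_of_real s * b) has_vector_derivative b) (at 0)"
    by (auto intro!: derivative_eq_intros)
  have "((\<lambda>x. expc x k) has_field_derivative (of_nat k * a ^ (k - 1)) / complex_of_real (sqrt (fact k))) (at (a + complex_of_real 0 * b))"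
    unfolding expc_def by (auto intro!: derivative_eq_intros)
  from field_vector_diff_chain_at[OF 1 this]
  have d: "((\<lambda>s::real. expc (a + complex_of_real s * b) k) has_vector_derivative
      b * ((of_nat k * a ^ (k - 1)) / complex_of_real (sqrt (fact k)))) (at 0)" by (simp add: comp_def)
  have e: "(of_nat k * a ^ (k - 1)) / complex_of_real (sqrt (fact k)) = complex_of_real (sqrt (real k)) * expc a (k - 1)"
  proof (cases k)
    case (Suc m)
    have "sqrt (fact (Suc m)) = sqrt (real (Suc m)) * sqrt (fact m)" by (simp add: real_sqrt_mult)
    moreover have "complex_of_nat (Suc m) = complex_of_real (sqrt (real (Suc m))) * complex_of_real (sqrt (real (Suc m)))"
      by (simp del: of_nat_Suc flip: of_real_mult)
    ultimately show ?thesis by (simp add: Suc expc_def del: of_nat_Suc)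
  qed simp
  show ?thesis using d unfolding e .
qed

lemma mon_deriv:
  "((\<lambda>s. mon (w + s *\<^sub>R z) n) has_vector_derivative (\<Sum>j\<in>UNIV. (z $ j) * cr j (mon w) n)) (at 0)"
proof (cases n)
  case n: (fields k l m)
  let ?d = "\<lambda>j k. (z $ j) * (complex_of_real (sqrt (real k)) * expc (w $ j) (k - 1))"
  have e: "((\<lambda>s::real. expc (w $ j + s *\<^sub>R z $ j) k) has_vector_derivative ?d j k) (at 0)" for j k
    using expc_deriv[of "w $ j" "z $ j" k] by (simp add: scaleR_conv_of_real)
  have "((\<lambda>s. expc (w $ 1 + s *\<^sub>R z $ 1) k * (expc (w $ 2 + s *\<^sub>R z $ 2) l * expc (w $ 3 + s *\<^sub>R z $ 3) m)) has_vector_derivative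
     expc (w $ 1 + 0 *\<^sub>R z $ 1) k * (expc (w $ 2 + 0 *\<^sub>R z $ 2) l * ?d 3 m + ?d 2 l * expc (w $ 3 + 0 *\<^sub>R z $ 3) m)
     + ?d 1 k * (expc (w $ 2 + 0 *\<^sub>R z $ 2) l * expc (w $ 3 + 0 *\<^sub>R z $ 3) m)) (at 0)"
    by (intro has_vector_derivative_mult e)
  then show ?thesis
    by (simp add: n mon_def sum_3 cr_def cnt_def dec_def algebra_simps)
qed

lemma bounded_linear_coord: "bounded_linear (\<lambda>f. ell2_coord f n)"
  by (rule bounded_linear_intro[where K=1])
    (auto simp: plus_ell2.rep_eq scaleR_ell2.rep_eq scaleR_conv_of_real ell2_coord_le)

lemma has_vector_derivative_scaleC:
  assumes "(c has_vector_derivative c') (at s)" "(f has_vector_derivative f') (at s)"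
  shows "((\<lambda>s. c s *\<^sub>C f s) has_vector_derivative c s *\<^sub>C f' + c' *\<^sub>C f s) (at s)"
  using bounded_bilinear.has_vector_derivative[OF bounded_bilinear_scaleC assms] .

lemma exp_vector_derivative:
  "((\<lambda>s::real. exp (a * complex_of_real s + b * complex_of_real s ^ 2 + c)) has_vector_derivative a * exp c) (at 0)"
proof -
  have "(complex_of_real has_vector_derivative 1) (at 0)"
    by (auto intro!: derivative_eq_intros)
  moreover have "((\<lambda>z. exp (a * z + b * z ^ 2 + c)) has_field_derivative a * exp c) (at (complex_of_real 0))"
    by (auto intro!: derivative_eq_intros)
  ultimately have "((\<lambda>z. exp (a * z + b * z ^ 2 + c)) \<circ> complex_of_real has_vector_derivative 1 * (a * exp c)) (at 0)"
    by (rule field_vector_diff_chain_at)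
  then show ?thesis by (simp add: comp_def)
qed

lemma expv_deriv: "((\<lambda>s. expv (w + s *\<^sub>R z)) has_vector_derivative cre z (expv w)) (at 0)"
proof -
  obtain p q where pq: "zvec (p, q, 0) = w" using zvec_surj by blast
  \<comment> \<open>A group element that translates the vacuum parameter to \<open>w\<close>; the
    scalar \<open>c s\<close> below undoes the factor it introduces.\<close>
  define g :: "3 heis" where "g = (p, q, 0)"
  have zg: "zvec g = w" "snd (snd g) = 0" using pq by (simp_all add: g_def)
  define c where "c s = exp (hdot z w * complex_of_real s + 0 * complex_of_real s ^ 2 + hdot w w / 2)" for s :: real
  have "weyl_op g (expv (s *\<^sub>R z)) = (1 / c s) *\<^sub>C expv (w + s *\<^sub>R z)" for s
  proof -
    have "coef g (s *\<^sub>R z) * c s = 1"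
      unfolding coef_def c_def exp_add[symmetric] by (simp add: zg hdot_simps mult.commute)
    then have "coef g (s *\<^sub>R z) = 1 / c s" by (rule eq_divide_imp[rotated]) (simp add: c_def)
    then show ?thesis by (simp add: weyl_op_expv zg add.commute)
  qed
  then have eq: "expv (w + s *\<^sub>R z) = c s *\<^sub>C weyl_op g (expv (s *\<^sub>R z))" for s
    by (simp add: scaleC_scaleC c_def)
  have "(c has_vector_derivative hdot z w * exp (hdot w w / 2)) (at 0)"
    unfolding c_def by (rule exp_vector_derivative)
  from has_vector_derivative_scaleC[OF this bounded_linear.has_vector_derivative[OF unitary_bounded_linear[OF weyl_op_unitary] expv_deriv_vacuum[of z]], of g]
  obtain L where L: "((\<lambda>s. expv (w + s *\<^sub>R z)) has_vector_derivative L) (at 0)" unfolding eq by blast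
  \<comment> \<open>The derivative exists in norm; its value is read off coordinatewise from the
    monomials.\<close>
  have "L = cre z (expv w)"
  proof (rule ell2_eqI)
    fix n
    have "((\<lambda>s. mon (w + s *\<^sub>R z) n) has_vector_derivative ell2_coord L n) (at 0)"
      using bounded_linear.has_vector_derivative[OF bounded_linear_coord L, of n] by simp
    from vector_derivative_unique_at[OF this mon_deriv]
    show "ell2_coord L n = ell2_coord (cre z (expv w)) n"
      by (simp add: cre_def sum_3 plus_ell2.rep_eq scaleC_ell2.rep_eq coord_fock_rep expv_rapid)
  qed
  with L show ?thesis by simp
qed

lemma weyl_op_deriv_expv: "((\<lambda>s. weyl_op (s *\<^sub>R X) (expv w)) has_vector_derivative act X (expv w)) (at 0)"
proof -
  let ?z = "zvec X" and ?t = "snd (snd X)"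
  define c where "c s = exp ((\<i> * complex_of_real ?t - hdot w ?z) * complex_of_real s
      + (- hdot ?z ?z / 2) * complex_of_real s ^ 2 + 0)" for s :: real
  have coef: "coef (s *\<^sub>R X) w = c s" for s
    unfolding coef_def c_def zvec_simps hdot_simps
    by (rule arg_cong[of _ _ exp]) (simp add: snd_scaleR power2_eq_square algebra_simps)
  have "(c has_vector_derivative (\<i> * complex_of_real ?t - hdot w ?z) * exp 0) (at 0)"
    unfolding c_def by (rule exp_vector_derivative)
  from has_vector_derivative_scaleC[OF this expv_deriv[of w ?z]]
  have "((\<lambda>s. weyl_op (s *\<^sub>R X) (expv w)) has_vector_derivative
      cre ?z (expv w) + (\<i> * complex_of_real ?t - hdot w ?z) *\<^sub>C expv w) (at 0)"
    by (simp add: weyl_op_expv coef zvec_simps c_def)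
  moreover have "cre ?z (expv w) + (\<i> * complex_of_real ?t - hdot w ?z) *\<^sub>C expv w = act X (expv w)"
    unfolding heis_lie_act_eq cre_def fock_annihilation_expv sum_3 hdot_def
    by (simp add: scaleC_diff_left scaleC_add_left scaleC_scaleC mult.commute)
  ultimately show ?thesis by simp
qed

section \<open>From weak derivatives to norm estimates\<close>

lemma heis_mult_collinear: "heis_mult (r *\<^sub>R X) (s *\<^sub>R X) = (r + s) *\<^sub>R (X :: 'n::finite heis)"
  by (cases X) (simp add: heis_mult_eq scaleR_left_distrib inner_commute distrib_right)

text \<open>Skew-symmetry moves the derivative onto the exponential vectors, where it is known.\<close>

lemma weyl_op_weak_deriv:
  assumes f: "f \<in> rapidly_decreasing" and g: "g \<in> lin_span expv"
  shows "((\<lambda>s. cinner (weyl_op (s *\<^sub>R X) f) g) has_vector_derivative cinner (weyl_op (s *\<^sub>R X) (act X f)) g) (at s)"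
  using g
proof induction
  case zero
  show ?case by simp
next
  case (step g c w)
  note adj = heis_rep_adjoint[OF weyl_op_heis_rep]
  have "((\<lambda>r. cinner (weyl_op (r *\<^sub>R X) f) (expv w)) has_vector_derivative cinner (weyl_op (s *\<^sub>R X) (act X f)) (expv w)) (at s)"
  proof -
    \<comment> \<open>Weyl operators map exponential vectors to multiples of such vectors, so the
      derivative at parameter 0 is available for \<open>\<psi>\<close> too.\<close>
    define \<psi> where "\<psi> = weyl_op (s *\<^sub>R (- X)) (expv w)"
    define k where "k = coef (s *\<^sub>R (- X)) w"
    define w' where "w' = w + zvec (s *\<^sub>R (- X))"
    have \<psi>: "\<psi> = k *\<^sub>C expv w'" by (simp add: \<psi>_def weyl_op_expv k_def w'_def)
    have "((\<lambda>r. weyl_op (r *\<^sub>R (- X)) (expv w')) has_vector_derivative act (- X) (expv w')) (at (s - s))"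
      using weyl_op_deriv_expv[of "- X" w'] by simp
    from bounded_linear.has_vector_derivative[OF bounded_linear_scaleC this, of k]
    have 1: "((\<lambda>r. weyl_op (r *\<^sub>R (- X)) \<psi>) has_vector_derivative act (- X) \<psi>) (at (s - s))"
      by (simp add: \<psi> unitary_scaleC[OF weyl_op_unitary] act_scale_right[OF expv_rapid])
    have "((\<lambda>r. r - s) has_vector_derivative 1) (at s)" by (auto intro!: derivative_eq_intros)
    from vector_diff_chain_at[OF this 1]
    have "((\<lambda>r. weyl_op ((r - s) *\<^sub>R (- X)) \<psi>) has_vector_derivative act (- X) \<psi>) (at s)" by (simp add: comp_def)
    moreover have "weyl_op ((r - s) *\<^sub>R (- X)) \<psi> = weyl_op (r *\<^sub>R (- X)) (expv w)" for r
      unfolding \<psi>_def heis_rep_mult[OF weyl_op_heis_rep, symmetric] heis_mult_collinear by simp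
    ultimately have "((\<lambda>r. weyl_op (r *\<^sub>R (- X)) (expv w)) has_vector_derivative act (- X) \<psi>) (at s)" by simp
    from bounded_linear.has_vector_derivative[OF bounded_bilinear.bounded_linear_right[OF bounded_bilinear_cinner] this, of f]
    have "((\<lambda>r. cinner (weyl_op (r *\<^sub>R X) f) (expv w)) has_vector_derivative cinner f (act (- X) \<psi>)) (at s)"
      by (simp add: adj)
    moreover have "cinner f (act (- X) \<psi>) = cinner (weyl_op (s *\<^sub>R X) (act X f)) (expv w)"
    proof -
      have "\<psi> \<in> rapidly_decreasing"
        by (simp add: \<psi> csubspace_scaleC[OF csubspace_rapidly_decreasing] expv_rapid)
      then show ?thesis using act_skew[OF f, of \<psi> X] by (simp add: adj \<psi>_def)
    qed
    ultimately show ?thesis by simp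
  qed
  from has_vector_derivative_add[OF step.IH has_vector_derivative_mult_right[OF this, of "cnj c"]]
  show ?case by (simp add: cinner_simps)
qed

text \<open>The mean value inequality against a test vector gives a bound proportional to its norm,
  since the Weyl operators are isometric.\<close>

lemma weyl_op_increment_le:
  assumes f: "f \<in> rapidly_decreasing"
  shows "norm (weyl_op X f - f) \<le> norm (act X f)"
proof (rule norm_le_of_dense[OF expv_total])
  fix g assume g: "g \<in> lin_span expv"
  have "norm (cinner (weyl_op (1 *\<^sub>R X) f) g - cinner (weyl_op (0 *\<^sub>R X) f) g) \<le> norm (act X f) * norm g"
  proof (rule vector_derivative_bound_01[OF weyl_op_weak_deriv[OF f g]])
    show "norm (cinner (weyl_op (s *\<^sub>R X) (act X f)) g) \<le> norm (act X f) * norm g" for s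
      using cmod_cinner_le[of "weyl_op (s *\<^sub>R X) (act X f)" g] by (simp add: unitary_norm[OF weyl_op_unitary])
  qed
  then show "cmod (cinner (weyl_op X f - f) g) \<le> norm (act X f) * norm g"
    by (simp add: heis_rep_zero[OF weyl_op_heis_rep] cinner_simps)
qed simp

text \<open>Subtracting the linear term leaves the increment of \<open>act X f\<close> as the
  derivative, to which the first-order estimate applies because \<open>act X f\<close> is again
  rapidly decreasing.\<close>

lemma weyl_op_remainder_le:
  assumes f: "f \<in> rapidly_decreasing"
  shows "norm (weyl_op X f - f - act X f) \<le> norm (act X (act X f))"
proof (rule norm_le_of_dense[OF expv_total])
  fix g assume g: "g \<in> lin_span expv"
  have d: "((\<lambda>s. cinner (weyl_op (s *\<^sub>R X) f) g - s *\<^sub>R cinner (act X f) g) has_vector_derivative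
      cinner (weyl_op (s *\<^sub>R X) (act X f)) g - cinner (act X f) g) (at s)" for s
    by (rule has_vector_derivative_diff[OF weyl_op_weak_deriv[OF f g]])
      (auto intro!: derivative_eq_intros)
  have "norm ((cinner (weyl_op (1 *\<^sub>R X) f) g - 1 *\<^sub>R cinner (act X f) g) -
      (cinner (weyl_op (0 *\<^sub>R X) f) g - 0 *\<^sub>R cinner (act X f) g)) \<le> norm (act X (act X f)) * norm g"
  proof (rule vector_derivative_bound_01[OF d])
    fix s :: real assume s: "0 \<le> s" "s \<le> 1"
    have "norm (weyl_op (s *\<^sub>R X) (act X f) - act X f) \<le> norm (act (s *\<^sub>R X) (act X f))"
      by (rule weyl_op_increment_le[OF act_rapid[OF f]])
    also have "\<dots> = s * norm (act X (act X f))" using s by (simp add: act_linear_left)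
    also have "\<dots> \<le> norm (act X (act X f))" using s by (simp add: mult_left_le_one_le)
    finally have "norm (weyl_op (s *\<^sub>R X) (act X f) - act X f) * norm g \<le> norm (act X (act X f)) * norm g"
      by (rule mult_right_mono) simp
    then show "norm (cinner (weyl_op (s *\<^sub>R X) (act X f)) g - cinner (act X f) g) \<le> norm (act X (act X f)) * norm g"
      using cmod_cinner_le[of "weyl_op (s *\<^sub>R X) (act X f) - act X f" g] by (simp add: cinner_simps)
  qed
  then show "cmod (cinner (weyl_op X f - f - act X f) g) \<le> norm (act X (act X f)) * norm g"
    by (simp add: heis_rep_zero[OF weyl_op_heis_rep] cinner_simps algebra_simps)
qed simp

text \<open>The remainder is bounded by a bilinear expression on the finite-dimensional Lie algebra,
  hence is quadratic in \<open>X\<close>.\<close>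

lemma weyl_op_has_derivative_zero:
  assumes f: "f \<in> rapidly_decreasing"
  shows "((\<lambda>X. weyl_op X f) has_derivative (\<lambda>X. act X f)) (at 0)"
proof -
  have lin: "linear (\<lambda>X. act X f)" for f by (rule linearI) (simp_all add: act_linear_left)
  have "bilinear (\<lambda>X Y. act X (act Y f))"
    unfolding bilinear_def
  proof (intro conjI allI)
    show "linear (\<lambda>Y. act X (act Y f))" for X
      by (rule linearI) (simp_all add: act_linear_left act_add_right act_scale_right act_rapid f)
  qed (rule lin)
  then have "bounded_bilinear (\<lambda>X Y. act X (act Y f))" by (simp add: bilinear_conv_bounded_bilinear)
  then obtain K where K: "\<And>X Y. norm (act X (act Y f)) \<le> norm X * norm Y * K"
    using bounded_bilinear.bounded by blast
  show ?thesis
  proof (rule quadratic_remainder_has_derivative[where e=1 and C=K])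
    show "bounded_linear (\<lambda>X. act X f)" by (rule linear_conv_bounded_linear[THEN iffD1, OF lin])
    show "norm (weyl_op X f - weyl_op 0 f - act (X - 0) f) \<le> K * (norm (X - 0))\<^sup>2" for X
      using weyl_op_remainder_le[OF f, of X] K[of X X]
      by (simp add: heis_rep_zero[OF weyl_op_heis_rep] power2_eq_square mult_ac)
  qed simp
qed

text \<open>The central coordinate by which left translation to the identity differs from
  subtraction in exponential coordinates. It is linear in either argument because the group is
  two-step nilpotent.\<close>

definition twist :: "3 heis \<Rightarrow> 3 heis \<Rightarrow> real" where
  "twist h g = (case (g, h) of ((p, q, t), (p', q', t')) \<Rightarrow> - (p \<bullet> q' - q \<bullet> p') / 2)"

lemma twist_linear_right: "bounded_linear (twist h)"
proof -
  have "linear (twist h)"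
    by (cases h, rule linearI) (auto simp: twist_def inner_simps algebra_simps diff_divide_distrib add_divide_distrib)
  then show ?thesis by (rule linear_conv_bounded_linear[THEN iffD1])
qed

lemma twist_linear_left: "linear (\<lambda>h. twist h g)"
  by (cases g, rule linearI) (auto simp: twist_def inner_simps algebra_simps diff_divide_distrib add_divide_distrib)

lemma heis_mult_difference: "heis_mult (- g) h = (h - g) + (0, 0, twist (h - g) g)"
  by (cases g; cases h) (simp add: heis_mult_eq twist_def inner_simps inner_commute field_simps)

lemma act_central: "act (0, 0, r) f = r *\<^sub>R (\<i> *\<^sub>C f)"
  by (simp add: heis_lie_act_eq zvec_simps scaleR_scaleC scaleC_scaleC mult.commute)

text \<open>Writing h = g (g^(-1) h) moves the base point to the identity. Only
  \<open>act h f\<close> and \<i> times \<open>f\<close> occur, both rapidly decreasing, so the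
  formula can be iterated.\<close>

lemma weyl_op_has_derivative:
  assumes f: "f \<in> rapidly_decreasing"
  shows "((\<lambda>h. weyl_op h f) has_derivative
    (\<lambda>h. weyl_op g (act h f) + twist h g *\<^sub>R weyl_op g (\<i> *\<^sub>C f))) (at g)"
proof -
  define A where "A h = h + (0, 0, twist h g)" for h :: "3 heis"
  have lin: "linear A"
    unfolding A_def by (rule linearI)
      (simp_all add: linear_add[OF twist_linear_left] linear_cmul[OF twist_linear_left] scaleR_right_distrib)
  then have bl: "bounded_linear A" by (rule linear_conv_bounded_linear[THEN iffD1])
  have 1: "((\<lambda>h. A (h - g)) has_derivative A) (at g)"
    using has_derivative_diff[OF bounded_linear_imp_has_derivative[OF bl] has_derivative_const[of "A g"], of "at g"]
    by (simp add: linear_diff[OF lin])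
  have "((\<lambda>X. weyl_op X f) has_derivative (\<lambda>X. act X f)) (at (A (g - g)))"
    using weyl_op_has_derivative_zero[OF f] by (simp add: linear_0[OF lin])
  from diff_chain_at[OF 1 this]
  have "((\<lambda>h. weyl_op (A (h - g)) f) has_derivative (\<lambda>h. act (A h) f)) (at g)" by (simp add: comp_def)
  from bounded_linear.has_derivative[OF unitary_bounded_linear[OF weyl_op_unitary[of g]] this]
  have "((\<lambda>h. weyl_op g (weyl_op (A (h - g)) f)) has_derivative (\<lambda>h. weyl_op g (act (A h) f))) (at g)" .
  moreover have "weyl_op g (weyl_op (A (h - g)) f) = weyl_op h f" for h
  proof -
    have "weyl_op (A (h - g)) f = weyl_op (- g) (weyl_op h f)"
      unfolding A_def heis_mult_difference[symmetric] by (rule heis_rep_mult[OF weyl_op_heis_rep])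
    then show ?thesis by (simp add: heis_rep_inverse[OF weyl_op_heis_rep])
  qed
  moreover have "weyl_op g (act (A h) f) = weyl_op g (act h f) + twist h g *\<^sub>R weyl_op g (\<i> *\<^sub>C f)" for h
    unfolding A_def act_linear_left act_central
    by (simp add: unitary_add[OF weyl_op_unitary] scaleR_scaleC unitary_scaleC[OF weyl_op_unitary])
  ultimately show ?thesis by simp
qed

lemma rapidly_decreasing_smooth:
  assumes "f \<in> rapidly_decreasing"
  shows "f \<in> smooth_vectors weyl_op"
proof -
  \<comment> \<open>All vectors are treated at once, as the derivative for \<open>f\<close> involves
    other vectors of the domain.\<close>
  have "\<forall>f\<in>rapidly_decreasing. C_k k (\<lambda>g. weyl_op g f)" for k
  proof (induction k)
    case 0
    show ?case by (simp add: weyl_op_continuous)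
  next
    case (Suc k)
    show ?case
    proof
      fix f assume f: "f \<in> rapidly_decreasing"
      show "C_k (Suc k) (\<lambda>g. weyl_op g f)"
      proof (rule C_k_SucI[OF weyl_op_has_derivative[OF f]])
        show "C_k k (\<lambda>g. weyl_op g (act v f) + twist v g *\<^sub>R weyl_op g (\<i> *\<^sub>C f))" for v
          using Suc f by (intro C_k_add C_k_scaleR twist_linear_right)
            (auto simp: act_rapid csubspace_scaleC[OF csubspace_rapidly_decreasing])
      qed
    qed
  qed
  then show ?thesis using assms by (simp add: smooth_vectors_def smooth_def)
qed

lemma weyl_op_deriv:
  assumes "f \<in> rapidly_decreasing"
  shows "((\<lambda>s. weyl_op (s *\<^sub>R X) f) has_vector_derivative act X f) (at 0)"
proof -
  have 1: "((\<lambda>s. s *\<^sub>R X) has_derivative (\<lambda>s. s *\<^sub>R X)) (at 0)"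
    by (rule bounded_linear_imp_has_derivative[OF bounded_linear_scaleR_left])
  have "((\<lambda>X. weyl_op X f) has_derivative (\<lambda>X. act X f)) (at (0 *\<^sub>R X))"
    using weyl_op_has_derivative_zero[OF assms] by simp
  from diff_chain_at[OF 1 this] show ?thesis
    by (simp add: has_vector_derivative_def comp_def act_linear_left)
qed

section \<open>Smooth vectors decrease rapidly\<close>

definition unit_seq :: "occ \<Rightarrow> occ \<Rightarrow> complex" where
  "unit_seq n m = (if m = n then 1 else 0)"

lemma unit_seq_rapid: "rapid (unit_seq n)"
proof -
  have "wt m ^ N * cmod (unit_seq n m) \<le> wt n ^ N" for N m
    using wt_ge_1[of n] by (auto simp: unit_seq_def)
  then show ?thesis unfolding rapid_def by blast
qed

lemma cinner_unit: "cinner v (ell2_of (unit_seq n)) = ell2_coord v n"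
proof (rule has_sum_unique)
  show "((\<lambda>m. ell2_coord v m * cnj (unit_seq n m)) has_sum cinner v (ell2_of (unit_seq n))) UNIV"
    using cinner_has_sum[of v "ell2_of (unit_seq n)"] by (simp add: unit_seq_rapid)
  show "((\<lambda>m. ell2_coord v m * cnj (unit_seq n m)) has_sum ell2_coord v n) UNIV"
    by (rule has_sum_finite_neutralI[where B="{n}"]) (auto simp: unit_seq_def)
qed

lemma fock_creation_unit:
  "fock_rep (Gen j) (ell2_of (unit_seq n)) = complex_of_real (sqrt (real (cnt j n) + 1)) *\<^sub>C ell2_of (unit_seq (inc j n))"
proof (rule ell2_eqI)
  fix m
  have "cr j (unit_seq n) m = complex_of_real (sqrt (real (cnt j n) + 1)) * unit_seq (inc j n) m"
  proof (cases "m = inc j n")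
    case False
    then have "cnt j m = 0 \<or> dec j m \<noteq> n" using inc_dec by metis
    then show ?thesis using False by (auto simp: cr_def unit_seq_def)
  qed (simp add: cr_def unit_seq_def cnt_inc add.commute)
  then show "ell2_coord (fock_rep (Gen j) (ell2_of (unit_seq n))) m =
      ell2_coord (complex_of_real (sqrt (real (cnt j n) + 1)) *\<^sub>C ell2_of (unit_seq (inc j n))) m"
    by (simp add: coord_fock_rep unit_seq_rapid scaleC_ell2.rep_eq)
qed

lemma fock_annihilation_unit:
  "fock_rep ((Gen j)\<^sup>\<star>) (ell2_of (unit_seq n)) = complex_of_real (sqrt (real (cnt j n))) *\<^sub>C ell2_of (unit_seq (dec j n))"
proof (rule ell2_eqI)
  fix m
  have "an j (unit_seq n) m = complex_of_real (sqrt (real (cnt j n))) * unit_seq (dec j n) m"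
  proof (cases "n = inc j m")
    case False
    then have "cnt j n = 0 \<or> dec j n \<noteq> m" using inc_dec by metis
    then show ?thesis using False by (auto simp: an_def unit_seq_def)
  qed (simp add: an_def unit_seq_def cnt_inc add.commute)
  then show "ell2_coord (fock_rep ((Gen j)\<^sup>\<star>) (ell2_of (unit_seq n))) m =
      ell2_coord (complex_of_real (sqrt (real (cnt j n))) *\<^sub>C ell2_of (unit_seq (dec j n))) m"
    by (simp add: coord_fock_rep unit_seq_rapid scaleC_ell2.rep_eq)
qed

lemma cinner_act_unit: "cinner v (act (- X) (ell2_of (unit_seq n))) = actf X (ell2_coord v) n"
  unfolding heis_lie_act_eq sum_3 fock_creation_unit fock_annihilation_unit actf_def
  by (simp add: cinner_simps cinner_unit zvec_simps cr_def an_def algebra_simps)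

lemma smooth_vector_derivative_coord:
  assumes "((\<lambda>s. weyl_op (s *\<^sub>R X) v) has_vector_derivative L) (at 0)"
  shows "ell2_coord L n = actf X (ell2_coord v) n"
proof -
  let ?e = "ell2_of (unit_seq n)"
  have e: "?e \<in> rapidly_decreasing" by (simp add: unit_seq_rapid)
  have "((\<lambda>s. cinner (weyl_op (s *\<^sub>R X) v) ?e) has_vector_derivative cinner L ?e) (at 0)"
    by (rule bounded_linear.has_vector_derivative[OF bounded_bilinear.bounded_linear_left[OF bounded_bilinear_cinner] assms])
  moreover have "((\<lambda>s. cinner v (weyl_op (s *\<^sub>R (- X)) ?e)) has_vector_derivative cinner v (act (- X) ?e)) (at 0)"
    by (rule bounded_linear.has_vector_derivative[OF bounded_bilinear.bounded_linear_right[OF bounded_bilinear_cinner] weyl_op_deriv[OF e]])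
  moreover have "cinner (weyl_op (s *\<^sub>R X) v) ?e = cinner v (weyl_op (s *\<^sub>R (- X)) ?e)" for s
    using heis_rep_adjoint[OF weyl_op_heis_rep] by simp
  ultimately have "cinner L ?e = cinner v (act (- X) ?e)"
    using vector_derivative_unique_at by simp
  then show ?thesis by (simp add: cinner_unit cinner_act_unit)
qed

lemma csubspace_smooth_vectors:
  assumes "heis_rep U"
  shows "csubspace (smooth_vectors U)"
proof -
  have "smooth (\<lambda>g. U g 0)"
  proof -
    have "C_k k (\<lambda>g::'a heis. 0::'b)" for k
      by (induction k) (auto intro!: C_k_SucI[where f'="\<lambda>_ _. 0"])
    then show ?thesis
      by (simp add: smooth_def linear_0[OF bounded_linear.linear[OF unitary_bounded_linear[OF heis_rep_unitary[OF assms]]]])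
  qed
  then show ?thesis
    by (auto simp: csubspace_def smooth_vectors_def unitary_add[OF heis_rep_unitary[OF assms]] smooth_add
        unitary_scaleC[OF heis_rep_unitary[OF assms]] smooth_bounded_linear[OF bounded_linear_scaleC])
qed

text \<open>With \<open>u\<close> the derivative of the orbit of \<open>v\<close> at the identity,
  the orbit map of \<open>u\<close> differentiates that of \<open>v\<close> along a left-invariant
  field. The coefficients of this field are affine in \<open>g\<close>, so smoothness is
  inherited.\<close>

lemma smooth_vectors_act_invariant:
  assumes v: "v \<in> smooth_vectors weyl_op"
  obtains u where "u \<in> smooth_vectors weyl_op" "ell2_coord u = actf X (ell2_coord v)"
proof -
  let ?F = "\<lambda>g. weyl_op g v"
  let ?F' = "\<lambda>g. frechet_derivative ?F (at g)"
  have sm: "smooth ?F" using v by (simp add: smooth_vectors_def)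
  have F': "(?F has_derivative ?F' g) (at g)" for g
    using smooth_differentiable[OF sm] by (simp add: frechet_derivative_works[symmetric])
  define u where "u = ?F' 0 X"
  have d0: "((\<lambda>s. weyl_op (s *\<^sub>R X) v) has_vector_derivative u) (at 0)"
  proof -
    have 1: "((\<lambda>s. s *\<^sub>R X) has_derivative (\<lambda>s. s *\<^sub>R X)) (at 0)"
      by (rule bounded_linear_imp_has_derivative[OF bounded_linear_scaleR_left])
    have "(?F has_derivative ?F' 0) (at (0 *\<^sub>R X))" using F'[of 0] by simp
    from diff_chain_at[OF 1 this] show ?thesis
      by (simp add: has_vector_derivative_def comp_def u_def linear_cmul[OF has_derivative_linear[OF F'[of 0]]])
  qed
  have eq: "weyl_op g u = ?F' g X + (- twist X g) *\<^sub>R ?F' g (0, 0, 1)" for g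
  proof -
    \<comment> \<open>The value at \<open>g\<close> of the left-invariant field generated by
      \<open>X\<close>.\<close>
    let ?Y = "X + (0, 0, - twist X g)"
    have "((\<lambda>s. weyl_op g (weyl_op (s *\<^sub>R X) v)) has_vector_derivative weyl_op g u) (at 0)"
      by (rule bounded_linear.has_vector_derivative[OF unitary_bounded_linear[OF weyl_op_unitary] d0])
    moreover have "weyl_op g (weyl_op (s *\<^sub>R X) v) = ?F (g + s *\<^sub>R ?Y)" for s
    proof -
      have "heis_mult g (s *\<^sub>R X) = g + s *\<^sub>R ?Y"
        by (cases g; cases X) (simp add: heis_mult_eq twist_def inner_simps algebra_simps diff_divide_distrib)
      then show ?thesis by (simp flip: heis_rep_mult[OF weyl_op_heis_rep])
    qed
    ultimately have 1: "((\<lambda>s. ?F (g + s *\<^sub>R ?Y)) has_vector_derivative weyl_op g u) (at 0)" by simp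
    have 2: "((\<lambda>s. g + s *\<^sub>R ?Y) has_derivative (\<lambda>s. s *\<^sub>R ?Y)) (at 0)"
      by (auto intro!: derivative_eq_intros)
    have "(?F has_derivative ?F' g) (at (g + 0 *\<^sub>R ?Y))" using F'[of g] by simp
    from diff_chain_at[OF 2 this]
    have "((\<lambda>s. ?F (g + s *\<^sub>R ?Y)) has_vector_derivative ?F' g ?Y) (at 0)"
      by (simp only: has_vector_derivative_def comp_def linear_cmul[OF has_derivative_linear[OF F'[of g]]])
    then have "weyl_op g u = ?F' g ?Y" by (rule vector_derivative_unique_at[OF 1])
    also have "?Y = X + (- twist X g) *\<^sub>R (0, 0, 1)" by simp
    finally show ?thesis
      by (simp only: linear_add[OF has_derivative_linear[OF F'[of g]]] linear_cmul[OF has_derivative_linear[OF F'[of g]]])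
  qed
  have "smooth (\<lambda>g. weyl_op g u)"
    unfolding eq by (intro smooth_add smooth_scaleR smooth_frechet_derivative sm bounded_linear_minus twist_linear_right)
  then have "u \<in> smooth_vectors weyl_op" by (simp add: smooth_vectors_def)
  moreover have "ell2_coord u = actf X (ell2_coord v)"
    using smooth_vector_derivative_coord[OF d0] by auto
  ultimately show thesis by (rule that)
qed

text \<open>Momentum and position, applied to \<open>v\<close> by the preceding lemma, are combined
  as in \<open>rep_gen_eq\<close>, now on coordinates.\<close>

lemma smooth_vectors_ladder:
  assumes v: "v \<in> smooth_vectors weyl_op"
  shows "\<exists>u\<in>smooth_vectors weyl_op. ell2_coord u = cr j (ell2_coord v)"
    and "\<exists>u\<in>smooth_vectors weyl_op. ell2_coord u = an j (ell2_coord v)"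
proof -
  note sub = csubspace_smooth_vectors[OF weyl_op_heis_rep]
  let ?r = "complex_of_real (1 / sqrt 2)"
  obtain a where a: "a \<in> smooth_vectors weyl_op" "ell2_coord a = actf (axis j 1, 0, 0) (ell2_coord v)"
    using smooth_vectors_act_invariant[OF v] by blast
  obtain b where b: "b \<in> smooth_vectors weyl_op" "ell2_coord b = actf (0, axis j 1, 0) (ell2_coord v)"
    using smooth_vectors_act_invariant[OF v] by blast
  have za: "zvec (axis j 1, 0, 0) $ i = (if i = j then - ?r else 0)"
    and zb: "zvec (0, axis j 1, 0) $ i = (if i = j then \<i> * ?r else 0)" for i
    by (simp_all add: zvec_def axis_def complex_eq_iff)
  have half: "?r * ?r = 1 / 2" by (simp flip: of_real_mult)
  have cr_eq: "- r * (r * (x - y) + \<i> * (\<i> * r * (x + y))) = (r * r) * (2 * y)"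
    and an_eq: "r * (r * (x - y) - \<i> * (\<i> * r * (x + y))) = (r * r) * (2 * x)" for r x y :: complex
    by (simp_all add: algebra_simps)
  have ca: "ell2_coord a n = ?r * (an j (ell2_coord v) n - cr j (ell2_coord v) n)" for n
    unfolding a(2) actf_def za by (cases j rule: cases_3) (simp_all add: sum_3 algebra_simps)
  have cb: "ell2_coord b n = \<i> * ?r * (an j (ell2_coord v) n + cr j (ell2_coord v) n)" for n
    unfolding b(2) actf_def zb by (cases j rule: cases_3) (simp_all add: sum_3 algebra_simps)
  show "\<exists>u\<in>smooth_vectors weyl_op. ell2_coord u = cr j (ell2_coord v)"
  proof (rule bexI[of _ "(- ?r) *\<^sub>C (a + \<i> *\<^sub>C b)"])
    show "(- ?r) *\<^sub>C (a + \<i> *\<^sub>C b) \<in> smooth_vectors weyl_op"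
      by (intro csubspace_scaleC csubspace_add sub a b)
    have "- ?r * (?r * (x - y) + \<i> * (\<i> * ?r * (x + y))) = y" for x y
      unfolding cr_eq half by simp
    then show "ell2_coord ((- ?r) *\<^sub>C (a + \<i> *\<^sub>C b)) = cr j (ell2_coord v)"
      by (intro ext) (simp only: scaleC_ell2.rep_eq plus_ell2.rep_eq ca cb)
  qed
  show "\<exists>u\<in>smooth_vectors weyl_op. ell2_coord u = an j (ell2_coord v)"
  proof (rule bexI[of _ "?r *\<^sub>C (a - \<i> *\<^sub>C b)"])
    show "?r *\<^sub>C (a - \<i> *\<^sub>C b) \<in> smooth_vectors weyl_op"
      by (intro csubspace_scaleC csubspace_diff sub a b)
    have "?r * (?r * (x - y) - \<i> * (\<i> * ?r * (x + y))) = x" for x y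
      unfolding an_eq half by simp
    then show "ell2_coord (?r *\<^sub>C (a - \<i> *\<^sub>C b)) = an j (ell2_coord v)"
      by (intro ext) (simp only: scaleC_ell2.rep_eq minus_ell2.rep_eq ca cb)
  qed
qed

text \<open>Multiplication by \<open>wt\<close> is 1 plus the number operator, a polynomial in the
  ladder operators.\<close>

lemma smooth_vectors_number:
  assumes v: "v \<in> smooth_vectors weyl_op"
  shows "\<exists>u\<in>smooth_vectors weyl_op. ell2_coord u = (\<lambda>n. complex_of_real (wt n ^ N) * ell2_coord v n)"
proof (induction N)
  case 0
  then show ?case using v by auto
next
  case (Suc N)
  then obtain u where u: "u \<in> smooth_vectors weyl_op" "ell2_coord u = (\<lambda>n. complex_of_real (wt n ^ N) * ell2_coord v n)"
    by blast
  have "\<exists>y\<in>smooth_vectors weyl_op. ell2_coord y = cr j (an j (ell2_coord u))" for j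
    using smooth_vectors_ladder(2)[OF u(1), of j] smooth_vectors_ladder(1) by metis
  then obtain y where y: "\<And>j. y j \<in> smooth_vectors weyl_op" "\<And>j. ell2_coord (y j) = cr j (an j (ell2_coord u))"
    by metis
  have "u + (y 1 + y 2 + y 3) \<in> smooth_vectors weyl_op"
    by (intro csubspace_add csubspace_smooth_vectors weyl_op_heis_rep u y)
  moreover have "ell2_coord (u + (y 1 + y 2 + y 3)) n = complex_of_real (wt n ^ Suc N) * ell2_coord v n" for n
  proof -
    have "ell2_coord (u + (y 1 + y 2 + y 3)) n = complex_of_real (wt n) * ell2_coord u n"
      by (simp add: plus_ell2.rep_eq y cr_an wt_cnt sum_3 algebra_simps)
    then show ?thesis by (simp add: u(2) mult.assoc)
  qed
  ultimately show ?case by (intro bexI[of _ "u + (y 1 + y 2 + y 3)"]) auto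
qed

lemma smooth_vectors_weyl_op: "smooth_vectors weyl_op = rapidly_decreasing"
proof (intro subset_antisym subsetI)
  fix v assume v: "v \<in> smooth_vectors weyl_op"
  show "v \<in> rapidly_decreasing"
    unfolding rapidly_decreasing_iff rapid_def
  proof
    fix N
    \<comment> \<open>Membership of the weighted family in the Hilbert space already bounds each of
      its coordinates by the norm.\<close>
    obtain u where u: "ell2_coord u = (\<lambda>n. complex_of_real (wt n ^ N) * ell2_coord v n)"
      using smooth_vectors_number[OF v] by blast
    have "wt n ^ N * cmod (ell2_coord v n) \<le> norm u" for n
      using ell2_coord_le[of u n] wt_ge_1[of n] by (simp add: u norm_mult norm_power)
    then show "\<exists>C. \<forall>n. wt n ^ N * cmod (ell2_coord v n) \<le> C" by blast
  qed
qed (rule rapidly_decreasing_smooth)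

theorem fock_rep_integrable: "integrable_rep rapidly_decreasing fock_rep"
  unfolding integrable_rep_def
  using weyl_op_heis_rep smooth_vectors_weyl_op weyl_op_deriv by blast

section \<open>The representation\<close>

lemma mode_linear:
  "cr j (\<lambda>n. f n - g n) = (\<lambda>n. cr j f n - cr j g n)" "cr j (\<lambda>n. f n / c) = (\<lambda>n. cr j f n / c)"
  "an j (\<lambda>n. f n - g n) = (\<lambda>n. an j f n - an j g n)" "an j (\<lambda>n. f n / c) = (\<lambda>n. an j f n / c)"
  "cr j (\<lambda>n. f n * c) = (\<lambda>n. c * cr j f n)" "an j (\<lambda>n. f n * c) = (\<lambda>n. c * an j f n)"
  by (auto simp: cr_def an_def fun_eq_iff algebra_simps)

lemma A0_relation_interp:
  assumes "(s, t) \<in> A0_rels x"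
  shows "interp (star_subst (A0_iso_gen x) s) b f = interp (star_subst (A0_iso_gen x) t) b f"
proof -
  \<comment> \<open>This balances the first two modes: in the commutators of the adjoint of
    \<open>a1\<close> with \<open>A\<close> and with \<open>a1\<close>, their contributions cancel
    because |x|^2 = x \<open>cnj\<close> x.\<close>
  have "complex_of_real (cmod x) * complex_of_real (cmod x) = x * cnj x"
    using complex_norm_square[of x] by (simp add: power2_eq_square)
  then have xx: "complex_of_real (cmod x) * (complex_of_real (cmod x) * z) = x * (cnj x * z)" for z
    by (metis mult.assoc)
  \<comment> \<open>Oriented instances of commutativity that sort the modes and so give operator
    words a normal form.\<close>
  have com: "cr 2 (cr 1 f) = cr 1 (cr 2 f)" "cr 3 (cr 1 f) = cr 1 (cr 3 f)" "cr 3 (cr 2 f) = cr 2 (cr 3 f)"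
    "an 2 (an 1 f) = an 1 (an 2 f)" "an 3 (an 1 f) = an 1 (an 3 f)" "an 3 (an 2 f) = an 2 (an 3 f)" for f
    by (rule cr_commute an_commute)+
  note rules = fun_eq_iff cr_linear an_linear cr_minus an_minus an_cr_same an_cr_other com mode_linear algebra_simps xx
    add_divide_distrib diff_divide_distrib
  show ?thesis
  proof (cases b)
    case True
    with assms show ?thesis by (auto simp: A0_rels_def Let_def rules)
  next
    case False
    with assms show ?thesis by (auto simp: A0_rels_def Let_def rules)
  qed
qed


text \<open>Transfers irreducibility across the isomorphism in either direction; the hypothesis is
  applied to \<open>K\<close> and to its complement.\<close>

lemma irreducible_rep_of_invariant:
  assumes irr: "irreducible_rep D \<pi>"
    and inv: "\<And>K. csubspace K \<Longrightarrow> \<forall>t. \<rho> t ` (D \<inter> K) \<subseteq> K \<Longrightarrow> \<forall>t. \<pi> t ` (D \<inter> K) \<subseteq> K"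
  shows "irreducible_rep D \<rho>"
  unfolding irreducible_rep_def
proof (intro conjI allI impI; (elim conjE)?)
  show "\<exists>v::'a. v \<noteq> 0" using irr by (simp add: irreducible_rep_def)
  fix K :: "'a set"
  assume K: "csubspace K" "closed K" "\<forall>v\<in>D. \<exists>u\<in>D \<inter> K. \<exists>w\<in>D \<inter> ortho_compl K. v = u + w"
    "\<forall>t. \<rho> t ` (D \<inter> K) \<subseteq> K" "\<forall>t. \<rho> t ` (D \<inter> ortho_compl K) \<subseteq> ortho_compl K"
  then show "K = {0} \<or> K = UNIV"
    using irr inv[OF K(1,4)] inv[OF csubspace_ortho_compl K(5)] unfolding irreducible_rep_def by blast
qed

section \<open>Irreducibility of the Fock representation\<close>

abbreviation unit_vec :: "occ \<Rightarrow> occ ell2" where "unit_vec n \<equiv> ell2_of (unit_seq n)"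

lemma unit_vec_rapid: "unit_vec n \<in> rapidly_decreasing"
  by (simp add: unit_seq_rapid)

lemma unit_vec_in_invariant:
  assumes K: "csubspace K" "unit_vec (0, 0, 0) \<in> K"
    and inv: "\<And>j v. v \<in> rapidly_decreasing \<Longrightarrow> v \<in> K \<Longrightarrow> fock_rep (Gen j) v \<in> K"
  shows "unit_vec n \<in> K"
proof -
  have step: "unit_vec (inc j n) \<in> K" if "unit_vec n \<in> K" for j n
  proof -
    have "complex_of_real (sqrt (real (cnt j n) + 1)) *\<^sub>C unit_vec (inc j n) \<in> K"
      using inv[OF unit_vec_rapid that, of j] by (simp add: fock_creation_unit)
    from csubspace_scaleC[OF K(1) this, of "1 / complex_of_real (sqrt (real (cnt j n) + 1))"]
    show ?thesis by (simp add: scaleC_scaleC add_nonneg_eq_0_iff)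
  qed
  have 1: "unit_vec (0, 0, m) \<in> K" for m
    by (induction m) (use K(2) step[of _ 3] in \<open>auto simp: inc_def\<close>)
  have 2: "unit_vec (0, l, m) \<in> K" for l m
    by (induction l) (use 1 step[of _ 2] in \<open>auto simp: inc_def\<close>)
  have "unit_vec (k, l, m) \<in> K" for k l m
    by (induction k) (use 2 step[of _ 1] in \<open>auto simp: inc_def\<close>)
  then show ?thesis by (cases n) auto
qed

lemma unit_vec_total:
  assumes K: "csubspace K" "closed K" and units: "\<And>n. unit_vec n \<in> K"
  shows "K = UNIV"
proof (rule ortho_compl_trivial_imp_UNIV[OF K])
  have "f = 0" if "f \<in> ortho_compl K" for f
  proof (rule ell2_eqI)
    fix n
    have "cinner (unit_vec n) f = 0" using that units by (auto simp: ortho_compl_def)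
    then have "cinner f (unit_vec n) = 0" by (subst cinner_commute) simp
    then show "ell2_coord f n = ell2_coord 0 n" by (simp add: cinner_unit zero_ell2.rep_eq)
  qed
  then show "ortho_compl K = {0}" using csubspace_zero[OF csubspace_ortho_compl] by blast
qed

text \<open>The vacuum spans the common kernel of the annihilation operators, so it lies in \<open>K\<close> or in its complement.\<close>

lemma fock_rep_irreducible: "irreducible_rep rapidly_decreasing fock_rep"
  unfolding irreducible_rep_def
proof (intro conjI allI impI; (elim conjE)?)
  let ?e = "unit_vec (0, 0, 0)"
  have "?e \<noteq> 0"
  proof
    assume "?e = 0"
    then have "ell2_coord ?e (0, 0, 0) = 0" by (simp only: zero_ell2.rep_eq)
    then show False by (simp add: unit_seq_rapid unit_seq_def)
  qed
  then show "\<exists>v::occ ell2. v \<noteq> 0" by blast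
  fix K :: "occ ell2 set"
  assume K: "csubspace K" "closed K"
    and dec: "\<forall>v\<in>rapidly_decreasing. \<exists>u\<in>rapidly_decreasing \<inter> K. \<exists>w\<in>rapidly_decreasing \<inter> ortho_compl K. v = u + w"
    and inv: "\<forall>t. fock_rep t ` (rapidly_decreasing \<inter> K) \<subseteq> K"
    and inv': "\<forall>t. fock_rep t ` (rapidly_decreasing \<inter> ortho_compl K) \<subseteq> ortho_compl K"
  obtain u w where u: "u \<in> rapidly_decreasing" "u \<in> K" and w: "w \<in> rapidly_decreasing" "w \<in> ortho_compl K"
    and e: "?e = u + w"
    using dec unit_vec_rapid by blast
  \<comment> \<open>The images of \<open>u\<close> and \<open>w\<close> lie in \<open>K\<close> and
    in its complement, but add up to the image of the vacuum, which is 0; so each of them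
    vanishes.\<close>
  have "fock_rep ((Gen j)\<^sup>\<star>) u = 0" for j
  proof -
    let ?a = "fock_rep ((Gen j)\<^sup>\<star>)"
    have "?a u + ?a w = ?a ?e"
      using star_repD(3)[OF fock_rep_star_rep, of "(Gen j)\<^sup>\<star>"] u(1) w(1) by (simp add: e clinear_on_def)
    also have "\<dots> = 0" by (cases j rule: cases_3) (simp_all add: fock_annihilation_unit cnt_def)
    finally have "?a w = - ?a u" by (simp add: eq_neg_iff_add_eq_0 add.commute)
    moreover have "cinner (?a u) (?a w) = 0"
      using inv inv' u w by (auto simp: ortho_compl_def image_subset_iff)
    ultimately show ?thesis by (simp add: cinner_minus_right)
  qed
  then have "an j (ell2_coord u) n = 0" for j n
    using fun_cong[OF coord_fock_rep[OF u(1), of "(Gen j)\<^sup>\<star>"], of n] by (simp add: zero_ell2.rep_eq)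
  then have shift: "ell2_coord u (inc j n) = 0" for j n
    by (metis add_nonneg_eq_0_iff an_def mult_eq_0_iff of_nat_0_le_iff of_real_eq_0_iff real_sqrt_eq_0_iff zero_le_one zero_neq_one)
  have off: "ell2_coord u n = 0" if "n \<noteq> (0, 0, 0)" for n
  proof -
    \<comment> \<open>An occupied mode makes \<open>n\<close> of the form \<open>inc j m\<close>,
      where the coordinate of \<open>u\<close> is known to vanish.\<close>
    have "\<exists>j. cnt j n \<noteq> 0"
    proof (rule ccontr)
      assume "\<not> ?thesis"
      then have "cnt 1 n = 0" "cnt 2 n = 0" "cnt 3 n = 0" by auto
      then show False using that by (cases n) (simp add: cnt_def)
    qed
    then show ?thesis using shift inc_dec by metis
  qed
  have ue: "u = ell2_coord u (0, 0, 0) *\<^sub>C ?e"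
    by (intro ell2_eqI) (use off in \<open>auto simp: scaleC_ell2.rep_eq unit_seq_rapid unit_seq_def\<close>)
  show "K = {0} \<or> K = UNIV"
  proof (cases "ell2_coord u (0, 0, 0) = 0")
    case True
    then have "u = 0" using ue by simp
    then have "?e \<in> ortho_compl K" using w(2) e by simp
    then have "unit_vec n \<in> ortho_compl K" for n
      by (rule unit_vec_in_invariant[OF csubspace_ortho_compl]) (use inv' in blast)
    then have "ortho_compl K = UNIV"
      by (intro unit_vec_total csubspace_ortho_compl closed_ortho_compl)
    then have "x \<in> ortho_compl K" for x by simp
    then have "cinner x x = 0" if "x \<in> K" for x using that unfolding ortho_compl_def by blast
    then show ?thesis using csubspace_zero[OF K(1)] by auto
  next
    case False
    have "(1 / ell2_coord u (0, 0, 0)) *\<^sub>C u = ?e"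
      using False arg_cong[OF ue, of "\<lambda>v. (1 / ell2_coord u (0, 0, 0)) *\<^sub>C v"] by (simp add: scaleC_scaleC)
    then have "?e \<in> K" using csubspace_scaleC[OF K(1) u(2)] by metis
    then have "unit_vec n \<in> K" for n
      by (rule unit_vec_in_invariant[OF K(1)]) (use inv in blast)
    then show ?thesis using unit_vec_total[OF K] by blast
  qed
qed

section \<open>Recovering the CCR generators\<close>

text \<open>The expressions in \<open>a\<^sub>1\<close>, \<open>a\<^sub>2\<close>, \<open>A\<close> that the isomorphism sends to the CCR generators.\<close>

definition A0_inv2 :: "complex \<Rightarrow> gen star_expr" where
  "A0_inv2 x = Const (1 / cmod x) \<odot> (Gen G_A \<oplus> Const (- x) \<odot> (Gen G_a2)\<^sup>\<star>)"

definition A0_inv3 :: "complex \<Rightarrow> gen star_expr" where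
  "A0_inv3 x = Const (- 1) \<odot> (Gen G_a1 \<oplus> Const (cnj x / 2) \<odot> (A0_inv2 x \<odot> A0_inv2 x)
    \<oplus> Const (cmod x) \<odot> ((Gen G_a2)\<^sup>\<star> \<odot> A0_inv2 x) \<oplus> Const (x / 2) \<odot> ((Gen G_a2)\<^sup>\<star> \<odot> (Gen G_a2)\<^sup>\<star>))"

text \<open>The isomorphism is triangular, so the generators are solved for one after another; here
  |x| is inverted, which requires \<open>x \<noteq> 0\<close>.\<close>

lemma A0_inv2_interp:
  assumes "x \<noteq> 0"
  shows "interp (A0_iso x (A0_inv2 x)) b f = interp (Gen 2) b f"
  using assms by (cases b) (auto simp: A0_inv2_def A0_iso_def fun_eq_iff cr_linear an_linear cr_minus an_minus mode_linear)

lemma A0_inv3_interp: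
  assumes "x \<noteq> 0"
  shows "interp (A0_iso x (A0_inv3 x)) b f = interp (Gen 3) b f"
proof -
  note inv2 = A0_inv2_interp[OF assms, unfolded A0_iso_def]
  show ?thesis
    by (cases b) (auto simp: A0_inv3_def A0_iso_def inv2 fun_eq_iff algebra_simps an_cr_other cr_linear an_linear
        cr_minus an_minus mode_linear)
qed

lemma A0_iso_generators:
  assumes "x \<noteq> 0"
  obtains s where "\<And>b f. interp (A0_iso x s) b f = interp (Gen j) b f"
proof (cases j rule: cases_3)
  case 1
  have "interp (A0_iso x (Gen G_a2)) b f = interp (Gen j) b f" for b f by (simp add: A0_iso_def 1)
  then show thesis by (rule that)
next
  case 2
  then show thesis using that A0_inv2_interp[OF assms] by blast
next
  case 3
  then show thesis using that A0_inv3_interp[OF assms] by blast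
qed

lemma A0_fock_irreducible:
  assumes "x \<noteq> 0"
  shows "irreducible_rep rapidly_decreasing (\<lambda>t. fock_rep (A0_iso x t))"
proof (rule irreducible_rep_of_invariant[OF fock_rep_irreducible])
  fix K assume K: "csubspace K" and inv: "\<forall>t. fock_rep (A0_iso x t) ` (rapidly_decreasing \<inter> K) \<subseteq> K"
  have "fock_rep (Gen j) v \<in> K \<and> fock_rep ((Gen j)\<^sup>\<star>) v \<in> K" if v: "v \<in> rapidly_decreasing" "v \<in> K" for j v
  proof -
    obtain s where s: "\<And>b f. interp (A0_iso x s) b f = interp (Gen j) b f"
      using A0_iso_generators[OF assms] by blast
    have "fock_rep (Gen j) v = fock_rep (A0_iso x s) v" by (simp add: fock_rep_def s)
    \<comment> \<open>The value \<open>True\<close> of the flag shows that the adjoint of the same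
      expression yields the annihilation operator.\<close>
    moreover have "fock_rep ((Gen j)\<^sup>\<star>) v = fock_rep (A0_iso x (s\<^sup>\<star>)) v"
      using s[of True] by (simp add: fock_rep_def A0_iso_def)
    ultimately show ?thesis using inv v by auto
  qed
  then show "\<forall>t. fock_rep t ` (rapidly_decreasing \<inter> K) \<subseteq> K"
    using star_rep_invariant[OF fock_rep_star_rep K] by blast
qed

section \<open>The formulas on the threefold tensor product\<close>

lemma tensor_op_modes:
  "tensor_op creation id id f = cr 1 f" "tensor_op id creation id f = cr 2 f" "tensor_op id id creation f = cr 3 f"
  "tensor_op annihilation id id f = an 1 f" "tensor_op annihilation creation id f = an 1 (cr 2 f)"
  "tensor_op id (creation ^^ 2) id f = cr 2 (cr 2 f)" "tensor_op (annihilation ^^ 2) id id f = an 1 (an 1 f)"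
  by (auto simp: fun_eq_iff tensor_op_def creation_def annihilation_def cr_def an_def cnt_def dec_def inc_def
      numeral_2_eq_2 add.commute split: nat.split)

theorem theorem3:
  fixes x2 :: complex
  assumes "x2 \<noteq> 0"
  shows "\<exists>\<pi> :: gen star_expr \<Rightarrow> (nat \<times> nat \<times> nat) ell2 \<Rightarrow> (nat \<times> nat \<times> nat) ell2.
    A0_star_rep x2 rapidly_decreasing \<pi> \<and>
    A0_well_behaved x2 rapidly_decreasing \<pi> \<and>
    irreducible_rep rapidly_decreasing \<pi> \<and>
    (\<forall>f \<in> rapidly_decreasing.
       ell2_coord (\<pi> (Gen G_a2) f) = tensor_op creation id id (ell2_coord f) \<and>
       ell2_coord (\<pi> (Gen G_a1) f) = (\<lambda>n. -
         (tensor_op id id creation (ell2_coord f) n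
          + cnj x2 / 2 * tensor_op id (creation ^^ 2) id (ell2_coord f) n
          + complex_of_real (cmod x2) * tensor_op annihilation creation id (ell2_coord f) n
          + x2 / 2 * tensor_op (annihilation ^^ 2) id id (ell2_coord f) n)) \<and>
       ell2_coord (\<pi> (Gen G_A) f) = (\<lambda>n.
         complex_of_real (cmod x2) * tensor_op id creation id (ell2_coord f) n
         + x2 * tensor_op annihilation id id (ell2_coord f) n)) \<and>
    (\<forall>(D :: 'h::chilbert_space set) \<sigma>.
       A0_star_rep x2 D \<sigma> \<and> A0_well_behaved x2 D \<sigma> \<and> irreducible_rep D \<sigma>
       \<longrightarrow> unitarily_equivalent D \<sigma> rapidly_decreasing \<pi>)"
proof (rule exI[of _ "\<lambda>t. fock_rep (A0_iso x2 t)"], intro conjI allI impI ballI)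
  show "A0_star_rep x2 rapidly_decreasing (\<lambda>t. fock_rep (A0_iso x2 t))"
    unfolding A0_star_rep_def A0_iso_def
    by (rule fock_star_rep_subst[OF A0_relation_interp rapidly_decreasing_dense])
  show "A0_well_behaved x2 rapidly_decreasing (\<lambda>t. fock_rep (A0_iso x2 t))"
    unfolding A0_well_behaved_def using fock_rep_star_rep fock_rep_integrable by blast
  show "irreducible_rep rapidly_decreasing (\<lambda>t. fock_rep (A0_iso x2 t))"
    by (rule A0_fock_irreducible[OF assms])
next
  fix f :: "(nat \<times> nat \<times> nat) ell2" assume f: "f \<in> rapidly_decreasing"
  note coord = coord_fock_rep[OF f] tensor_op_modes A0_iso_def
  show "ell2_coord (fock_rep (A0_iso x2 (Gen G_a2)) f) = tensor_op creation id id (ell2_coord f)"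
    by (simp add: coord)
  show "ell2_coord (fock_rep (A0_iso x2 (Gen G_a1)) f) = (\<lambda>n. -
      (tensor_op id id creation (ell2_coord f) n
       + cnj x2 / 2 * tensor_op id (creation ^^ 2) id (ell2_coord f) n
       + complex_of_real (cmod x2) * tensor_op annihilation creation id (ell2_coord f) n
       + x2 / 2 * tensor_op (annihilation ^^ 2) id id (ell2_coord f) n))"
    by (simp add: coord)
  show "ell2_coord (fock_rep (A0_iso x2 (Gen G_A)) f) = (\<lambda>n.
      complex_of_real (cmod x2) * tensor_op id creation id (ell2_coord f) n
      + x2 * tensor_op annihilation id id (ell2_coord f) n)"
    by (simp add: coord)
next
  fix D :: "'h set" and \<sigma>
  assume "A0_star_rep x2 D \<sigma> \<and> A0_well_behaved x2 D \<sigma> \<and> irreducible_rep D \<sigma>"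
  then obtain \<rho> where \<rho>: "star_rep ccr_rels D \<rho>" "integrable_rep D \<rho>"
      "\<And>t v. v \<in> D \<Longrightarrow> \<sigma> t v = \<rho> (A0_iso x2 t) v"
    and irr: "irreducible_rep D \<sigma>"
    unfolding A0_well_behaved_def by blast
  \<comment> \<open>The operators of \<open>\<sigma>\<close> are among those of
    \<open>\<rho>\<close> on \<open>D\<close>, so a subspace invariant under \<open>\<rho>\<close>
    is invariant under \<open>\<sigma>\<close>.\<close>
  have "irreducible_rep D \<rho>"
    by (rule irreducible_rep_of_invariant[OF irr]) (use \<rho>(3) in auto)
  then have "unitarily_equivalent D \<rho> rapidly_decreasing fock_rep"
    using \<rho> fock_rep_star_rep fock_rep_integrable fock_rep_irreducible by (intro Stone_von_Neumann)
  \<comment> \<open>The unitary intertwines all CCR expressions, in particular those in the image of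
    \<open>A0_iso x2\<close>.\<close>
  then show "unitarily_equivalent D \<sigma> rapidly_decreasing (\<lambda>t. fock_rep (A0_iso x2 t))"
    unfolding unitarily_equivalent_def using \<rho>(3) by auto
qed

end
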